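(* Let $(G, \mathcal{H} \cup\{K\})$ be a pair, $C$ a subgroup of $K$, $s\in G$, and $\varphi\colon C\to K^s$ a group monomorphism. Let $G\ast_{\varphi}$ denote the HNN-extension $\langle G, t\mid t c t^{-1} =\varphi(c)\ \text{for all } c\in C \rangle$. Then: 1. If $\mathcal{H} \cup\{K\}\hookrightarrow_h G$, then $\mathcal H \cup\{\langle K, s^{-1}t\rangle\} \hookrightarrow_h G\ast_{\varphi}$. 2. If $(G, \mathcal{H}\cup\{K\}) \in \mathcal{D}$, then $(G\ast_{\varphi},\mathcal H \cup\{\langle K, s^{-1}t\rangle\}) \in \mathcal D$. 3. For any $g\in G$, the element $g$ is conjugate in $G$ to an element of some $Q\in\mathcal{H} \cup \{K\}$ if and only if $g$ is conjugate in $G\ast_\varphi$ to an element of some $H\in\mathcal{H}\cup \{ \langle K, s^{-1}t \rangle\}$.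
   Context: A pair $(G,\mathcal H)$ consists of a group $G$ and a finite collection $\mathcal H$ of subgroups of $G$. In the collection $\mathcal H\cup\{K\}$, $K$ is a distinguished member that is not an element of $\mathcal H$. $K^g$ denotes $gKg^{-1}$. The group $G$ and its subgroups are regarded as subgroups of $G\ast_\varphi$; $\langle K,s^{-1}t\rangle$ is the subgroup of $G\ast_\varphi$ generated by $K\cup\{s^{-1}t\}$. Hyperbolically embedded collections ($\mathcal H\hookrightarrow_h G$). Definition (Dahmani–Guirardel–Osin): for $\mathcal H=\{H_1,\dots,H_n\}$ and $X\subseteq G$ such that $X\cup\bigcup_i H_i$ generates $G$, let $\Gamma$ be the Cayley graph of $G$ with respect to the alphabet $X\sqcup\bigsqcup_i (H_i\setminus\{1\})$, and for $h,h'\in H_i$ let $\hat d_i(h,h')\in[0,\infty]$ be the length of a shortest path in $\Gamma$ from $h$ to $h'$ containing no edge that joins two elements of $H_i$ and is labelled by an element of $H_i\setminus\{1\}$. Then $\mathcal H\hookrightarrow_h G$ if for some such $X$ the graph $\Gamma$ is hyperbolic and, for each $i$, every ball of finite radius in $(H_i,\hat d_i)$ is finite. An equivalent characterization, used as a working definition: call $(G,\mathcal H)$ proper if no two distinct infinite members of $\mathcal H$ are conjugate in $G$; a proper pair satisfies $\mathcal H\hookrightarrow_h G$ if and only if there is a connected hyperbolic simplicial $G$-graph $\Gamma$ with finitely many $G$-orbits of vertices and finite edge stabilizers, such that each vertex stabilizer is finite or conjugate to a member of $\mathcal H$, every $H\in\mathcal H$ is the stabilizer of a vertex, and $\Gamma$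 is fine at every vertex with infinite stabilizer. Here $\Gamma$ is fine at $v$ if, on the set $T_v\Gamma$ of vertices adjacent to $v$, with $\angle_v(x,y)\in[0,\infty]$ the length of a shortest path from $x$ to $y$ in $\Gamma-\{v\}$ ($\infty$ if none exists), all balls of finite radius are finite. (Hyperbolically embedded pairs are proper.) Class $\mathcal D$: pairs whose relative Dehn function is well-defined. For $S\subseteq G$ put $F(S,\mathcal H)=F(S)\ast\left(\ast_{H\in\mathcal H}H\right)$, where $F(S)$ is the free group on $S$. A presentation $\langle S,\mathcal H\mid R\rangle$ of $(G,\mathcal H)$ consists of $S\subseteq G$ such that the natural map $F(S,\mathcal H)\to G$ is surjective and $R\subseteq F(S,\mathcal H)$ normally generating its kernel; it is finite if $S$ and $R$ are finite. For a finite presentation, a function $f\colon\mathbb N\to\mathbb N$ is a relative isoperimetric function if every word $W$ of length at most $n$ over $S^{\pm1}\sqcup\bigsqcup_{H\in\mathcal H}(H\setminus\{1\})$ representing $1$ in $G$ can be written in $F(S,\mathcal H)$ as $W=\prod_{i=1}^k f_i^{-1}R_if_i$ with $R_i\in R\cup R^{-1}$, $f_i\in F(S,\mathcal H)$ and $k\le f(n)$. The smallest such function is the relative Dehn function; it is well-defined if it takes only finite values (a property independent of the finite presentation). $(G,\mathcal H)\in\mathcal D$ means that $(G,\mathcal H)$ has a finite presentation and its relative Dehn function is well-defined. *)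

theory Defs
  imports "HOL-Algebra.Generated_Groups" "HOL-Library.Extended_Nat"
begin

section \<open>Pairs\<close>

definition group_pair :: "('a, 'b) monoid_scheme \<Rightarrow> 'a set set \<Rightarrow> bool" where
  "group_pair G \<H> \<longleftrightarrow> group G \<and> finite \<H> \<and> (\<forall>H\<in>\<H>. subgroup H G)"

definition conjugate_in :: "('a, 'b) monoid_scheme \<Rightarrow> 'a \<Rightarrow> 'a \<Rightarrow> bool" where
  "conjugate_in G a b \<longleftrightarrow> (\<exists>x\<in>carrier G. b = x \<otimes>\<^bsub>G\<^esub> a \<otimes>\<^bsub>G\<^esub> inv\<^bsub>G\<^esub> x)"

definition normal_closure :: "('a, 'b) monoid_scheme \<Rightarrow> 'a set \<Rightarrow> 'a set" where
  "normal_closure G R = generate G {b. \<exists>a\<in>R. conjugate_in G a b}"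


section \<open>The free product of a free group and a collection of subgroups\<close>

text \<open>
  Letters carry a tag, so that unions of alphabets are disjoint: \<open>Par H h\<close> is the element \<open>h\<close>
  taken from the copy of \<open>H\<close>, and differs from \<open>Par K h\<close> and from \<open>Gen h\<close>.
\<close>

datatype ('s, 'a) letter = Gen 's | GenInv 's | Par "'a set" 'a

definition alphabet :: "'s set \<Rightarrow> 'a set set \<Rightarrow> ('s, 'a) letter set" where
  "alphabet S \<H> = Gen ` S \<union> GenInv ` S \<union> {Par H h | H h. H \<in> \<H> \<and> h \<in> H}"

inductive fp_eq ::
  "('a, 'b) monoid_scheme \<Rightarrow> 's set \<Rightarrow> 'a set set \<Rightarrow> ('s, 'a) letter list \<Rightarrow> ('s, 'a) letter list \<Rightarrow> bool"
  for G S \<H> where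
  word_refl: "w \<in> lists (alphabet S \<H>) \<Longrightarrow> fp_eq G S \<H> w w"
| word_sym: "fp_eq G S \<H> v w \<Longrightarrow> fp_eq G S \<H> w v"
| word_trans: "fp_eq G S \<H> u v \<Longrightarrow> fp_eq G S \<H> v w \<Longrightarrow> fp_eq G S \<H> u w"
| word_append: "fp_eq G S \<H> u u' \<Longrightarrow> fp_eq G S \<H> v v' \<Longrightarrow> fp_eq G S \<H> (u @ v) (u' @ v')"
| gen_inv: "s \<in> S \<Longrightarrow> fp_eq G S \<H> [Gen s, GenInv s] []"
| inv_gen: "s \<in> S \<Longrightarrow> fp_eq G S \<H> [GenInv s, Gen s] []"
| par_one: "H \<in> \<H> \<Longrightarrow> fp_eq G S \<H> [Par H \<one>\<^bsub>G\<^esub>] []"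
| par_mult: "H \<in> \<H> \<Longrightarrow> h \<in> H \<Longrightarrow> k \<in> H \<Longrightarrow>
    fp_eq G S \<H> [Par H h, Par H k] [Par H (h \<otimes>\<^bsub>G\<^esub> k)]"

definition word_class ::
  "('a, 'b) monoid_scheme \<Rightarrow> 's set \<Rightarrow> 'a set set \<Rightarrow> ('s, 'a) letter list \<Rightarrow> ('s, 'a) letter list set" where
  "word_class G S \<H> w = {v. fp_eq G S \<H> w v}"

text \<open>
  \<open>rel_free_group G S \<H>\<close> is \<open>F(S, \<H>)\<close>, the free product of the free group on \<open>S\<close> and all
  \<open>H \<in> \<H>\<close>: words modulo the congruence generated by the relations of the factors. The set \<open>S\<close> of free generators is abstract
  here; it may be a subset of \<open>G\<close> but it need not be.
\<close>

definition rel_free_group ::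
  "('a, 'b) monoid_scheme \<Rightarrow> 's set \<Rightarrow> 'a set set \<Rightarrow> ('s, 'a) letter list set monoid" where
  "rel_free_group G S \<H> =
    \<lparr>carrier = word_class G S \<H> ` lists (alphabet S \<H>),
     mult = (\<lambda>P Q. {w. \<exists>u\<in>P. \<exists>v\<in>Q. fp_eq G S \<H> (u @ v) w}),
     one = word_class G S \<H> []\<rparr>"

lemma fp_eq_words:
  assumes "\<And>H. H \<in> \<H> \<Longrightarrow> subgroup H G" and "fp_eq G S \<H> u v"
  shows "u \<in> lists (alphabet S \<H>) \<and> v \<in> lists (alphabet S \<H>)"
  using assms(2)
  by (induction rule: fp_eq.induct)
     (auto simp: alphabet_def assms(1) subgroup.one_closed subgroup.m_closed)

lemma word_class_eq_iff:
  assumes "v \<in> lists (alphabet S \<H>)"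
  shows "word_class G S \<H> u = word_class G S \<H> v \<longleftrightarrow> fp_eq G S \<H> u v"
  using assms unfolding word_class_def by (blast intro: fp_eq.word_refl fp_eq.word_sym fp_eq.word_trans)

lemma mult_word_class:
  assumes "u \<in> lists (alphabet S \<H>)" "v \<in> lists (alphabet S \<H>)"
  shows "word_class G S \<H> u \<otimes>\<^bsub>rel_free_group G S \<H>\<^esub> word_class G S \<H> v = word_class G S \<H> (u @ v)"
proof -
  have "fp_eq G S \<H> (u' @ v') w \<Longrightarrow> fp_eq G S \<H> (u @ v) w"
    if "fp_eq G S \<H> u u'" "fp_eq G S \<H> v v'" for u' v' w
    using fp_eq.word_append[OF that] by (rule fp_eq.word_trans)
  moreover note fp_eq.word_refl[OF assms(1), of G] fp_eq.word_refl[OF assms(2), of G]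
  ultimately show ?thesis unfolding rel_free_group_def word_class_def by auto
qed

lemma letter_inverse:
  assumes "group G" "\<And>H. H \<in> \<H> \<Longrightarrow> subgroup H G" "a \<in> alphabet S \<H>"
  shows "\<exists>b\<in>alphabet S \<H>. fp_eq G S \<H> [b, a] []"
proof -
  consider s where "s \<in> S" "a = Gen s" | s where "s \<in> S" "a = GenInv s"
    | H h where "H \<in> \<H>" "h \<in> H" "a = Par H h"
    using assms(3) by (auto simp: alphabet_def)
  then show ?thesis
  proof cases
    case 3
    then have i: "inv\<^bsub>G\<^esub> h \<in> H" "h \<in> carrier G"
      using assms(2) by (auto simp: subgroup.m_inv_closed dest: subgroup.mem_carrier)
    have "fp_eq G S \<H> [Par H (inv\<^bsub>G\<^esub> h), Par H h] [Par H (inv\<^bsub>G\<^esub> h \<otimes>\<^bsub>G\<^esub> h)]"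
      using 3 i by (intro fp_eq.par_mult) auto
    moreover have "inv\<^bsub>G\<^esub> h \<otimes>\<^bsub>G\<^esub> h = \<one>\<^bsub>G\<^esub>" using assms(1) i by (simp add: group.l_inv)
    ultimately have "fp_eq G S \<H> [Par H (inv\<^bsub>G\<^esub> h), Par H h] []"
      using fp_eq.par_one[OF 3(1)] by (metis fp_eq.word_trans)
    then show ?thesis using 3 i by (auto simp: alphabet_def)
  qed (auto simp: alphabet_def intro: fp_eq.gen_inv fp_eq.inv_gen)
qed

lemma word_inverse:
  assumes "group G" "\<And>H. H \<in> \<H> \<Longrightarrow> subgroup H G" "w \<in> lists (alphabet S \<H>)"
  shows "\<exists>v\<in>lists (alphabet S \<H>). fp_eq G S \<H> (v @ w) []"
  using assms(3)
proof (induction w)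
  case Nil
  then show ?case by (auto intro: bexI[of _ "[]"] fp_eq.word_refl)
next
  case (Cons a w)
  then obtain v where v: "v \<in> lists (alphabet S \<H>)" "fp_eq G S \<H> (v @ w) []" by blast
  obtain b where b: "b \<in> alphabet S \<H>" "fp_eq G S \<H> [b, a] []"
    using letter_inverse[OF assms(1,2)] Cons by blast
  have "fp_eq G S \<H> (v @ ([b, a] @ w)) (v @ ([] @ w))"
    using v b Cons by (intro fp_eq.word_append fp_eq.word_refl) auto
  then have "fp_eq G S \<H> ((v @ [b]) @ a # w) []" using v fp_eq.word_trans by fastforce
  then show ?case using v b by (intro bexI[of _ "v @ [b]"]) auto
qed

lemma group_rel_free_group:
  assumes "group G" "\<And>H. H \<in> \<H> \<Longrightarrow> subgroup H G"
  shows "group (rel_free_group G S \<H>)"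
proof -
  let ?F = "rel_free_group G S \<H>"
  have c: "carrier ?F = word_class G S \<H> ` lists (alphabet S \<H>)"
    and o: "\<one>\<^bsub>?F\<^esub> = word_class G S \<H> []"
    by (simp_all add: rel_free_group_def)
  have "\<exists>y\<in>carrier ?F. y \<otimes>\<^bsub>?F\<^esub> x = \<one>\<^bsub>?F\<^esub>" if x: "x \<in> carrier ?F" for x
  proof -
    obtain w where w: "w \<in> lists (alphabet S \<H>)" "x = word_class G S \<H> w"
      using x unfolding c by blast
    obtain v where v: "v \<in> lists (alphabet S \<H>)" "fp_eq G S \<H> (v @ w) []"
      using word_inverse[OF assms w(1)] by blast
    have "word_class G S \<H> v \<otimes>\<^bsub>?F\<^esub> x = \<one>\<^bsub>?F\<^esub>"
      unfolding w(2) o mult_word_class[OF v(1) w(1)] using v by (subst word_class_eq_iff) auto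
    then show ?thesis using v(1) unfolding c by blast
  qed
  then show ?thesis
  proof (intro groupI)
    fix x y assume "x \<in> carrier ?F" "y \<in> carrier ?F"
    then obtain u v where "u \<in> lists (alphabet S \<H>)" "x = word_class G S \<H> u"
      "v \<in> lists (alphabet S \<H>)" "y = word_class G S \<H> v" unfolding c by blast
    then show "x \<otimes>\<^bsub>?F\<^esub> y \<in> carrier ?F"
      unfolding c by (simp add: mult_word_class del: in_lists_conv_set)
  next
    fix x y z assume "x \<in> carrier ?F" "y \<in> carrier ?F" "z \<in> carrier ?F"
    then obtain u v w where "u \<in> lists (alphabet S \<H>)" "x = word_class G S \<H> u"
      "v \<in> lists (alphabet S \<H>)" "y = word_class G S \<H> v"
      "w \<in> lists (alphabet S \<H>)" "z = word_class G S \<H> w" unfolding c by blast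
    then show "x \<otimes>\<^bsub>?F\<^esub> y \<otimes>\<^bsub>?F\<^esub> z = x \<otimes>\<^bsub>?F\<^esub> (y \<otimes>\<^bsub>?F\<^esub> z)"
      by (simp add: mult_word_class del: in_lists_conv_set)
  next
    fix x assume "x \<in> carrier ?F"
    then obtain u where "u \<in> lists (alphabet S \<H>)" "x = word_class G S \<H> u" unfolding c by blast
    then show "\<one>\<^bsub>?F\<^esub> \<otimes>\<^bsub>?F\<^esub> x = x" unfolding o by (simp add: mult_word_class del: in_lists_conv_set)
  qed (auto simp: c o)
qed


lemma normal_closure_normal:
  assumes "group G" "R \<subseteq> carrier G"
  shows "normal_closure G R \<lhd> G"
  unfolding normal_closure_def
proof (rule group.normal_generateI[OF assms(1)])
  interpret group G by fact
  show "{b. \<exists>a\<in>R. conjugate_in G a b} \<subseteq> carrier G"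
    using assms(2) by (auto simp: conjugate_in_def)
  fix h g assume "h \<in> {b. \<exists>a\<in>R. conjugate_in G a b}" "g \<in> carrier G"
  then obtain a x where a: "a \<in> R" "x \<in> carrier G" "h = x \<otimes>\<^bsub>G\<^esub> a \<otimes>\<^bsub>G\<^esub> inv\<^bsub>G\<^esub> x"
    by (auto simp: conjugate_in_def)
  then have "g \<otimes>\<^bsub>G\<^esub> h \<otimes>\<^bsub>G\<^esub> inv\<^bsub>G\<^esub> g = (g \<otimes>\<^bsub>G\<^esub> x) \<otimes>\<^bsub>G\<^esub> a \<otimes>\<^bsub>G\<^esub> inv\<^bsub>G\<^esub> (g \<otimes>\<^bsub>G\<^esub> x)"
    using \<open>g \<in> carrier G\<close> assms(2) by (simp add: subset_eq inv_mult_group m_assoc)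
  then show "g \<otimes>\<^bsub>G\<^esub> h \<otimes>\<^bsub>G\<^esub> inv\<^bsub>G\<^esub> g \<in> {b. \<exists>a\<in>R. conjugate_in G a b}"
    using a \<open>g \<in> carrier G\<close> by (auto simp: conjugate_in_def)
qed


section \<open>HNN extensions\<close>

text \<open>
  \<open>\<langle>G, t | t c t\<inverse> = \<phi>(c) for c \<in> C\<rangle>\<close>: the quotient of \<open>G * \<langle>t\<rangle>\<close> by the normal closure of the
  elements \<open>t c t\<inverse> \<phi>(c)\<inverse>\<close>. The stable letter \<open>t\<close> is \<open>Gen ()\<close>.
\<close>

definition hnn_free :: "('a, 'b) monoid_scheme \<Rightarrow> (unit, 'a) letter list set monoid" where
  "hnn_free G = rel_free_group G {()} {carrier G}"

definition hnn_word :: "('a, 'b) monoid_scheme \<Rightarrow> (unit, 'a) letter list \<Rightarrow> (unit, 'a) letter list set" where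
  "hnn_word G w = word_class G {()} {carrier G} w"

definition hnn_relators ::
  "('a, 'b) monoid_scheme \<Rightarrow> 'a set \<Rightarrow> ('a \<Rightarrow> 'a) \<Rightarrow> (unit, 'a) letter list set set" where
  "hnn_relators G C \<phi> =
    {hnn_word G [Gen (), Par (carrier G) c, GenInv (), Par (carrier G) (inv\<^bsub>G\<^esub> (\<phi> c))] | c. c \<in> C}"

definition HNN ::
  "('a, 'b) monoid_scheme \<Rightarrow> 'a set \<Rightarrow> ('a \<Rightarrow> 'a) \<Rightarrow> (unit, 'a) letter list set set monoid" where
  "HNN G C \<phi> = hnn_free G Mod normal_closure (hnn_free G) (hnn_relators G C \<phi>)"

definition hnn_class ::
  "('a, 'b) monoid_scheme \<Rightarrow> 'a set \<Rightarrow> ('a \<Rightarrow> 'a) \<Rightarrow> (unit, 'a) letter list \<Rightarrow> (unit, 'a) letter list set set" where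
  "hnn_class G C \<phi> w =
    normal_closure (hnn_free G) (hnn_relators G C \<phi>) #>\<^bsub>hnn_free G\<^esub> hnn_word G w"

definition hnn_base ::
  "('a, 'b) monoid_scheme \<Rightarrow> 'a set \<Rightarrow> ('a \<Rightarrow> 'a) \<Rightarrow> 'a \<Rightarrow> (unit, 'a) letter list set set" where
  "hnn_base G C \<phi> g = hnn_class G C \<phi> [Par (carrier G) g]"

definition hnn_stable ::
  "('a, 'b) monoid_scheme \<Rightarrow> 'a set \<Rightarrow> ('a \<Rightarrow> 'a) \<Rightarrow> (unit, 'a) letter list set set" where
  "hnn_stable G C \<phi> = hnn_class G C \<phi> [Gen ()]"

lemma hnn_words:
  assumes "w \<in> lists (alphabet {()} {carrier G})"
  shows "hnn_word G w \<in> carrier (hnn_free G)"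
  using assms by (simp add: hnn_word_def hnn_free_def rel_free_group_def del: in_lists_conv_set)

lemma hnn_normal:
  assumes "group G" "C \<subseteq> carrier G" "\<phi> ` C \<subseteq> carrier G"
  shows "normal_closure (hnn_free G) (hnn_relators G C \<phi>) \<lhd> hnn_free G"
proof (rule normal_closure_normal)
  interpret group G by fact
  show "group (hnn_free G)"
    unfolding hnn_free_def by (rule group_rel_free_group) (auto simp: assms(1) subgroup_self)
  show "hnn_relators G C \<phi> \<subseteq> carrier (hnn_free G)"
    using assms(2,3) by (auto simp: hnn_relators_def alphabet_def subset_eq intro!: hnn_words)
qed

lemma group_HNN:
  assumes "group G" "C \<subseteq> carrier G" "\<phi> ` C \<subseteq> carrier G"
  shows "group (HNN G C \<phi>)"
  unfolding HNN_def by (rule normal.factorgroup_is_group[OF hnn_normal[OF assms]])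

lemma hnn_class_append:
  assumes "group G" "C \<subseteq> carrier G" "\<phi> ` C \<subseteq> carrier G"
    and "u \<in> lists (alphabet {()} {carrier G})" "v \<in> lists (alphabet {()} {carrier G})"
  shows "hnn_class G C \<phi> u \<otimes>\<^bsub>HNN G C \<phi>\<^esub> hnn_class G C \<phi> v = hnn_class G C \<phi> (u @ v)"
  using normal.rcos_sum[OF hnn_normal[OF assms(1-3)] hnn_words[OF assms(4)] hnn_words[OF assms(5)]]
    mult_word_class[OF assms(4,5), of G]
  by (simp add: hnn_class_def HNN_def FactGroup_def hnn_free_def hnn_word_def)

lemma hnn_base_hom:
  assumes "group G" "C \<subseteq> carrier G" "\<phi> ` C \<subseteq> carrier G"
  shows "hnn_base G C \<phi> \<in> hom G (HNN G C \<phi>)"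
proof (rule homI)
  fix g assume "g \<in> carrier G"
  then have "hnn_word G [Par (carrier G) g] \<in> carrier (hnn_free G)"
    by (intro hnn_words) (auto simp: alphabet_def)
  then show "hnn_base G C \<phi> g \<in> carrier (HNN G C \<phi>)"
    by (auto simp: hnn_base_def hnn_class_def HNN_def FactGroup_def RCOSETS_def)
next
  fix g h assume gh: "g \<in> carrier G" "h \<in> carrier G"
  then have "hnn_base G C \<phi> g \<otimes>\<^bsub>HNN G C \<phi>\<^esub> hnn_base G C \<phi> h =
      hnn_class G C \<phi> [Par (carrier G) g, Par (carrier G) h]"
    unfolding hnn_base_def by (subst hnn_class_append) (auto simp: assms alphabet_def)
  moreover have "hnn_word G [Par (carrier G) g, Par (carrier G) h] =
      hnn_word G [Par (carrier G) (g \<otimes>\<^bsub>G\<^esub> h)]"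
    unfolding hnn_word_def using gh assms(1)
    by (subst word_class_eq_iff)
       (auto simp: alphabet_def group.is_monoid monoid.m_closed intro: fp_eq.par_mult)
  ultimately show "hnn_base G C \<phi> (g \<otimes>\<^bsub>G\<^esub> h) =
      hnn_base G C \<phi> g \<otimes>\<^bsub>HNN G C \<phi>\<^esub> hnn_base G C \<phi> h"
    by (simp add: hnn_base_def hnn_class_def)
qed

lemma hnn_stable_carrier: "hnn_stable G C \<phi> \<in> carrier (HNN G C \<phi>)"
proof -
  have "hnn_word G [Gen ()] \<in> carrier (hnn_free G)"
    by (intro hnn_words) (auto simp: alphabet_def)
  then show ?thesis
    by (auto simp: hnn_stable_def hnn_class_def HNN_def FactGroup_def RCOSETS_def)
qed

lemma hnn_relation:
  assumes "group G" "C \<subseteq> carrier G" "\<phi> ` C \<subseteq> carrier G" "c \<in> C"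
  shows "hnn_stable G C \<phi> \<otimes>\<^bsub>HNN G C \<phi>\<^esub> hnn_base G C \<phi> c \<otimes>\<^bsub>HNN G C \<phi>\<^esub>
    inv\<^bsub>HNN G C \<phi>\<^esub> (hnn_stable G C \<phi>) = hnn_base G C \<phi> (\<phi> c)"
proof -
  let ?N = "normal_closure (hnn_free G) (hnn_relators G C \<phi>)"
  let ?t = "hnn_stable G C \<phi>" and ?T = "hnn_class G C \<phi> [GenInv ()]"
    and ?b = "hnn_base G C \<phi>"
  interpret group "HNN G C \<phi>" by (rule group_HNN[OF assms(1-3)])
  interpret N: normal ?N "hnn_free G" by (rule hnn_normal[OF assms(1-3)])
  interpret G: group G by fact
  interpret b: group_hom G "HNN G C \<phi>" ?b
    by unfold_locales (rule hnn_base_hom[OF assms(1-3)])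
  have c: "c \<in> carrier G" "\<phi> c \<in> carrier G" using assms by auto
  have "hnn_word G [] = \<one>\<^bsub>hnn_free G\<^esub>"
    by (simp add: hnn_word_def hnn_free_def rel_free_group_def)
  then have e: "hnn_class G C \<phi> [] = \<one>\<^bsub>HNN G C \<phi>\<^esub>"
    using N.coset_mult_one[OF N.subset] by (simp add: hnn_class_def HNN_def FactGroup_def)
  have "?t \<otimes>\<^bsub>HNN G C \<phi>\<^esub> ?T = hnn_class G C \<phi> [Gen (), GenInv ()]"
    unfolding hnn_stable_def by (subst hnn_class_append) (auto simp: assms alphabet_def)
  also have "\<dots> = hnn_class G C \<phi> []"
    unfolding hnn_class_def hnn_word_def
    by (rule arg_cong[where f = "\<lambda>x. ?N #>\<^bsub>hnn_free G\<^esub> x"], subst word_class_eq_iff)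
       (auto intro: fp_eq.gen_inv)
  finally have tT: "?t \<otimes>\<^bsub>HNN G C \<phi>\<^esub> ?T = \<one>\<^bsub>HNN G C \<phi>\<^esub>" by (simp add: e)
  have T: "?T \<in> carrier (HNN G C \<phi>)"
    using hnn_words[of "[GenInv ()]" G]
    by (auto simp: hnn_class_def HNN_def FactGroup_def RCOSETS_def alphabet_def)
  have iT: "inv\<^bsub>HNN G C \<phi>\<^esub> ?t = ?T"
    by (rule inv_equality[OF inv_comm[OF tT hnn_stable_carrier T] hnn_stable_carrier T])
  let ?r = "[Gen (), Par (carrier G) c, GenInv (), Par (carrier G) (inv\<^bsub>G\<^esub> (\<phi> c))]"
  have "hnn_word G ?r \<in> hnn_relators G C \<phi>" using assms(4) by (auto simp: hnn_relators_def)
  moreover have "hnn_word G ?r \<in> carrier (hnn_free G)"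
    using c by (intro hnn_words) (auto simp: alphabet_def)
  then have "conjugate_in (hnn_free G) (hnn_word G ?r) (hnn_word G ?r)"
    unfolding conjugate_in_def by (intro bexI[of _ "\<one>\<^bsub>hnn_free G\<^esub>"]) auto
  ultimately have "hnn_word G ?r \<in> ?N"
    unfolding normal_closure_def by (blast intro: generate.incl)
  then have r1: "hnn_class G C \<phi> ?r = \<one>\<^bsub>HNN G C \<phi>\<^esub>"
    using N.rcos_const[of "hnn_word G ?r"] N.is_group
    by (simp add: hnn_class_def HNN_def FactGroup_def)
  have r2: "hnn_class G C \<phi> ?r = ?t \<otimes>\<^bsub>HNN G C \<phi>\<^esub> (?b c \<otimes>\<^bsub>HNN G C \<phi>\<^esub> (?T \<otimes>\<^bsub>HNN G C \<phi>\<^esub> ?b (inv\<^bsub>G\<^esub> (\<phi> c))))"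
    unfolding hnn_stable_def hnn_base_def using c
    by (simp add: hnn_class_append[OF assms(1-3)] alphabet_def)
  have "?t \<otimes>\<^bsub>HNN G C \<phi>\<^esub> ?b c \<otimes>\<^bsub>HNN G C \<phi>\<^esub> ?T \<otimes>\<^bsub>HNN G C \<phi>\<^esub> inv\<^bsub>HNN G C \<phi>\<^esub> (?b (\<phi> c)) = \<one>\<^bsub>HNN G C \<phi>\<^esub>"
    using c T hnn_stable_carrier[of G C \<phi>] trans[OF r2[symmetric] r1] by (simp add: m_assoc)
  then show ?thesis
    unfolding iT using c T hnn_stable_carrier[of G C \<phi>]
      inv_solve_right[of "\<one>\<^bsub>HNN G C \<phi>\<^esub>" "?t \<otimes>\<^bsub>HNN G C \<phi>\<^esub> ?b c \<otimes>\<^bsub>HNN G C \<phi>\<^esub> ?T" "?b (\<phi> c)"]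
    by simp
qed


section \<open>Graphs\<close>

text \<open>
  A graph is a set of labelled edges \<open>(u, l, v)\<close>, with multiple edges and loops allowed; a path
  may traverse an edge in either direction.
\<close>

inductive edge_path ::
  "('v \<times> 'l \<times> 'v) set \<Rightarrow> 'v \<Rightarrow> ('v \<times> 'l \<times> 'v) list \<Rightarrow> 'v \<Rightarrow> bool" for E where
  nil: "edge_path E u [] u"
| forward: "(u, l, v) \<in> E \<Longrightarrow> edge_path E v p w \<Longrightarrow> edge_path E u ((u, l, v) # p) w"
| backward: "(v, l, u) \<in> E \<Longrightarrow> edge_path E v p w \<Longrightarrow> edge_path E u ((v, l, u) # p) w"

definition graph_dist :: "('v \<times> 'l \<times> 'v) set \<Rightarrow> 'v \<Rightarrow> 'v \<Rightarrow> enat" where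
  "graph_dist E u v = (INF p\<in>{p. edge_path E u p v}. enat (length p))"

definition geodesic ::
  "'v set \<Rightarrow> ('v \<times> 'l \<times> 'v) set \<Rightarrow> 'v \<Rightarrow> 'v \<Rightarrow> nat \<Rightarrow> (nat \<Rightarrow> 'v) \<Rightarrow> bool" where
  "geodesic V E x y n \<gamma> \<longleftrightarrow> \<gamma> 0 = x \<and> \<gamma> n = y \<and> \<gamma> ` {..n} \<subseteq> V \<and>
    (\<forall>i j. i \<le> j \<and> j \<le> n \<longrightarrow> graph_dist E (\<gamma> i) (\<gamma> j) = enat (j - i))"

text \<open>
  Slim triangles. As \<open>x\<close>, \<open>y\<close>, \<open>z\<close> are arbitrary, it is enough to bound one side of the triangle.
  Restricting to geodesics between vertices changes only the value of \<open>\<delta>\<close>.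
\<close>

definition hyperbolic_graph :: "'v set \<Rightarrow> ('v \<times> 'l \<times> 'v) set \<Rightarrow> bool" where
  "hyperbolic_graph V E \<longleftrightarrow>
    (\<exists>\<delta>::nat. \<forall>x y z l m n \<alpha> \<beta> \<gamma>.
       geodesic V E x y l \<alpha> \<and> geodesic V E y z m \<beta> \<and> geodesic V E x z n \<gamma> \<longrightarrow>
       (\<forall>k\<le>n. \<exists>p \<in> \<alpha> ` {..l} \<union> \<beta> ` {..m}. graph_dist E (\<gamma> k) p \<le> enat \<delta>))"


section \<open>Hyperbolically embedded collections\<close>

fun letter_val :: "('a, 'b) monoid_scheme \<Rightarrow> ('a, 'a) letter \<Rightarrow> 'a" where
  "letter_val G (Gen x) = x"
| "letter_val G (GenInv x) = inv\<^bsub>G\<^esub> x"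
| "letter_val G (Par H h) = h"

definition cayley_edges ::
  "('a, 'b) monoid_scheme \<Rightarrow> 'a set \<Rightarrow> 'a set set \<Rightarrow> ('a \<times> ('a, 'a) letter \<times> 'a) set" where
  "cayley_edges G X \<H> =
    {(g, a, g \<otimes>\<^bsub>G\<^esub> letter_val G a) | g a. g \<in> carrier G \<and>
       a \<in> Gen ` X \<union> {Par H h | H h. H \<in> \<H> \<and> h \<in> H - {\<one>\<^bsub>G\<^esub>}}}"

definition rel_dist ::
  "('a, 'b) monoid_scheme \<Rightarrow> 'a set \<Rightarrow> 'a set set \<Rightarrow> 'a set \<Rightarrow> 'a \<Rightarrow> 'a \<Rightarrow> enat" where
  "rel_dist G X \<H> H h h' =
    graph_dist (cayley_edges G X \<H> - {(u, Par H k, v) | u k v. u \<in> H \<and> v \<in> H}) h h'"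

text \<open>
  The distance \<open>rel_dist\<close> only forbids edges labelled from the copy of \<open>H\<close> itself: edges between
  elements of \<open>H\<close> labelled by \<open>X\<close> or by another member of \<open>\<H>\<close> remain.
\<close>

definition hyp_embedded :: "'a set set \<Rightarrow> ('a, 'b) monoid_scheme \<Rightarrow> bool" where
  "hyp_embedded \<H> G \<longleftrightarrow> group_pair G \<H> \<and>
    (\<exists>X. X \<subseteq> carrier G \<and> generate G (X \<union> \<Union>\<H>) = carrier G \<and>
       hyperbolic_graph (carrier G) (cayley_edges G X \<H>) \<and>
       (\<forall>H\<in>\<H>. \<forall>h\<in>H. \<forall>n::nat. finite {h'\<in>H. rel_dist G X \<H> H h h' \<le> enat n}))"


section \<open>Relative presentations and relative Dehn functions\<close>

definition word_val :: "('a, 'b) monoid_scheme \<Rightarrow> ('a, 'a) letter list \<Rightarrow> 'a" where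
  "word_val G w = foldr (\<lambda>a g. letter_val G a \<otimes>\<^bsub>G\<^esub> g) w \<one>\<^bsub>G\<^esub>"

lemma word_val_eq:
  assumes "group G" "S \<subseteq> carrier G" "\<And>H. H \<in> \<H> \<Longrightarrow> subgroup H G" and "fp_eq G S \<H> u v"
  shows "word_val G u = word_val G v"
proof -
  interpret group G by fact
  have h: "h \<in> carrier G" if "H \<in> \<H>" "h \<in> H" for H h
    using that assms(3) by (meson subgroup.mem_carrier)
  have l: "letter_val G a \<in> carrier G" if "a \<in> alphabet S \<H>" for a
    using that assms(2) h by (auto simp: alphabet_def)
  have c: "word_val G w \<in> carrier G" if "w \<in> lists (alphabet S \<H>)" for w
    using that by (induction w) (auto simp: word_val_def l)
  have app: "word_val G (v @ w) = word_val G v \<otimes>\<^bsub>G\<^esub> word_val G w"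
    if "v \<in> lists (alphabet S \<H>)" "w \<in> lists (alphabet S \<H>)" for v w
    using that(1) c[OF that(2)]
  proof (induction v)
    case (Cons a v)
    then show ?case using c[of v] l[of a] by (simp add: word_val_def m_assoc)
  qed (simp add: word_val_def)
  show ?thesis using assms(4)
  proof (induction rule: fp_eq.induct)
    case (word_append u u' v v')
    then have "u \<in> lists (alphabet S \<H>) \<and> u' \<in> lists (alphabet S \<H>)"
      "v \<in> lists (alphabet S \<H>) \<and> v' \<in> lists (alphabet S \<H>)"
      using fp_eq_words[OF assms(3)] by blast+
    then show ?case using word_append.IH by (simp only: app)
  next
    case (gen_inv s)
    then show ?case using assms(2) by (auto simp: word_val_def)
  next
    case (inv_gen s)
    then show ?case using assms(2) by (auto simp: word_val_def)
  next
    case (par_mult H j k)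
    then have "j \<in> carrier G" "k \<in> carrier G" using h by blast+
    then show ?case by (simp add: word_val_def m_assoc)
  qed (simp_all add: word_val_def)
qed

text \<open>The homomorphism \<open>F(S, \<H>) \<rightarrow> G\<close> on classes of words; it is well-defined by the preceding lemma.\<close>

definition natural_map :: "('a, 'b) monoid_scheme \<Rightarrow> ('a, 'a) letter list set \<Rightarrow> 'a" where
  "natural_map G P = the_elem (word_val G ` P)"

lemma natural_map_word_class:
  assumes "group G" "S \<subseteq> carrier G" "\<And>H. H \<in> \<H> \<Longrightarrow> subgroup H G"
    and "w \<in> lists (alphabet S \<H>)"
  shows "natural_map G (word_class G S \<H> w) = word_val G w"
proof -
  have "word_val G ` word_class G S \<H> w = {word_val G w}"
  proof (intro equalityI subsetI)
    fix g assume "g \<in> word_val G ` word_class G S \<H> w"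
    then show "g \<in> {word_val G w}"
      using word_val_eq[OF assms(1-3)] by (force simp: word_class_def)
  next
    fix g assume "g \<in> {word_val G w}"
    moreover have "w \<in> word_class G S \<H> w"
      using fp_eq.word_refl[OF assms(4)] by (simp add: word_class_def)
    ultimately show "g \<in> word_val G ` word_class G S \<H> w" by blast
  qed
  then show ?thesis by (simp add: natural_map_def)
qed

definition finite_rel_presentation ::
  "('a, 'b) monoid_scheme \<Rightarrow> 'a set set \<Rightarrow> 'a set \<Rightarrow> ('a, 'a) letter list set set \<Rightarrow> bool" where
  "finite_rel_presentation G \<H> S R \<longleftrightarrow>
    (let F = rel_free_group G S \<H> in
      S \<subseteq> carrier G \<and> natural_map G ` carrier F = carrier G \<and>
      R \<subseteq> carrier F \<and> normal_closure F R = kernel F G (natural_map G) \<and>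
      finite S \<and> finite R)"

definition conj_product ::
  "('c, 'd) monoid_scheme \<Rightarrow> ('c \<times> 'c) list \<Rightarrow> 'c" where
  "conj_product F ps = foldr (\<lambda>(r, f) x. (inv\<^bsub>F\<^esub> f \<otimes>\<^bsub>F\<^esub> r \<otimes>\<^bsub>F\<^esub> f) \<otimes>\<^bsub>F\<^esub> x) ps \<one>\<^bsub>F\<^esub>"

definition area_bound ::
  "('a, 'b) monoid_scheme \<Rightarrow> 'a set set \<Rightarrow> 'a set \<Rightarrow> ('a, 'a) letter list set set \<Rightarrow> nat \<Rightarrow> nat \<Rightarrow> bool" where
  "area_bound G \<H> S R n m \<longleftrightarrow>
    (let F = rel_free_group G S \<H> in
      \<forall>W \<in> lists (Gen ` S \<union> GenInv ` S \<union> {Par H h | H h. H \<in> \<H> \<and> h \<in> H - {\<one>\<^bsub>G\<^esub>}}).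
        length W \<le> n \<and> word_val G W = \<one>\<^bsub>G\<^esub> \<longrightarrow>
        (\<exists>ps. set ps \<subseteq> (R \<union> m_inv F ` R) \<times> carrier F \<and> length ps \<le> m \<and>
           word_class G S \<H> W = conj_product F ps))"

definition rel_isoperimetric ::
  "('a, 'b) monoid_scheme \<Rightarrow> 'a set set \<Rightarrow> 'a set \<Rightarrow> ('a, 'a) letter list set set \<Rightarrow> (nat \<Rightarrow> nat) \<Rightarrow> bool" where
  "rel_isoperimetric G \<H> S R f \<longleftrightarrow> (\<forall>n. area_bound G \<H> S R n (f n))"

text \<open>
  The smallest relative isoperimetric function: the condition on \<open>f\<close> is imposed separately at each
  \<open>n\<close>, so the minimum is taken separately at each \<open>n\<close>, with value \<open>\<infinity>\<close> if there is no bound.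
\<close>

definition rel_dehn ::
  "('a, 'b) monoid_scheme \<Rightarrow> 'a set set \<Rightarrow> 'a set \<Rightarrow> ('a, 'a) letter list set set \<Rightarrow> nat \<Rightarrow> enat" where
  "rel_dehn G \<H> S R n = (INF m\<in>{m. area_bound G \<H> S R n m}. enat m)"

lemma rel_isoperimetric_rel_dehn:
  "(\<forall>n. rel_dehn G \<H> S R n < \<infinity>) \<longleftrightarrow> (\<exists>f. rel_isoperimetric G \<H> S R f)"
proof -
  have "rel_dehn G \<H> S R n < \<infinity> \<longleftrightarrow> (\<exists>m. area_bound G \<H> S R n m)" for n
    unfolding rel_dehn_def by (simp only: INF_less_iff) auto
  then show ?thesis unfolding rel_isoperimetric_def by metis
qed

lemma rel_dehn_le:
  "rel_isoperimetric G \<H> S R f \<Longrightarrow> rel_dehn G \<H> S R n \<le> enat (f n)"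
  unfolding rel_isoperimetric_def rel_dehn_def by (auto intro: INF_lower)

definition class_D :: "('a, 'b) monoid_scheme \<Rightarrow> 'a set set \<Rightarrow> bool" where
  "class_D G \<H> \<longleftrightarrow> group_pair G \<H> \<and>
    (\<exists>S R. finite_rel_presentation G \<H> S R \<and> (\<forall>n. rel_dehn G \<H> S R n < \<infinity>))"

end

theory Submission
  imports Defs
begin

text \<open>
  Put \<open>u = s\<inverse> t\<close> and \<open>\<theta>(c) = s\<inverse> \<phi>(c) s\<close>. Conjugation by \<open>u\<close> is \<open>\<theta> : C \<rightarrow> K\<close> on \<open>C\<close>, so \<open>L = \<langle>K, u\<rangle>\<close> is
  itself an HNN extension of \<open>K\<close>, and the HNN extension \<open>M\<close> of \<open>G\<close> is the amalgamated product of \<open>G\<close>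
  and \<open>L\<close> over \<open>K\<close>. Van der Waerden's action of \<open>M\<close> on normal forms yields a ping-pong set \<open>N\<close>, the
  elements whose alternating form starts with a factor from \<open>L - K\<close>; all three parts only use \<open>N\<close>.

  Conjugacy: if an element of \<open>G\<close> is not conjugate into \<open>K\<close> in \<open>G\<close>, then it is not conjugate into
  \<open>L\<close> in \<open>M\<close>, and only elements of \<open>G\<close> conjugate it into \<open>G\<close>.

  Dehn functions: a word over \<open>L\<close> and the alphabet of \<open>G\<close> that represents 1 contains two factors from
  \<open>L - K\<close> separated by a word \<open>v\<close> over the alphabet of \<open>G\<close> whose value lies in \<open>K\<close>. Replacing \<open>v\<close> by
  this value costs one filling in \<open>G\<close>, after which the two factors merge. Hence the area of a
  word of length \<open>n\<close> is at most \<open>n + 1\<close> times the value at \<open>n + 1\<close> of the Dehn function of \<open>G\<close>.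

  Hyperbolic embedding: the Cayley graph of \<open>M\<close> is a tree of copies of the Cayley graph of \<open>G\<close> glued
  along the cliques formed by the cosets of \<open>L\<close>. Every excursion of a path outside a copy leaves and
  returns through one coset of \<open>K\<close>, so it can be replaced by an edge. Hence copies are isometrically
  embedded, relative distances do not decrease, and the part of a geodesic triangle in a copy
  is a triangle up to errors of length 1.
\<close>

section \<open>Normal forms in HNN extensions\<close>

text \<open>No universal property of the amalgamated product is used. The locale
  \<open>amalgam\<close> only asks that G and L generate M and that N behaves well under left
  multiplication; the relators of M enter only when these conditions are verified. Even the
  presentation in the second part is found afresh: bounded areas also show that the lifted relators
  normally generate the kernel. N controls left multiplication, whereas paths and conjugators are
  followed by multiplying on the right. The alternating products, and the set \<open>P\<close> built
  from them, provide that second kind of control. The obstacle to hyperbolic embedding is the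
  relative metric of L: shortcuts along K can be exactly the edges that it forbids. Such shortcuts
  do not occur, because a path without the forbidden edges leaves G only through cosets gK other
  than K. The slimness constant is 3\<delta> + 1: \<delta> for a triangle in a copy of G, and
  2\<delta> + 1 for replacing a side by a geodesic whose ends agree with its ends up to distance
  1.\<close>

locale hnn_setup = group G for G (structure) +
  fixes K C :: "'a set" and s :: 'a and \<phi> :: "'a \<Rightarrow> 'a"
  assumes K: "subgroup K G"
    and C: "subgroup C (G\<lparr>carrier := K\<rparr>)"
    and s [simp]: "s \<in> carrier G"
    and \<phi>: "\<phi> \<in> mon (G\<lparr>carrier := C\<rparr>) (G\<lparr>carrier := s <# K #> inv s\<rparr>)"
begin

section \<open>The associated subgroups C and \<theta>(C) of K\<close>

definition \<theta> :: "'a \<Rightarrow> 'a" where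
  "\<theta> c = inv s \<otimes> \<phi> c \<otimes> s"

text \<open>The Boolean is the sign of the exponent of u = s^-1 t: conjugation by that power of u
  maps \<open>side e\<close> onto \<open>side (\<not> e)\<close> by \<open>cross e\<close>. Indexing
  by the sign treats the cancellations in u a u^-1 and in u^-1 a u at once.\<close>

definition side :: "bool \<Rightarrow> 'a set" where
  "side e = (if e then C else \<theta> ` C)"

definition cross :: "bool \<Rightarrow> 'a \<Rightarrow> 'a" where
  "cross e = (if e then \<theta> else inv_into C \<theta>)"

lemma K_carrier: "k \<in> K \<Longrightarrow> k \<in> carrier G"
  using K by (rule subgroup.mem_carrier)

lemma C_subgroup: "subgroup C G"
  by (rule incl_subgroup[OF K C])

lemma C_K: "C \<subseteq> K"
  using subgroup.subset[OF C] by simp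

lemma C_carrier: "c \<in> C \<Longrightarrow> c \<in> carrier G"
  using C_K K_carrier by blast

lemma \<phi>_conj:
  assumes "c \<in> C"
  obtains k where "k \<in> K" "\<phi> c = s \<otimes> k \<otimes> inv s"
proof -
  have "\<phi> c \<in> s <# K #> inv s"
    using \<phi> assms by (auto simp: mon_def hom_def)
  then show thesis using that by (auto simp: l_coset_def r_coset_def)
qed

lemma \<phi>_carrier: "c \<in> C \<Longrightarrow> \<phi> c \<in> carrier G"
  by (metis \<phi>_conj K_carrier s inv_closed m_closed)

lemma \<theta>_K: "c \<in> C \<Longrightarrow> \<theta> c \<in> K"
proof -
  assume "c \<in> C"
  then obtain k where k: "k \<in> K" "\<phi> c = s \<otimes> k \<otimes> inv s" by (rule \<phi>_conj)
  then have "\<theta> c = k"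
    using K_carrier[of k] by (simp add: \<theta>_def m_assoc inv_solve_left')
  then show ?thesis using k by simp
qed

lemma \<theta>_carrier: "c \<in> C \<Longrightarrow> \<theta> c \<in> carrier G"
  using \<theta>_K K_carrier by blast

lemma \<phi>_\<theta>: "c \<in> C \<Longrightarrow> \<phi> c \<otimes> s = s \<otimes> \<theta> c"
  using \<phi>_carrier[of c] by (simp add: \<theta>_def m_assoc[symmetric])

lemma \<theta>_mult: "c \<in> C \<Longrightarrow> d \<in> C \<Longrightarrow> \<theta> (c \<otimes> d) = \<theta> c \<otimes> \<theta> d"
proof -
  assume cd: "c \<in> C" "d \<in> C"
  have "\<phi> (c \<otimes> d) = \<phi> c \<otimes> \<phi> d"
    using \<phi> cd by (auto simp: mon_def hom_def)
  then show ?thesis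
    using \<phi>_carrier[OF cd(1)] \<phi>_carrier[OF cd(2)]
    by (simp add: \<theta>_def m_assoc) (simp add: m_assoc[symmetric])
qed

lemma \<theta>_inj: "inj_on \<theta> C"
proof (rule inj_onI)
  fix c d assume cd: "c \<in> C" "d \<in> C" "\<theta> c = \<theta> d"
  then have "\<phi> c = \<phi> d" using \<phi>_carrier by (simp add: \<theta>_def)
  then show "c = d" using \<phi> cd by (auto simp: mon_def dest: inj_onD)
qed

lemma side_subgroup: "subgroup (side e) G"
proof (cases e)
  case True
  then show ?thesis using C_subgroup by (simp add: side_def)
next
  case False
  interpret \<theta>: group_hom "G\<lparr>carrier := C\<rparr>" G \<theta>
    using \<theta>_mult \<theta>_carrier C_subgroup
    by (simp add: group_hom_def group_hom_axioms_def hom_def subgroup.subgroup_is_group is_group Pi_def)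
  show ?thesis using False \<theta>.img_is_subgroup by (simp add: side_def)
qed

lemma side_K: "side e \<subseteq> K"
  using C_K \<theta>_K by (auto simp: side_def)

lemma side_carrier: "a \<in> side e \<Longrightarrow> a \<in> carrier G"
  using side_K K_carrier by blast

lemma cross_side: "a \<in> side e \<Longrightarrow> cross e a \<in> side (\<not> e)"
  by (auto simp: side_def cross_def inv_into_into)

lemma cross_cross: "a \<in> side e \<Longrightarrow> cross (\<not> e) (cross e a) = a"
  using \<theta>_inj by (auto simp: side_def cross_def)

lemma cross_mult: "a \<in> side e \<Longrightarrow> b \<in> side e \<Longrightarrow> cross e (a \<otimes> b) = cross e a \<otimes> cross e b"
proof (cases e)
  case False
  assume "a \<in> side e" "b \<in> side e"
  then obtain c d where "c \<in> C" "d \<in> C" "a = \<theta> c" "b = \<theta> d" using False by (auto simp: side_def)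
  moreover from this have "c \<otimes> d \<in> C" using C_subgroup by (simp add: subgroup.m_closed)
  ultimately show ?thesis using False \<theta>_inj by (simp add: cross_def flip: \<theta>_mult)
qed (simp add: side_def cross_def \<theta>_mult)

lemma cross_K: "a \<in> side e \<Longrightarrow> cross e a \<in> K"
  using cross_side side_K by blast

lemma cross_carrier: "a \<in> side e \<Longrightarrow> cross e a \<in> carrier G"
  using cross_K K_carrier by blast

definition rep :: "bool \<Rightarrow> 'a \<Rightarrow> 'a" where
  "rep e g = (if g \<in> side e then \<one> else SOME r. r \<in> side e #> g)"

definition cof :: "bool \<Rightarrow> 'a \<Rightarrow> 'a" where
  "cof e g = g \<otimes> inv (rep e g)"

lemma rep_coset:
  assumes "g \<in> carrier G" shows "rep e g \<in> side e #> g"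
proof (cases "g \<in> side e")
  case True
  then have "\<one> \<in> side e #> g"
    using side_subgroup[of e] assms
    by (auto simp: r_coset_def intro!: bexI[of _ "inv g"] subgroup.m_inv_closed)
  then show ?thesis using True by (simp add: rep_def)
next
  case False
  have "g \<in> side e #> g" using rcos_self[OF assms side_subgroup] .
  then show ?thesis using False by (auto simp: rep_def intro: someI)
qed

lemma rep_decomp:
  assumes "g \<in> carrier G"
  obtains a where "a \<in> side e" "rep e g = a \<otimes> g"
  using rep_coset[OF assms, of e] by (auto simp: r_coset_def)

lemma rep_carrier: "g \<in> carrier G \<Longrightarrow> rep e g \<in> carrier G"
  by (metis rep_decomp side_carrier m_closed)

lemma cof_side: "g \<in> carrier G \<Longrightarrow> cof e g \<in> side e"
proof -
  assume g: "g \<in> carrier G"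
  obtain a where a: "a \<in> side e" "rep e g = a \<otimes> g" using rep_decomp[OF g] .
  then have "cof e g = inv a"
    using g side_carrier[of a e] by (simp add: cof_def inv_mult_group m_assoc[symmetric])
  then show ?thesis using a side_subgroup by (simp add: subgroup.m_inv_closed)
qed

lemma cof_rep: "g \<in> carrier G \<Longrightarrow> cof e g \<otimes> rep e g = g"
  using rep_carrier[of g e] by (simp add: cof_def m_assoc)

text \<open>Both ingredients of \<open>rep\<close>, the membership test and the choice, depend only
  on the coset \<open>side e #> g\<close>.\<close>

lemma rep_mult:
  assumes "a \<in> side e" "g \<in> carrier G"
  shows "rep e (a \<otimes> g) = rep e g"
proof -
  have "side e #> (a \<otimes> g) = side e #> g"
    using coset_mult_assoc[of "side e" a g] coset_join2[of a "side e"] assms side_carrier[of a e]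
      side_subgroup[of e] subgroup.subset[OF side_subgroup[of e]] by (metis)
  moreover have "a \<otimes> g \<in> side e \<longleftrightarrow> g \<in> side e"
  proof
    assume "a \<otimes> g \<in> side e"
    then have "inv a \<otimes> (a \<otimes> g) \<in> side e"
      using assms side_subgroup by (simp add: subgroup.m_closed subgroup.m_inv_closed)
    then show "g \<in> side e" using assms side_carrier[of a e] by (simp add: m_assoc[symmetric])
  qed (use assms side_subgroup in \<open>auto simp: subgroup.m_closed\<close>)
  ultimately show ?thesis by (simp add: rep_def)
qed

lemma cof_mult:
  assumes "a \<in> side e" "g \<in> carrier G"
  shows "cof e (a \<otimes> g) = a \<otimes> cof e g"
  using assms rep_carrier[of g e] side_carrier[of a e] by (simp add: cof_def rep_mult m_assoc)

lemma rep_rep: "g \<in> carrier G \<Longrightarrow> rep e (rep e g) = rep e g"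
  by (metis rep_decomp rep_mult)

text \<open>This is why \<open>rep\<close> picks \<one> in the trivial coset: comparing a stored
  representative with \<one> then detects a possible cancellation.\<close>

lemma rep_one_iff: "g \<in> carrier G \<Longrightarrow> rep e g = \<one> \<longleftrightarrow> g \<in> side e"
  using cof_side[of g e] cof_rep[of g e] side_carrier[of "cof e g" e] by (auto simp: rep_def)

text \<open>
  The normal form \<open>(g, [(e\<^sub>1, r\<^sub>1), \<dots>, (e\<^sub>n, r\<^sub>n)])\<close> stands for the product
  \<open>g u\<^sub>1 r\<^sub>1 \<cdots> u\<^sub>n r\<^sub>n\<close>, where \<open>u\<^sub>i\<close> is \<open>s\<inverse> t\<close> if \<open>e\<^sub>i\<close> is true and \<open>(s\<inverse> t)\<inverse>\<close> otherwise.
\<close>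

fun reduced :: "(bool \<times> 'a) list \<Rightarrow> bool" where
  "reduced [] = True"
| "reduced [(e, r)] = (r \<in> carrier G \<and> rep e r = r)"
| "reduced ((e, r) # (e', r') # xs) =
    (r \<in> carrier G \<and> rep e r = r \<and> \<not> (r = \<one> \<and> e' = (\<not> e)) \<and> reduced ((e', r') # xs))"

definition forms :: "('a \<times> (bool \<times> 'a) list) set" where
  "forms = {(g, xs). g \<in> carrier G \<and> reduced xs}"

fun push :: "bool \<Rightarrow> 'a \<times> (bool \<times> 'a) list \<Rightarrow> 'a \<times> (bool \<times> 'a) list" where
  "push e (g, xs) = (cross e (cof e g), (e, rep e g) # xs)"

text \<open>Left multiplication by u^e. If g can be carried across u^e and the opposite power
  follows, then u^e g u^-e is \<open>cross e g\<close> and both powers vanish. Otherwise only the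
  factor \<open>cof e g\<close> is carried across, and the coset representative stays
  behind.\<close>

fun stable_act :: "bool \<Rightarrow> 'a \<times> (bool \<times> 'a) list \<Rightarrow> 'a \<times> (bool \<times> 'a) list" where
  "stable_act e (g, []) = push e (g, [])"
| "stable_act e (g, (e', r) # xs) =
    (if g \<in> side e \<and> e' = (\<not> e) then (cross e g \<otimes> r, xs) else push e (g, (e', r) # xs))"

fun base_act :: "'a \<Rightarrow> 'a \<times> (bool \<times> 'a) list \<Rightarrow> 'a \<times> (bool \<times> 'a) list" where
  "base_act h (g, xs) = (h \<otimes> g, xs)"

lemma reduced_Cons:
  "reduced ((e, r) # xs) \<longleftrightarrow> r \<in> carrier G \<and> rep e r = r \<and> reduced xs \<and>
    \<not> (r = \<one> \<and> xs \<noteq> [] \<and> fst (hd xs) = (\<not> e))"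
  by (cases xs) auto

lemma stable_act_cases:
  fixes e :: bool
  obtains (cancel) r ys where "xs = (\<not> e, r) # ys" "g \<in> side e"
      "stable_act e (g, xs) = (cross e g \<otimes> r, ys)"
  | (push) "\<not> (g \<in> side e \<and> xs \<noteq> [] \<and> fst (hd xs) = (\<not> e))"
      "stable_act e (g, xs) = (cross e (cof e g), (e, rep e g) # xs)"
proof (cases "g \<in> side e \<and> xs \<noteq> [] \<and> fst (hd xs) = (\<not> e)")
  case True
  then show thesis using cancel by (cases xs) auto
next
  case False
  then have "stable_act e (g, xs) = (cross e (cof e g), (e, rep e g) # xs)" by (cases xs) auto
  then show thesis using False push by blast
qed

lemma stable_act_forms: "\<omega> \<in> forms \<Longrightarrow> stable_act e \<omega> \<in> forms"
proof -
  assume "\<omega> \<in> forms"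
  then obtain g xs where gx: "\<omega> = (g, xs)" "g \<in> carrier G" "reduced xs" by (auto simp: forms_def)
  show ?thesis unfolding gx(1)
  proof (cases xs e g rule: stable_act_cases)
    case (cancel r ys)
    then show "stable_act e (g, xs) \<in> forms"
      using gx cross_carrier[of g e] by (simp add: forms_def reduced_Cons)
  next
    case push
    then show "stable_act e (g, xs) \<in> forms"
      using gx cross_carrier[OF cof_side[OF gx(2), of e]]
      by (simp add: forms_def reduced_Cons rep_carrier rep_rep rep_one_iff)
  qed
qed

lemma base_act_forms: "\<omega> \<in> forms \<Longrightarrow> h \<in> carrier G \<Longrightarrow> base_act h \<omega> \<in> forms"
  by (auto simp: forms_def)

lemma base_act_mult:
  "\<omega> \<in> forms \<Longrightarrow> h \<in> carrier G \<Longrightarrow> k \<in> carrier G \<Longrightarrow> base_act h (base_act k \<omega>) = base_act (h \<otimes> k) \<omega>"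
  by (auto simp: forms_def m_assoc)

lemma base_act_one: "\<omega> \<in> forms \<Longrightarrow> base_act \<one> \<omega> = \<omega>"
  by (auto simp: forms_def)

text \<open>A cancellation is undone by a push and a push by a cancellation. After a cancellation
  the inverse step cannot cancel again: \<open>cross e g \<otimes> r\<close> lies in
  \<open>side (\<not> e)\<close> only if r = \<one>, and reducedness forbids r = \<one> when the
  next exponent is e.\<close>

lemma stable_act_inverse:
  assumes "\<omega> \<in> forms" shows "stable_act (\<not> e) (stable_act e \<omega>) = \<omega>"
proof -
  obtain g xs where gx: "\<omega> = (g, xs)" "g \<in> carrier G" "reduced xs"
    using assms by (auto simp: forms_def)
  show ?thesis unfolding gx(1)
  proof (cases xs e g rule: stable_act_cases)
    case (cancel r ys)
    then have r: "r \<in> carrier G" "rep (\<not> e) r = r" "\<not> (r = \<one> \<and> ys \<noteq> [] \<and> fst (hd ys) = e)"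
      using gx by (auto simp: reduced_Cons)
    have c: "cross e g \<in> side (\<not> e)" using cancel cross_side by blast
    have rm: "rep (\<not> e) (cross e g \<otimes> r) = r" using c r by (simp add: rep_mult)
    have "cof (\<not> e) (cross e g \<otimes> r) = cross e g"
      using r c side_carrier[OF c] rm by (simp add: cof_def m_assoc)
    moreover have "\<not> (cross e g \<otimes> r \<in> side (\<not> e) \<and> ys \<noteq> [] \<and> fst (hd ys) = e)"
      using r rm rep_one_iff[of "cross e g \<otimes> r" "\<not> e"] side_carrier[OF c] by auto
    then have "stable_act (\<not> e) (cross e g \<otimes> r, ys) = push (\<not> e) (cross e g \<otimes> r, ys)"
      by (cases ys "\<not> e" "cross e g \<otimes> r" rule: stable_act_cases) auto
    ultimately show "stable_act (\<not> e) (stable_act e (g, xs)) = (g, xs)"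
      using cancel rm cross_cross[of g e] by simp
  next
    case push
    then show "stable_act (\<not> e) (stable_act e (g, xs)) = (g, xs)"
      using cross_side[OF cof_side[OF gx(2), of e]] cross_cross[OF cof_side[OF gx(2), of e]]
        cof_rep[OF gx(2), of e] by simp
  qed
qed

text \<open>A factor from \<open>side e\<close> changes neither the coset of g nor the choice
  between the two branches, and \<open>cross\<close> is multiplicative. This is the HNN relation on
  normal forms, needed for the relators to act as the identity.\<close>

lemma stable_act_base_act:
  assumes "\<omega> \<in> forms" "a \<in> side e"
  shows "stable_act e (base_act a \<omega>) = base_act (cross e a) (stable_act e \<omega>)"
proof -
  obtain g xs where gx: "\<omega> = (g, xs)" "g \<in> carrier G" "reduced xs"
    using assms by (auto simp: forms_def)
  have ag: "a \<otimes> g \<in> side e \<longleftrightarrow> g \<in> side e"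
    using rep_mult[OF assms(2) gx(2)] rep_one_iff[of g e] rep_one_iff[of "a \<otimes> g" e]
      gx side_carrier[OF assms(2)] by auto
  show ?thesis
  proof (cases xs e g rule: stable_act_cases)
    case (cancel r ys)
    then show ?thesis
      using gx assms ag cross_mult[of a e g] cross_carrier[of a e] cross_carrier[of g e]
      by (simp add: reduced_Cons m_assoc)
  next
    case push
    then have "stable_act e (a \<otimes> g, xs) = local.push e (a \<otimes> g, xs)"
      using ag by (cases xs) auto
    then show ?thesis
      using gx assms push cof_mult[OF assms(2) gx(2)] rep_mult[OF assms(2) gx(2)]
        cross_mult[OF assms(2) cof_side[OF gx(2)]] by simp
  qed
qed

text \<open>The stable letter is t = s u, so its action is composed from those of s and u.\<close>

fun letter_act :: "(unit, 'a) letter \<Rightarrow> 'a \<times> (bool \<times> 'a) list \<Rightarrow> 'a \<times> (bool \<times> 'a) list" where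
  "letter_act (Gen _) \<omega> = base_act s (stable_act True \<omega>)"
| "letter_act (GenInv _) \<omega> = stable_act False (base_act (inv s) \<omega>)"
| "letter_act (Par _ h) \<omega> = base_act h \<omega>"

definition word_act :: "(unit, 'a) letter list \<Rightarrow> 'a \<times> (bool \<times> 'a) list \<Rightarrow> 'a \<times> (bool \<times> 'a) list" where
  "word_act w = foldr letter_act w"

abbreviation letters :: "(unit, 'a) letter set" where
  "letters \<equiv> alphabet {()} {carrier G}"

lemma word_act_simps [simp]:
  "word_act [] \<omega> = \<omega>"
  "word_act (a # w) \<omega> = letter_act a (word_act w \<omega>)"
  "word_act (u @ v) \<omega> = word_act u (word_act v \<omega>)"
  by (simp_all add: word_act_def)

lemma letter_act_forms: "a \<in> letters \<Longrightarrow> \<omega> \<in> forms \<Longrightarrow> letter_act a \<omega> \<in> forms"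
  by (auto simp: alphabet_def base_act_forms stable_act_forms)

lemma word_act_forms: "w \<in> lists letters \<Longrightarrow> \<omega> \<in> forms \<Longrightarrow> word_act w \<omega> \<in> forms"
  by (induction w) (auto simp: letter_act_forms)

lemma carrier_subgroups: "H \<in> {carrier G} \<Longrightarrow> subgroup H G"
  using subgroup_self by simp

lemma word_act_fp_eq:
  assumes "fp_eq G {()} {carrier G} u v" "\<omega> \<in> forms"
  shows "word_act u \<omega> = word_act v \<omega>"
  using assms
proof (induction arbitrary: \<omega> rule: fp_eq.induct)
  case (word_append u u' v v')
  have "u' \<in> lists letters" "v' \<in> lists letters"
    using word_append.hyps fp_eq_words[OF carrier_subgroups] by blast+
  then show ?case
    using word_append.IH word_append.prems word_act_forms by simp
next
  case (gen_inv x)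
  then show ?case
    using stable_act_inverse[OF base_act_forms[of \<omega> "inv s"], of False]
    by (simp add: base_act_mult base_act_one)
next
  case (inv_gen x)
  then show ?case
    using stable_act_inverse[of \<omega> True] stable_act_forms[of \<omega> True]
    by (simp add: base_act_mult base_act_one)
qed (auto simp: base_act_one base_act_mult)

section \<open>Descent of the action to the HNN extension\<close>

abbreviation F where "F \<equiv> hnn_free G"
abbreviation M where "M \<equiv> HNN G C \<phi>"
abbreviation cls where "cls \<equiv> hnn_class G C \<phi>"
abbreviation \<iota> where "\<iota> \<equiv> hnn_base G C \<phi>"
abbreviation t where "t \<equiv> hnn_stable G C \<phi>"
abbreviation NC where "NC \<equiv> normal_closure F (hnn_relators G C \<phi>)"

lemma hnn_hyps: "group G" "C \<subseteq> carrier G" "\<phi> ` C \<subseteq> carrier G"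
  using is_group C_carrier \<phi>_carrier by auto

sublocale F: group F
  unfolding hnn_free_def by (rule group_rel_free_group[OF is_group carrier_subgroups])

sublocale M: group M
  by (rule group_HNN[OF hnn_hyps])

sublocale NC: normal NC F
  by (rule hnn_normal[OF hnn_hyps])

sublocale \<iota>: group_hom G M \<iota>
  by unfold_locales (rule hnn_base_hom[OF hnn_hyps])

lemmas cls_append = hnn_class_append[OF hnn_hyps]
lemmas t_carrier [simp] = hnn_stable_carrier[of G C \<phi>]
lemmas t_relation = hnn_relation[OF hnn_hyps]

text \<open>The kernel of the action, as a set of classes of words. Quantifying over all words of a
  class avoids choosing representatives; by \<open>trivial_iff\<close> one word decides.\<close>

definition acts_trivially :: "(unit, 'a) letter list set set" where
  "acts_trivially = {x \<in> carrier F. \<forall>w\<in>x. \<forall>\<omega>\<in>forms. word_act w \<omega> = \<omega>}"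

lemma F_carrierE:
  assumes "x \<in> carrier F"
  obtains w where "w \<in> lists letters" "x = hnn_word G w"
  using assms by (auto simp: hnn_free_def rel_free_group_def hnn_word_def)

lemma hnn_word_mult:
  "u \<in> lists letters \<Longrightarrow> v \<in> lists letters \<Longrightarrow> hnn_word G u \<otimes>\<^bsub>F\<^esub> hnn_word G v = hnn_word G (u @ v)"
  unfolding hnn_free_def hnn_word_def by (rule mult_word_class)

lemma F_one: "\<one>\<^bsub>F\<^esub> = hnn_word G []"
  by (simp add: hnn_free_def rel_free_group_def hnn_word_def)

lemma hnn_word_eq_act:
  assumes "hnn_word G u = hnn_word G v" "v \<in> lists letters" "\<omega> \<in> forms"
  shows "word_act u \<omega> = word_act v \<omega>"
  using assms word_act_fp_eq by (simp add: hnn_word_def word_class_eq_iff del: in_lists_conv_set)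

lemma trivial_iff:
  assumes "w \<in> lists letters"
  shows "hnn_word G w \<in> acts_trivially \<longleftrightarrow> (\<forall>\<omega>\<in>forms. word_act w \<omega> = \<omega>)"
proof -
  have "w \<in> hnn_word G w"
    using fp_eq.word_refl[OF assms, of G] by (simp add: hnn_word_def word_class_def)
  moreover have "word_act v \<omega> = word_act w \<omega>" if "v \<in> hnn_word G w" "\<omega> \<in> forms" for v \<omega>
    using that word_act_fp_eq[of w v \<omega>] by (simp add: hnn_word_def word_class_def)
  ultimately have "(\<forall>v\<in>hnn_word G w. \<forall>\<omega>\<in>forms. word_act v \<omega> = \<omega>) \<longleftrightarrow> (\<forall>\<omega>\<in>forms. word_act w \<omega> = \<omega>)"
    by metis
  moreover have "hnn_word G w \<in> carrier F" by (rule hnn_words[OF assms])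
  ultimately show ?thesis by (simp add: acts_trivially_def)
qed

lemma trivial_one: "\<one>\<^bsub>F\<^esub> \<in> acts_trivially"
  unfolding F_one by (subst trivial_iff) auto

lemma trivial_mult:
  assumes "x \<in> acts_trivially" "y \<in> acts_trivially" shows "x \<otimes>\<^bsub>F\<^esub> y \<in> acts_trivially"
proof -
  have "x \<in> carrier F" "y \<in> carrier F" using assms by (auto simp: acts_trivially_def)
  then obtain u v where "u \<in> lists letters" "v \<in> lists letters"
    and "x = hnn_word G u" "y = hnn_word G v" by (meson F_carrierE)
  then show ?thesis
    using assms by (auto simp: hnn_word_mult trivial_iff word_act_forms simp del: in_lists_conv_set)
qed

lemma trivial_conj:
  assumes x: "x \<in> acts_trivially" and f: "f \<in> carrier F"
  shows "f \<otimes>\<^bsub>F\<^esub> x \<otimes>\<^bsub>F\<^esub> inv\<^bsub>F\<^esub> f \<in> acts_trivially"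
proof -
  have "x \<in> carrier F" using x by (auto simp: acts_trivially_def)
  then obtain u where u: "u \<in> lists letters" "x = hnn_word G u" by (rule F_carrierE)
  obtain v where v: "v \<in> lists letters" "f = hnn_word G v" using f by (rule F_carrierE)
  obtain w where w: "w \<in> lists letters" "inv\<^bsub>F\<^esub> f = hnn_word G w"
    using f F.inv_closed by (meson F_carrierE)
  have "hnn_word G (v @ w) = hnn_word G []"
    using F.r_inv[OF f] v w by (simp add: hnn_word_mult F_one)
  then have "word_act v (word_act w \<omega>) = \<omega>" if "\<omega> \<in> forms" for \<omega>
    using hnn_word_eq_act[of "v @ w" "[]" \<omega>] that by simp
  then show ?thesis
    using u v w x by (auto simp: hnn_word_mult trivial_iff word_act_forms simp del: in_lists_conv_set append_assoc)
qed

lemma trivial_inv: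
  assumes x: "x \<in> acts_trivially" shows "inv\<^bsub>F\<^esub> x \<in> acts_trivially"
proof -
  have c: "x \<in> carrier F" using x by (auto simp: acts_trivially_def)
  then obtain u where u: "u \<in> lists letters" "x = hnn_word G u" by (rule F_carrierE)
  obtain w where w: "w \<in> lists letters" "inv\<^bsub>F\<^esub> x = hnn_word G w"
    using c F.inv_closed by (meson F_carrierE)
  have "hnn_word G (w @ u) = hnn_word G []"
    using F.l_inv[OF c] u w by (simp add: hnn_word_mult F_one)
  then have "word_act w (word_act u \<omega>) = \<omega>" if "\<omega> \<in> forms" for \<omega>
    using hnn_word_eq_act[of "w @ u" "[]" \<omega>] that by simp
  then show ?thesis
    using u w x by (simp add: trivial_iff del: in_lists_conv_set)
qed

text \<open>The word t c t^-1 acts as s u c u^-1 s^-1, hence as s \<theta>(c) s^-1, which equals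
  \<phi>(c).\<close>

lemma relators_trivial: "hnn_relators G C \<phi> \<subseteq> acts_trivially"
proof
  fix x assume "x \<in> hnn_relators G C \<phi>"
  then obtain c where c: "c \<in> C"
    and x: "x = hnn_word G [Gen (), Par (carrier G) c, GenInv (), Par (carrier G) (inv (\<phi> c))]"
    by (auto simp: hnn_relators_def)
  have "base_act s (stable_act True (base_act c (stable_act False
      (base_act (inv s) (base_act (inv (\<phi> c)) \<omega>))))) = \<omega>" if w: "\<omega> \<in> forms" for \<omega>
  proof -
    let ?\<psi> = "base_act (inv s) (base_act (inv (\<phi> c)) \<omega>)"
    have f: "?\<psi> \<in> forms" using w c \<phi>_carrier by (simp add: base_act_forms)
    have "stable_act True (base_act c (stable_act False ?\<psi>)) =
        base_act (\<theta> c) (stable_act True (stable_act False ?\<psi>))"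
      using stable_act_base_act[of "stable_act False ?\<psi>" c True] stable_act_forms[OF f] c
      by (simp add: side_def cross_def)
    also have "stable_act True (stable_act False ?\<psi>) = ?\<psi>"
      using stable_act_inverse[OF f, of False] by simp
    finally have "base_act s (stable_act True (base_act c (stable_act False ?\<psi>))) =
        base_act (s \<otimes> \<theta> c \<otimes> inv s \<otimes> inv (\<phi> c)) \<omega>"
      using w c \<phi>_carrier[OF c] \<theta>_carrier[OF c] f
      by (simp add: base_act_mult base_act_forms m_assoc)
    also have "s \<otimes> \<theta> c \<otimes> inv s \<otimes> inv (\<phi> c) = \<one>"
      using c \<phi>_carrier[OF c] by (simp add: \<phi>_\<theta>[OF c, symmetric] m_assoc)
    finally show ?thesis using w by (simp add: base_act_one)
  qed
  moreover have "[Gen (), Par (carrier G) c, GenInv (), Par (carrier G) (inv (\<phi> c))] \<in> lists letters"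
    using c \<phi>_carrier C_carrier by (auto simp: alphabet_def)
  ultimately show "x \<in> acts_trivially" unfolding x by (subst trivial_iff) auto
qed

lemma NC_trivial: "NC \<subseteq> acts_trivially"
proof
  have *: "b \<in> acts_trivially" if "\<exists>a\<in>hnn_relators G C \<phi>. conjugate_in F a b" for b
    using that relators_trivial trivial_conj by (auto simp: conjugate_in_def)
  fix x assume "x \<in> NC"
  then show "x \<in> acts_trivially"
    unfolding normal_closure_def
    by (induction rule: generate.induct) (auto simp: trivial_one * trivial_inv trivial_mult)
qed

text \<open>Words of the same class differ by a factor from the normal closure, which
  \<open>NC_trivial\<close> places in the kernel of the action. So M itself acts on normal
  forms.\<close>

lemma cls_eq_act:
  assumes "cls u = cls v" "u \<in> lists letters" "v \<in> lists letters" "\<omega> \<in> forms"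
  shows "word_act u \<omega> = word_act v \<omega>"
proof -
  have "hnn_word G v \<in> cls v"
    unfolding hnn_class_def
    by (rule F.rcos_self[OF hnn_words[OF assms(3)] NC.subgroup_axioms])
  then have "hnn_word G v \<in> NC #>\<^bsub>F\<^esub> hnn_word G u" using assms(1) by (simp add: hnn_class_def)
  then obtain n where n: "n \<in> NC" "hnn_word G v = n \<otimes>\<^bsub>F\<^esub> hnn_word G u" by (auto simp: r_coset_def)
  obtain m where m: "m \<in> lists letters" "n = hnn_word G m"
    using n NC.mem_carrier by (meson F_carrierE)
  have "word_act m (word_act u \<omega>) = word_act u \<omega>"
    using n(1) NC_trivial m trivial_iff word_act_forms[OF assms(2,4)] by blast
  moreover have "hnn_word G (m @ u) = hnn_word G v" using n m assms by (simp add: hnn_word_mult)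
  then have "word_act (m @ u) \<omega> = word_act v \<omega>" using assms by (intro hnn_word_eq_act) auto
  ultimately show ?thesis by simp
qed

lemma M_carrierE:
  assumes "x \<in> carrier M"
  obtains w where "w \<in> lists letters" "x = cls w"
proof -
  obtain f where "f \<in> carrier F" "x = NC #>\<^bsub>F\<^esub> f"
    using assms by (auto simp: HNN_def FactGroup_def RCOSETS_def)
  then show thesis using that by (metis F_carrierE hnn_class_def)
qed

lemma cls_carrier: "w \<in> lists letters \<Longrightarrow> cls w \<in> carrier M"
  using hnn_words[of w G] by (auto simp: HNN_def FactGroup_def RCOSETS_def hnn_class_def)

lemma cls_Nil: "cls [] = \<one>\<^bsub>M\<^esub>"
  using F.coset_mult_one[OF NC.subset] by (simp add: hnn_class_def HNN_def FactGroup_def F_one[symmetric])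

section \<open>The element s^-1 t and its inverse in the HNN extension\<close>

definition u :: "bool \<Rightarrow> (unit, 'a) letter list set set" where
  "u e = (if e then \<iota> (inv s) \<otimes>\<^bsub>M\<^esub> t else inv\<^bsub>M\<^esub> (\<iota> (inv s) \<otimes>\<^bsub>M\<^esub> t))"

lemma u_carrier [simp]: "u e \<in> carrier M"
  by (simp add: u_def)

lemma u_inv: "u e \<otimes>\<^bsub>M\<^esub> u (\<not> e) = \<one>\<^bsub>M\<^esub>"
  by (simp add: u_def M.r_inv M.l_inv)

lemma u_cross_True:
  assumes "c \<in> C" shows "u True \<otimes>\<^bsub>M\<^esub> \<iota> c = \<iota> (\<theta> c) \<otimes>\<^bsub>M\<^esub> u True"
proof -
  have c: "c \<in> carrier G" "\<phi> c \<in> carrier G" using assms C_carrier \<phi>_carrier by auto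
  have "t \<otimes>\<^bsub>M\<^esub> \<iota> c = \<iota> (\<phi> c) \<otimes>\<^bsub>M\<^esub> t"
    using t_relation[OF assms] c M.inv_solve_right'[of "\<iota> (\<phi> c)" "t \<otimes>\<^bsub>M\<^esub> \<iota> c" t] by simp
  then have "u True \<otimes>\<^bsub>M\<^esub> \<iota> c = \<iota> (inv s) \<otimes>\<^bsub>M\<^esub> \<iota> (\<phi> c) \<otimes>\<^bsub>M\<^esub> t"
    using c by (simp add: u_def M.m_assoc)
  also have "inv s \<otimes> \<phi> c = \<theta> c \<otimes> inv s"
    using c by (simp add: \<theta>_def m_assoc)
  then have "\<iota> (inv s) \<otimes>\<^bsub>M\<^esub> \<iota> (\<phi> c) = \<iota> (\<theta> c) \<otimes>\<^bsub>M\<^esub> \<iota> (inv s)"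
    using c \<theta>_carrier[OF assms] by (metis \<iota>.hom_mult inv_closed s)
  finally show ?thesis using c \<theta>_carrier[OF assms] by (simp add: u_def M.m_assoc del: \<iota>.hom_inv)
qed

lemma u_cross:
  assumes "a \<in> side e" shows "u e \<otimes>\<^bsub>M\<^esub> \<iota> a = \<iota> (cross e a) \<otimes>\<^bsub>M\<^esub> u e"
proof (cases e)
  case True
  then show ?thesis using assms u_cross_True by (simp add: side_def cross_def)
next
  case False
  then obtain c where c: "c \<in> C" "a = \<theta> c" using assms by (auto simp: side_def)
  have cc: "c \<in> carrier G" "\<theta> c \<in> carrier G" using c C_carrier \<theta>_carrier by auto
  \<comment> \<open>Inserting u u^-1 at the right end reduces the relation for the negative exponent
    to the one for the positive exponent.\<close>
  have "u False \<otimes>\<^bsub>M\<^esub> \<iota> (\<theta> c) \<otimes>\<^bsub>M\<^esub> (u True \<otimes>\<^bsub>M\<^esub> u False) = u False \<otimes>\<^bsub>M\<^esub> (\<iota> (\<theta> c) \<otimes>\<^bsub>M\<^esub> u True) \<otimes>\<^bsub>M\<^esub> u False"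
    using cc by (simp add: M.m_assoc)
  also have "\<dots> = (u False \<otimes>\<^bsub>M\<^esub> u True) \<otimes>\<^bsub>M\<^esub> \<iota> c \<otimes>\<^bsub>M\<^esub> u False"
    using cc u_cross_True[OF c(1)] by (simp add: M.m_assoc)
  finally show ?thesis using False c cc u_inv[of True] u_inv[of False] \<theta>_inj by (simp add: cross_def)
qed

section \<open>Evaluation of normal forms in the HNN extension\<close>

fun tail_val :: "(bool \<times> 'a) list \<Rightarrow> (unit, 'a) letter list set set" where
  "tail_val [] = \<one>\<^bsub>M\<^esub>"
| "tail_val ((e, r) # xs) = u e \<otimes>\<^bsub>M\<^esub> (\<iota> r \<otimes>\<^bsub>M\<^esub> tail_val xs)"

fun form_val :: "'a \<times> (bool \<times> 'a) list \<Rightarrow> (unit, 'a) letter list set set" where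
  "form_val (g, xs) = \<iota> g \<otimes>\<^bsub>M\<^esub> tail_val xs"

lemma tail_val_carrier: "reduced xs \<Longrightarrow> tail_val xs \<in> carrier M"
  by (induction xs) (auto simp: reduced_Cons)

lemma form_val_base: "\<omega> \<in> forms \<Longrightarrow> h \<in> carrier G \<Longrightarrow> form_val (base_act h \<omega>) = \<iota> h \<otimes>\<^bsub>M\<^esub> form_val \<omega>"
  by (auto simp: forms_def M.m_assoc tail_val_carrier)

text \<open>Each branch of \<open>stable_act\<close> mirrors an identity in M: both carry an element
  of \<open>side e\<close> across u by \<open>u_cross\<close>, and the cancelling branch also uses
  \<open>u_inv\<close>.\<close>

lemma form_val_stable:
  assumes "\<omega> \<in> forms" shows "form_val (stable_act e \<omega>) = u e \<otimes>\<^bsub>M\<^esub> form_val \<omega>"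
proof -
  obtain g xs where gx: "\<omega> = (g, xs)" "g \<in> carrier G" "reduced xs"
    using assms by (auto simp: forms_def)
  have tv: "tail_val xs \<in> carrier M" using gx tail_val_carrier by blast
  show ?thesis unfolding gx(1)
  proof (cases xs e g rule: stable_act_cases)
    case (cancel r ys)
    then have r: "r \<in> carrier G" "tail_val ys \<in> carrier M"
      using gx by (auto simp: reduced_Cons tail_val_carrier)
    have "u e \<otimes>\<^bsub>M\<^esub> form_val (g, xs) = (u e \<otimes>\<^bsub>M\<^esub> \<iota> g) \<otimes>\<^bsub>M\<^esub> (u (\<not> e) \<otimes>\<^bsub>M\<^esub> (\<iota> r \<otimes>\<^bsub>M\<^esub> tail_val ys))"
      using gx r cancel by (simp add: M.m_assoc)
    also have "\<dots> = \<iota> (cross e g) \<otimes>\<^bsub>M\<^esub> (u e \<otimes>\<^bsub>M\<^esub> u (\<not> e)) \<otimes>\<^bsub>M\<^esub> (\<iota> r \<otimes>\<^bsub>M\<^esub> tail_val ys)"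
      using r cancel cross_carrier[of g e] by (simp add: u_cross M.m_assoc)
    finally show "form_val (stable_act e (g, xs)) = u e \<otimes>\<^bsub>M\<^esub> form_val (g, xs)"
      using cancel r cross_carrier[of g e] by (simp add: u_inv M.m_assoc)
  next
    case push
    have c: "cof e g \<in> side e" "cof e g \<in> carrier G" "cross e (cof e g) \<in> carrier G" "rep e g \<in> carrier G"
      using cof_side[OF gx(2), of e] side_carrier cross_carrier rep_carrier[OF gx(2)] by auto
    have "u e \<otimes>\<^bsub>M\<^esub> form_val (g, xs) = u e \<otimes>\<^bsub>M\<^esub> \<iota> (cof e g \<otimes> rep e g) \<otimes>\<^bsub>M\<^esub> tail_val xs"
      using gx tv by (simp add: cof_rep M.m_assoc)
    also have "\<dots> = (u e \<otimes>\<^bsub>M\<^esub> \<iota> (cof e g)) \<otimes>\<^bsub>M\<^esub> \<iota> (rep e g) \<otimes>\<^bsub>M\<^esub> tail_val xs"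
      using c tv by (simp add: M.m_assoc)
    finally show "form_val (stable_act e (g, xs)) = u e \<otimes>\<^bsub>M\<^esub> form_val (g, xs)"
      using push c tv by (simp add: u_cross M.m_assoc)
  qed
qed

lemma t_u: "t = \<iota> s \<otimes>\<^bsub>M\<^esub> u True"
  by (simp add: u_def M.m_assoc[symmetric] del: \<iota>.hom_inv flip: \<iota>.hom_mult)

lemma cls_GenInv: "cls [GenInv ()] = inv\<^bsub>M\<^esub> t"
proof -
  have l: "[GenInv ()] \<in> lists letters" "[Gen ()] \<in> lists letters" by (auto simp: alphabet_def)
  have "cls [GenInv ()] \<otimes>\<^bsub>M\<^esub> cls [Gen ()] = cls ([GenInv ()] @ [Gen ()])" by (rule cls_append[OF l])
  also have "hnn_word G ([GenInv ()] @ [Gen ()]) = hnn_word G []"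
    unfolding hnn_word_def by (subst word_class_eq_iff) (auto intro: fp_eq.inv_gen)
  then have "cls ([GenInv ()] @ [Gen ()]) = \<one>\<^bsub>M\<^esub>" by (simp add: hnn_class_def flip: cls_Nil)
  finally show ?thesis using M.inv_equality[of "cls [GenInv ()]" t] cls_carrier[OF l(1)] by (simp add: hnn_stable_def[symmetric])
qed

lemma cls_letter: "a \<in> letters \<Longrightarrow>
  cls [a] = (case a of Gen _ \<Rightarrow> t | GenInv _ \<Rightarrow> inv\<^bsub>M\<^esub> t | Par _ h \<Rightarrow> \<iota> h)"
  by (auto simp: alphabet_def hnn_stable_def cls_GenInv hnn_base_def)

lemma form_val_letter:
  assumes "a \<in> letters" "\<omega> \<in> forms"
  shows "form_val (letter_act a \<omega>) = cls [a] \<otimes>\<^bsub>M\<^esub> form_val \<omega>"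
proof -
  have v: "form_val \<psi> \<in> carrier M" if "\<psi> \<in> forms" for \<psi>
    using that by (auto simp: forms_def tail_val_carrier)
  have "inv\<^bsub>M\<^esub> t = u False \<otimes>\<^bsub>M\<^esub> \<iota> (inv s)"
    using M.inv_mult_group[of "\<iota> s" "u True"] u_inv[of False] M.inv_equality[of "u False" "u True"]
    by (subst t_u) simp
  then show ?thesis
    using assms v[OF assms(2)] stable_act_forms[OF assms(2)] base_act_forms[OF assms(2), of "inv s"]
    by (auto simp: cls_letter alphabet_def form_val_base form_val_stable t_u M.m_assoc)
qed

text \<open>Evaluation is equivariant, so an element of M is determined by its effect on a single
  form. This is how \<open>L_ping\<close> recognises an element of L that moves one form in the same
  way as an element of K.\<close>

lemma form_val_word:
  assumes "w \<in> lists letters" "\<omega> \<in> forms"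
  shows "form_val (word_act w \<omega>) = cls w \<otimes>\<^bsub>M\<^esub> form_val \<omega>"
  using assms(1)
proof (induction w)
  case Nil
  have "form_val \<omega> \<in> carrier M" using assms(2) by (auto simp: forms_def tail_val_carrier)
  then show ?case by (simp add: cls_Nil)
next
  case (Cons a w)
  then have l: "[a] \<in> lists letters" "w \<in> lists letters" by auto
  have "form_val \<omega> \<in> carrier M" using assms(2) by (auto simp: forms_def tail_val_carrier)
  then show ?case
    using Cons form_val_letter[of a "word_act w \<omega>"] word_act_forms[OF l(2) assms(2)] cls_append[OF l]
      cls_carrier[OF l(1)] cls_carrier[OF l(2)] M.m_assoc[of "cls [a]" "cls w" "form_val \<omega>"]
    by simp
qed

section \<open>The ping-pong set of the HNN extension\<close>

definition \<omega>\<^sub>0 :: "'a \<times> (bool \<times> 'a) list" where "\<omega>\<^sub>0 = (\<one>, [])"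

lemma \<omega>\<^sub>0_forms: "\<omega>\<^sub>0 \<in> forms"
  by (simp add: \<omega>\<^sub>0_def forms_def)

lemma base_word: "g \<in> carrier G \<Longrightarrow> [Par (carrier G) g] \<in> lists letters"
  by (auto simp: alphabet_def)

lemma base_word_act: "g \<in> carrier G \<Longrightarrow> word_act [Par (carrier G) g] \<omega>\<^sub>0 = (g, [])"
  by (simp add: \<omega>\<^sub>0_def)

text \<open>Applied to the form of the identity, \<iota> g yields the form with head g, so g can be
  read off.\<close>

lemma \<iota>_inj: "inj_on \<iota> (carrier G)"
proof (rule inj_onI)
  fix g h assume gh: "g \<in> carrier G" "h \<in> carrier G" "\<iota> g = \<iota> h"
  then show "g = h"
    using cls_eq_act[OF _ base_word base_word \<omega>\<^sub>0_forms, of g h] base_word_act[of g] base_word_act[of h]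
    by (simp add: hnn_base_def)
qed

abbreviation L where "L \<equiv> generate M (\<iota> ` K \<union> {\<iota> (inv s) \<otimes>\<^bsub>M\<^esub> t})"

text \<open>
  The elements whose normal form, as an alternating product of elements of \<open>G\<close> and \<open>L\<close>, starts
  with a factor from \<open>L - K\<close>.
\<close>

definition N :: "(unit, 'a) letter list set set set" where
  "N = {cls w | w. w \<in> lists letters \<and> fst (word_act w \<omega>\<^sub>0) \<in> K \<and> snd (word_act w \<omega>\<^sub>0) \<noteq> []}"

lemma cls_in_N:
  assumes "w \<in> lists letters"
  shows "cls w \<in> N \<longleftrightarrow> fst (word_act w \<omega>\<^sub>0) \<in> K \<and> snd (word_act w \<omega>\<^sub>0) \<noteq> []"
  using assms cls_eq_act[OF _ _ assms \<omega>\<^sub>0_forms] unfolding N_def by fastforce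

lemma cls_base_append:
  "g \<in> carrier G \<Longrightarrow> w \<in> lists letters \<Longrightarrow> cls (Par (carrier G) g # w) = \<iota> g \<otimes>\<^bsub>M\<^esub> cls w"
  using cls_append[OF base_word, of g w] by (simp add: hnn_base_def)

text \<open>
  Contains the \<open>L\<close>-orbit of the normal form \<open>(g, xs)\<close> if \<open>xs = []\<close> or \<open>g \<notin> K\<close>: then a stable letter
  multiplied from the left cannot cancel against \<open>xs\<close>.
\<close>

definition orbit :: "'a \<Rightarrow> (bool \<times> 'a) list \<Rightarrow> ('a \<times> (bool \<times> 'a) list) set" where
  "orbit g xs = {(k \<otimes> g, xs) | k. k \<in> K} \<union>
    {(k, ys @ (e, k' \<otimes> g) # xs) | k ys e k'. k \<in> K \<and> k' \<in> K \<and> snd ` set ys \<subseteq> K}"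

lemma K_cancel: "k \<in> K \<Longrightarrow> g \<in> carrier G \<Longrightarrow> k \<otimes> g \<in> K \<Longrightarrow> g \<in> K"
proof -
  assume a: "k \<in> K" "g \<in> carrier G" "k \<otimes> g \<in> K"
  then have "inv k \<otimes> (k \<otimes> g) \<in> K" using K by (simp add: subgroup.m_closed subgroup.m_inv_closed)
  then show ?thesis using a K_carrier by (simp add: m_assoc[symmetric])
qed

lemma rep_K:
  assumes "g \<in> carrier G" shows "\<exists>k\<in>K. rep e g = k \<otimes> g"
  using rep_decomp[OF assms, of e] side_K by blast

text \<open>Passing to a coset representative changes an element only by a factor from K, since both
  associated subgroups lie in K. Hence the entries in front stay in K and the entry next to
  \<open>xs\<close> stays in the coset K g. If \<open>xs\<close> is not empty, g \<notin> K keeps k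
  g out of \<open>side e\<close>, so nothing cancels against \<open>xs\<close>.\<close>

lemma orbit_stable:
  assumes g: "g \<in> carrier G" and free: "xs = [] \<or> g \<notin> K" and \<psi>: "\<psi> \<in> orbit g xs"
  shows "stable_act e \<psi> \<in> orbit g xs"
proof -
  have Km: "\<And>a b. a \<in> K \<Longrightarrow> b \<in> K \<Longrightarrow> a \<otimes> b \<in> K" using K by (simp add: subgroup.m_closed)
  consider (short) k where "\<psi> = (k \<otimes> g, xs)" "k \<in> K"
    | (long) k ys e' k' where "\<psi> = (k, ys @ (e', k' \<otimes> g) # xs)" "k \<in> K" "k' \<in> K" "snd ` set ys \<subseteq> K"
    using \<psi> unfolding orbit_def by blast
  then show ?thesis
  proof cases
    case short
    have kg: "k \<otimes> g \<in> carrier G" using short g K_carrier by simp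
    obtain a where a: "a \<in> K" "rep e (k \<otimes> g) = a \<otimes> (k \<otimes> g)" using rep_K[OF kg] by blast
    have "stable_act e \<psi> = (cross e (cof e (k \<otimes> g)), [] @ (e, (a \<otimes> k) \<otimes> g) # xs)"
    proof (cases xs e "k \<otimes> g" rule: stable_act_cases)
      case cancel
      then show ?thesis using free K_cancel[OF short(2) g] side_K by blast
    next
      case push
      then show ?thesis using short a g K_carrier by (simp add: m_assoc)
    qed
    then show ?thesis
      using Km[OF a(1) short(2)] cross_K[OF cof_side[OF kg, of e]] unfolding orbit_def by fastforce
  next
    case long
    have kc: "k \<in> carrier G" using long K_carrier by simp
    show ?thesis
    proof (cases "ys @ (e', k' \<otimes> g) # xs" e k rule: stable_act_cases)
      case (cancel r zs)
      have ck: "cross e k \<in> K" using cancel cross_K by blast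
      show ?thesis
      proof (cases ys)
        case Nil
        then have "stable_act e \<psi> = (cross e k \<otimes> k' \<otimes> g, xs)"
          using cancel long g K_carrier ck by (simp add: m_assoc)
        then show ?thesis using Km[OF ck long(3)] unfolding orbit_def by blast
      next
        case (Cons y ys')
        then have "stable_act e \<psi> = (cross e k \<otimes> r, ys' @ (e', k' \<otimes> g) # xs)" "r \<in> K" "snd ` set ys' \<subseteq> K"
          using cancel long by auto
        then show ?thesis using Km[OF ck] long unfolding orbit_def by blast
      qed
    next
      case push
      obtain a where a: "a \<in> K" "rep e k = a \<otimes> k" using rep_K[OF kc] by blast
      have "stable_act e \<psi> = (cross e (cof e k), ((e, a \<otimes> k) # ys) @ (e', k' \<otimes> g) # xs)"
        using push long a by simp
      moreover have "snd ` set ((e, a \<otimes> k) # ys) \<subseteq> K" using Km a long by simp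
      ultimately show ?thesis
        using long cross_K[OF cof_side[OF kc, of e]] unfolding orbit_def by blast
    qed
  qed
qed

lemma orbit_base:
  assumes "g \<in> carrier G" "k \<in> K" "\<psi> \<in> orbit g xs"
  shows "base_act k \<psi> \<in> orbit g xs"
proof -
  have Km: "\<And>b. b \<in> K \<Longrightarrow> k \<otimes> b \<in> K" using K assms by (simp add: subgroup.m_closed)
  consider (short) j where "\<psi> = (j \<otimes> g, xs)" "j \<in> K"
    | (long) j ys e' k' where "\<psi> = (j, ys @ (e', k' \<otimes> g) # xs)" "j \<in> K" "k' \<in> K" "snd ` set ys \<subseteq> K"
    using assms(3) unfolding orbit_def by blast
  then show ?thesis
  proof cases
    case short
    then have "base_act k \<psi> = (k \<otimes> j \<otimes> g, xs)" using assms K_carrier by (simp add: m_assoc)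
    then show ?thesis using Km short unfolding orbit_def by blast
  next
    case long
    then show ?thesis using Km unfolding orbit_def by auto
  qed
qed

text \<open>Induction over the generation of L. The word for s^-1 t acts by
  \<open>stable_act True\<close> alone, since the actions of s^-1 and s cancel, and the words for K
  act by \<open>base_act\<close>; both preserve \<open>orbit g xs\<close>.\<close>

lemma L_word:
  assumes "x \<in> L"
  shows "\<exists>w\<in>lists letters. x = cls w \<and> (\<forall>g\<in>carrier G. \<forall>xs. xs = [] \<or> g \<notin> K \<longrightarrow>
    (\<forall>\<psi>\<in>orbit g xs \<inter> forms. word_act w \<psi> \<in> orbit g xs))"
  using assms
proof (induction rule: generate.induct)
  case one
  then show ?case by (intro bexI[of _ "[]"]) (auto simp: cls_Nil)
next
  case (incl h)
  then consider (K) k where "k \<in> K" "h = \<iota> k" | (t) "h = \<iota> (inv s) \<otimes>\<^bsub>M\<^esub> t" by blast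
  then show ?case
  proof cases
    case K
    then show ?thesis
      using base_word K_carrier orbit_base
      by (intro bexI[of _ "[Par (carrier G) k]"]) (auto simp: hnn_base_def)
  next
    case t
    have "[Par (carrier G) (inv s), Gen ()] \<in> lists letters" "[Gen ()] \<in> lists letters"
      by (auto simp: alphabet_def)
    then show ?thesis
      using t orbit_stable cls_base_append[of "inv s" "[Gen ()]"] stable_act_forms
      by (intro bexI[of _ "[Par (carrier G) (inv s), Gen ()]"])
         (auto simp: hnn_stable_def base_act_mult base_act_one)
  qed
next
  case (inv h)
  then consider (base) k where "k \<in> K" "h = \<iota> k" | (t) "h = \<iota> (inv s) \<otimes>\<^bsub>M\<^esub> t" by blast
  then show ?case
  proof cases
    case base
    then have "inv k \<in> K" using K by (simp add: subgroup.m_inv_closed)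
    moreover have "inv\<^bsub>M\<^esub> h = \<iota> (inv k)" using base K_carrier by simp
    ultimately show ?thesis
      using base_word K_carrier orbit_base
      by (intro bexI[of _ "[Par (carrier G) (inv k)]"]) (auto simp: hnn_base_def)
  next
    case t
    have l: "[GenInv (), Par (carrier G) s] \<in> lists letters" "[GenInv ()] \<in> lists letters"
      by (auto simp: alphabet_def)
    have "inv\<^bsub>M\<^esub> h = inv\<^bsub>M\<^esub> t \<otimes>\<^bsub>M\<^esub> \<iota> s"
      using t by (simp add: M.inv_mult_group)
    also have "\<dots> = cls [GenInv (), Par (carrier G) s]"
      using cls_append[OF l(2) base_word[OF s]] by (simp add: cls_GenInv hnn_base_def)
    finally show ?thesis
      using l orbit_stable by (intro bexI[of _ "[GenInv (), Par (carrier G) s]"])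
         (auto simp: base_act_mult base_act_one)
  qed
next
  case (eng h1 h2)
  then obtain w1 w2 where w: "w1 \<in> lists letters" "w2 \<in> lists letters" "h1 = cls w1" "h2 = cls w2"
    and o: "\<And>g xs \<psi>. g \<in> carrier G \<Longrightarrow> xs = [] \<or> g \<notin> K \<Longrightarrow> \<psi> \<in> orbit g xs \<inter> forms \<Longrightarrow> word_act w1 \<psi> \<in> orbit g xs"
      "\<And>g xs \<psi>. g \<in> carrier G \<Longrightarrow> xs = [] \<or> g \<notin> K \<Longrightarrow> \<psi> \<in> orbit g xs \<inter> forms \<Longrightarrow> word_act w2 \<psi> \<in> orbit g xs"
    by metis
  show ?case
    using w o word_act_forms[OF w(2)] cls_append[OF w(1,2)]
    by (intro bexI[of _ "w1 @ w2"]) auto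
qed

text \<open>That y is not in N is exactly the condition under which the orbit of its form is
  controlled. If l y still has the tail of y, its form is that of y moved by some k \<in> K, and
  evaluation gives l = \<iota> k, which is excluded. Otherwise the head lies in K and a stable
  letter follows, which is membership in N.\<close>

lemma L_ping:
  assumes l: "l \<in> L" "l \<notin> \<iota> ` K" and y: "y \<in> carrier M" "y \<notin> N"
  shows "l \<otimes>\<^bsub>M\<^esub> y \<in> N"
proof -
  obtain w where w: "w \<in> lists letters" "y = cls w" using y M_carrierE by blast
  obtain v where v: "v \<in> lists letters" "l = cls v" and
    o: "\<And>g xs \<psi>. g \<in> carrier G \<Longrightarrow> xs = [] \<or> g \<notin> K \<Longrightarrow> \<psi> \<in> orbit g xs \<inter> forms \<Longrightarrow> word_act v \<psi> \<in> orbit g xs"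
    using L_word[OF l(1)] by metis
  let ?\<psi> = "word_act w \<omega>\<^sub>0"
  have f: "?\<psi> \<in> forms" using word_act_forms[OF w(1) \<omega>\<^sub>0_forms] .
  obtain g xs where gx: "?\<psi> = (g, xs)" "g \<in> carrier G" using f by (auto simp: forms_def)
  have free: "xs = [] \<or> g \<notin> K" using y cls_in_N[OF w(1)] w(2) gx by auto
  have "?\<psi> \<in> orbit g xs" unfolding orbit_def gx
    using subgroup.one_closed[OF K] gx(2) by (auto intro!: exI[of _ \<one>])
  then have ov: "word_act v ?\<psi> \<in> orbit g xs" using o[OF gx(2) free] f by blast
  have vw: "l \<otimes>\<^bsub>M\<^esub> y = cls (v @ w)" "v @ w \<in> lists letters" using v w cls_append by auto
  consider (short) k where "word_act v ?\<psi> = (k \<otimes> g, xs)" "k \<in> K"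
    | (long) "fst (word_act v ?\<psi>) \<in> K" "snd (word_act v ?\<psi>) \<noteq> []"
    using ov unfolding orbit_def by auto
  then show ?thesis
  proof cases
    case short
    then have "word_act v ?\<psi> = base_act k ?\<psi>" using gx by simp
    then have "l \<otimes>\<^bsub>M\<^esub> form_val ?\<psi> = \<iota> k \<otimes>\<^bsub>M\<^esub> form_val ?\<psi>"
      using form_val_word[OF v(1) f] form_val_base[OF f, of k] v(2) K_carrier[OF short(2)] by simp
    moreover have "form_val ?\<psi> \<in> carrier M" using f by (auto simp: forms_def tail_val_carrier)
    ultimately have "l = \<iota> k" using v cls_carrier K_carrier[OF short(2)] by simp
    then show ?thesis using l(2) short by blast
  next
    case long
    then show ?thesis using cls_in_N[OF vw(2)] vw(1) by simp
  qed
qed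

lemma N_base: "g \<in> carrier G \<Longrightarrow> \<iota> g \<notin> N"
  using cls_in_N[OF base_word, of g] base_word_act[of g] by (simp add: hnn_base_def)

lemma N_carrier: "N \<subseteq> carrier M"
  unfolding N_def using cls_carrier by blast

lemma base_in_N:
  assumes "g \<in> carrier G" "y \<in> N"
  shows "\<iota> g \<otimes>\<^bsub>M\<^esub> y \<in> N \<longleftrightarrow> g \<in> K"
proof -
  obtain w where w: "w \<in> lists letters" "y = cls w" using assms N_carrier M_carrierE by blast
  have gw: "Par (carrier G) g # w \<in> lists letters" using base_word[OF assms(1)] w by simp
  obtain k xs where kx: "word_act w \<omega>\<^sub>0 = (k, xs)" "k \<in> K" "xs \<noteq> []"
    using assms(2) cls_in_N[OF w(1)] w(2) by (cases "word_act w \<omega>\<^sub>0") auto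
  have "g \<otimes> k \<in> K \<longleftrightarrow> g \<in> K"
  proof
    assume "g \<otimes> k \<in> K"
    then have "g \<otimes> k \<otimes> inv k \<in> K"
      using K kx by (simp add: subgroup.m_closed subgroup.m_inv_closed)
    then show "g \<in> K" using assms kx K_carrier by (simp add: m_assoc)
  qed (use K kx in \<open>simp add: subgroup.m_closed\<close>)
  then show ?thesis
    using cls_in_N[OF gw] kx cls_base_append[OF assms(1) w(1)] w(2) by simp
qed

lemma M_generate: "generate M (\<iota> ` carrier G \<union> L) = carrier M"
proof
  let ?A = "generate M (\<iota> ` carrier G \<union> L)"
  have "\<iota> ` K \<union> {\<iota> (inv s) \<otimes>\<^bsub>M\<^esub> t} \<subseteq> carrier M" using K_carrier by auto
  then have Lc: "L \<subseteq> carrier M" by (rule M.generate_incl)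
  then show "?A \<subseteq> carrier M" by (intro M.generate_incl) auto
  have A: "subgroup ?A M" using Lc by (intro M.generate_is_subgroup) auto
  have "u True \<in> ?A" by (auto simp: u_def intro!: generate.incl)
  moreover have "\<iota> s \<in> ?A" by (simp add: generate.incl)
  ultimately have t: "t \<in> ?A" unfolding t_u by (rule generate.eng[rotated])
  have mem: "\<iota> g \<in> ?A" if "g \<in> carrier G" for g using that by (simp add: generate.incl)
  have t': "inv\<^bsub>M\<^esub> t \<in> ?A" using subgroup.m_inv_closed[OF A t] .
  show "carrier M \<subseteq> ?A"
  proof
    fix x assume "x \<in> carrier M"
    then obtain w where "w \<in> lists letters" "x = cls w" by (rule M_carrierE)
    moreover have "cls w \<in> ?A" if "w \<in> lists letters" for w using that
    proof (induction w)
      case Nil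
      then show ?case by (simp add: cls_Nil generate.one)
    next
      case (Cons a w)
      have "cls [a] \<in> ?A"
        using Cons(1) t t' mem by (cases a) (simp_all add: cls_letter, auto simp: alphabet_def)
      moreover have "cls (a # w) = cls [a] \<otimes>\<^bsub>M\<^esub> cls w" using cls_append[of "[a]" w] Cons by simp
      ultimately show ?case using Cons by (simp add: generate.eng)
    qed
    ultimately show "x \<in> ?A" by simp
  qed
qed

end

section \<open>Amalgamated products through ping-pong\<close>

text \<open>
  \<open>M\<close> is the amalgamated product of the image of \<open>G\<close> and of \<open>L\<close> over \<open>K\<close>; \<open>N\<close> plays the role of the
  set of elements whose normal form starts with a factor from \<open>L - K\<close>.
\<close>

locale amalgam = group G + M: group M
  for G :: "('a, 'b) monoid_scheme" (structure) and M :: "('m, 'c) monoid_scheme" +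
  fixes \<iota> :: "'a \<Rightarrow> 'm" and K :: "'a set" and L N :: "'m set"
  assumes hom: "\<iota> \<in> hom G M"
    and inj: "inj_on \<iota> (carrier G)"
    and K: "subgroup K G" and L: "subgroup L M"
    and K_L: "\<iota> ` K \<subseteq> L"
    and gen: "generate M (\<iota> ` carrier G \<union> L) = carrier M"
    and N_carrier: "N \<subseteq> carrier M"
    and base_notin_N: "g \<in> carrier G \<Longrightarrow> \<iota> g \<notin> N"
    and ping: "l \<in> L \<Longrightarrow> l \<notin> \<iota> ` K \<Longrightarrow> y \<in> carrier M \<Longrightarrow> y \<notin> N \<Longrightarrow> l \<otimes>\<^bsub>M\<^esub> y \<in> N"
    and base_in_N: "g \<in> carrier G \<Longrightarrow> y \<in> N \<Longrightarrow> \<iota> g \<otimes>\<^bsub>M\<^esub> y \<in> N \<longleftrightarrow> g \<in> K"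
begin

sublocale \<iota>: group_hom G M \<iota>
  by unfold_locales (rule hom)

lemma K_carrier: "k \<in> K \<Longrightarrow> k \<in> carrier G"
  using K by (rule subgroup.mem_carrier)

lemma L_carrier: "l \<in> L \<Longrightarrow> l \<in> carrier M"
  using L by (rule subgroup.mem_carrier)

lemmas L_mult = subgroup.m_closed[OF L] and L_inv = subgroup.m_inv_closed[OF L]
lemmas K_mult = subgroup.m_closed[OF K] and K_inv = subgroup.m_inv_closed[OF K]

lemma \<iota>_eq_iff: "g \<in> carrier G \<Longrightarrow> h \<in> carrier G \<Longrightarrow> \<iota> g = \<iota> h \<longleftrightarrow> g = h"
  using inj by (auto dest: inj_onD)

lemma \<iota>_in_K: "g \<in> carrier G \<Longrightarrow> \<iota> g \<in> \<iota> ` K \<longleftrightarrow> g \<in> K"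
  using \<iota>_eq_iff K_carrier by blast

lemma one_notin_N: "\<one>\<^bsub>M\<^esub> \<notin> N"
  using base_notin_N[of \<one>] by simp

text \<open>Ping-pong applied to y = 1: an element of L outside \<iota>(K) lies in N, and N is
  disjoint from \<iota>(G).\<close>

lemma L_Int_base:
  assumes "g \<in> carrier G" "\<iota> g \<in> L" shows "g \<in> K"
proof (rule ccontr)
  assume "g \<notin> K"
  then have "\<iota> g \<otimes>\<^bsub>M\<^esub> \<iota> \<one> \<in> N"
    using assms one_notin_N \<iota>_in_K by (intro ping) auto
  then show False using assms base_notin_N by simp
qed

lemma L_base_iff: "l \<in> L \<Longrightarrow> l \<in> \<iota> ` carrier G \<longleftrightarrow> l \<in> \<iota> ` K"
  using L_Int_base K_carrier by blast

text \<open>The conditions on N only concern multiplication from the left. The explicit products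
  make the right end accessible: their last factor from G is arbitrary, so they are stable under
  right multiplication by G.\<close>

inductive alternating :: "'m \<Rightarrow> bool" where
  last: "l \<in> L \<Longrightarrow> l \<notin> \<iota> ` K \<Longrightarrow> g \<in> carrier G \<Longrightarrow> alternating (l \<otimes>\<^bsub>M\<^esub> \<iota> g)"
| step: "l \<in> L \<Longrightarrow> l \<notin> \<iota> ` K \<Longrightarrow> g \<in> carrier G \<Longrightarrow> g \<notin> K \<Longrightarrow> alternating y \<Longrightarrow>
    alternating (l \<otimes>\<^bsub>M\<^esub> (\<iota> g \<otimes>\<^bsub>M\<^esub> y))"

text \<open>Ping-pong from the right: a factor from G - K leads out of N, and the next factor from L
  - K leads back in.\<close>

lemma alternating_N: "alternating y \<Longrightarrow> y \<in> N"
proof (induction rule: alternating.induct)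
  case (step l g y)
  then show ?case using N_carrier by (intro ping) (auto simp: base_in_N)
qed (auto intro: ping simp: base_notin_N)

lemma alternating_carrier: "alternating y \<Longrightarrow> y \<in> carrier M"
  using alternating_N N_carrier by blast

lemma alternating_base: "alternating y \<Longrightarrow> g \<in> carrier G \<Longrightarrow> alternating (y \<otimes>\<^bsub>M\<^esub> \<iota> g)"
proof (induction rule: alternating.induct)
  case (last l h)
  then show ?case
    using alternating.last[of l "h \<otimes> g"] L_carrier by (simp add: M.m_assoc)
next
  case (step l h y)
  then show ?case
    using alternating.step[of l h "y \<otimes>\<^bsub>M\<^esub> \<iota> g"] L_carrier alternating_carrier by (simp add: M.m_assoc)
qed

lemma L_times_L: "x \<in> L \<Longrightarrow> alternating (x \<otimes>\<^bsub>M\<^esub> \<iota> \<one>) \<or> x \<in> \<iota> ` K"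
  using alternating.last[of x \<one>] by blast

text \<open>A new factor l may merge with the last factor from L, when only an element of K
  separates them, and the result may collapse into K. A collapse passes to the outer factors as an
  element k that is absorbed into the preceding g, so it reaches \<iota>(K) only if there is just
  one factor from L.\<close>

lemma alternating_L: "alternating y \<Longrightarrow> l \<in> L \<Longrightarrow> alternating (y \<otimes>\<^bsub>M\<^esub> l) \<or> y \<otimes>\<^bsub>M\<^esub> l \<in> \<iota> ` K"
proof (induction rule: alternating.induct)
  case (last l1 g)
  note c = L_carrier[OF last(1)] L_carrier[OF last(4)]
  show ?case
  proof (cases "l \<in> \<iota> ` K")
    case True
    then obtain k where "k \<in> K" "l = \<iota> k" by blast
    then show ?thesis using alternating_base[OF alternating.last[OF last(1-3)], of k] K_carrier by simp
  next
    case l: False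
    show ?thesis
    proof (cases "g \<in> K")
      case True
      then have "l1 \<otimes>\<^bsub>M\<^esub> \<iota> g \<otimes>\<^bsub>M\<^esub> l \<in> L" using last K_L by (auto intro!: L_mult)
      then show ?thesis using L_times_L[of "l1 \<otimes>\<^bsub>M\<^esub> \<iota> g \<otimes>\<^bsub>M\<^esub> l"] c last by simp
    next
      case False
      then have "alternating (l1 \<otimes>\<^bsub>M\<^esub> (\<iota> g \<otimes>\<^bsub>M\<^esub> (l \<otimes>\<^bsub>M\<^esub> \<iota> \<one>)))"
        using last l by (intro alternating.step alternating.last) auto
      then show ?thesis using c last by (simp add: M.m_assoc)
    qed
  qed
next
  case (step l1 g y)
  note c = L_carrier[OF step(1)] L_carrier[OF step(7)] alternating_carrier[OF step(5)]
  from step.IH[OF step(7)] show ?case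
  proof
    assume "alternating (y \<otimes>\<^bsub>M\<^esub> l)"
    then show ?thesis using alternating.step[OF step(1-4)] c step(3) by (simp add: M.m_assoc)
  next
    assume "y \<otimes>\<^bsub>M\<^esub> l \<in> \<iota> ` K"
    then obtain k where k: "k \<in> K" "y \<otimes>\<^bsub>M\<^esub> l = \<iota> k" by blast
    then show ?thesis
      using alternating.last[OF step(1,2), of "g \<otimes> k"] K_carrier[OF k(1)] c step(3)
      by (simp add: M.m_assoc)
  qed
qed

text \<open>In the Bass-Serre tree these are the y for which the path from the vertex G to the
  vertex yL starts with the edge K. Including \<iota>(K) makes the set closed under right
  multiplication by L.\<close>

definition P :: "'m set" where
  "P = \<iota> ` K \<union> Collect alternating"

lemma P_carrier: "y \<in> P \<Longrightarrow> y \<in> carrier M"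
  unfolding P_def using alternating_carrier K_carrier by auto

lemma P_L: "y \<in> P \<Longrightarrow> l \<in> L \<Longrightarrow> y \<otimes>\<^bsub>M\<^esub> l \<in> P"
proof -
  assume y: "y \<in> P" and l: "l \<in> L"
  then consider k where "k \<in> K" "y = \<iota> k" | "alternating y" unfolding P_def by blast
  then show "y \<otimes>\<^bsub>M\<^esub> l \<in> P"
  proof cases
    case 1
    then have "y \<otimes>\<^bsub>M\<^esub> l \<in> L" using l K_L by (auto intro!: L_mult)
    then show ?thesis using L_times_L L_carrier unfolding P_def by fastforce
  qed (use alternating_L[OF _ l] in \<open>auto simp: P_def\<close>)
qed

text \<open>The elements of \<open>P\<close> in \<iota>(G) are those of \<iota>(K); for them right
  multiplication by g can change the first edge, which is why they are excluded.\<close>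

lemma P_base: "y \<in> P \<Longrightarrow> y \<notin> \<iota> ` carrier G \<Longrightarrow> g \<in> carrier G \<Longrightarrow> y \<otimes>\<^bsub>M\<^esub> \<iota> g \<in> P"
  unfolding P_def using alternating_base K_carrier by auto

text \<open>Left translation by g carries the first edge K of the path to the edge gK. So translates
  of \<open>P\<close> by elements of different left cosets of K in G are disjoint.\<close>

lemma P_K:
  assumes y: "y \<in> P" and g: "g \<in> carrier G" and gy: "\<iota> g \<otimes>\<^bsub>M\<^esub> y \<in> P"
  shows "g \<in> K"
proof -
  consider k where "k \<in> K" "y = \<iota> k" | "alternating y" using y unfolding P_def by blast
  then show ?thesis
  proof cases
    case 1
    then have "\<iota> (g \<otimes> k) \<in> P" using g gy K_carrier by simp
    then have "\<iota> (g \<otimes> k) \<in> \<iota> ` K"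
      unfolding P_def using alternating_N base_notin_N[of "g \<otimes> k"] g 1 K_carrier by blast
    then have "g \<otimes> k \<in> K" using \<iota>_in_K[of "g \<otimes> k"] g 1 K_carrier by simp
    then have "g \<otimes> k \<otimes> inv k \<in> K" using 1 by (auto intro: K_mult K_inv)
    then show ?thesis using g 1 K_carrier by (simp add: m_assoc)
  next
    case 2
    show ?thesis
    proof (cases "\<iota> g \<otimes>\<^bsub>M\<^esub> y \<in> \<iota> ` K")
      case True
      then obtain k where k: "k \<in> K" "\<iota> g \<otimes>\<^bsub>M\<^esub> y = \<iota> k" by blast
      then have "y = \<iota> (inv g \<otimes> k)"
        using g K_carrier P_carrier[OF y] by (simp add: M.inv_solve_left)
      then show ?thesis using alternating_N[OF 2] base_notin_N[of "inv g \<otimes> k"] g k K_carrier by simp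
    next
      case False
      then show ?thesis
        using gy alternating_N base_in_N[OF g alternating_N[OF 2]] unfolding P_def by blast
    qed
  qed
qed

lemma one_P: "\<one>\<^bsub>M\<^esub> \<in> P"
  using subgroup.one_closed[OF K] \<iota>.hom_one unfolding P_def by (metis UnI1 imageI)

text \<open>The products \<iota>(g) y contain 1 and are closed under right multiplication by the
  generators. The only case in which the new factor does not join y is y \<in> \<iota>(G), and then
  everything is absorbed into g.\<close>

lemma base_P_decomp:
  assumes "x \<in> carrier M"
  obtains g y where "g \<in> carrier G" "y \<in> P" "x = \<iota> g \<otimes>\<^bsub>M\<^esub> y"
proof -
  define T where "T = {x. \<exists>g\<in>carrier G. \<exists>y\<in>P. x = \<iota> g \<otimes>\<^bsub>M\<^esub> y}"
  have TL: "x \<otimes>\<^bsub>M\<^esub> l \<in> T" if x: "x \<in> T" and l: "l \<in> L" for x l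
  proof -
    obtain g y where "g \<in> carrier G" "y \<in> P" "x = \<iota> g \<otimes>\<^bsub>M\<^esub> y" using x unfolding T_def by blast
    then show ?thesis
      using P_L[of y l] l L_carrier P_carrier unfolding T_def
      by (auto simp: M.m_assoc intro!: bexI[of _ g] bexI[of _ "y \<otimes>\<^bsub>M\<^esub> l"])
  qed
  have TG: "x \<otimes>\<^bsub>M\<^esub> \<iota> h \<in> T" if x: "x \<in> T" and h: "h \<in> carrier G" for x h
  proof -
    obtain g y where gy: "g \<in> carrier G" "y \<in> P" "x = \<iota> g \<otimes>\<^bsub>M\<^esub> y" using x unfolding T_def by blast
    show ?thesis
    proof (cases "y \<in> \<iota> ` carrier G")
      case True
      then obtain k where "k \<in> carrier G" "y = \<iota> k" by blast
      then have "x \<otimes>\<^bsub>M\<^esub> \<iota> h = \<iota> (g \<otimes> k \<otimes> h) \<otimes>\<^bsub>M\<^esub> \<one>\<^bsub>M\<^esub>" "g \<otimes> k \<otimes> h \<in> carrier G" using gy h by auto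
      then show ?thesis using one_P unfolding T_def by blast
    next
      case False
      then show ?thesis
        using gy P_base[of y h] h P_carrier unfolding T_def
        by (auto simp: M.m_assoc intro!: bexI[of _ g] bexI[of _ "y \<otimes>\<^bsub>M\<^esub> \<iota> h"])
    qed
  qed
  have Tc: "T \<subseteq> carrier M" unfolding T_def using P_carrier by auto
  have "\<forall>x\<in>T. x \<otimes>\<^bsub>M\<^esub> z \<in> T" if "z \<in> generate M (\<iota> ` carrier G \<union> L)" for z
    using that
  proof (induction rule: generate.induct)
    case one
    then show ?case using Tc by auto
  next
    case (incl h)
    then show ?case using TL TG by blast
  next
    case (inv h)
    then show ?case using TL TG L_inv by (auto simp flip: \<iota>.hom_inv)
  next
    case (eng h1 h2)
    then have "h1 \<in> carrier M" "h2 \<in> carrier M" using gen by auto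
    then show ?case using eng Tc by (auto simp: M.m_assoc[symmetric])
  qed
  moreover have "\<one>\<^bsub>M\<^esub> \<in> T"
    unfolding T_def using one_P by (auto intro!: bexI[of _ \<one>] bexI[of _ "\<one>\<^bsub>M\<^esub>"])
  ultimately have "\<one>\<^bsub>M\<^esub> \<otimes>\<^bsub>M\<^esub> x \<in> T" using assms gen by blast
  then show thesis using assms that unfolding T_def by auto
qed


section \<open>Conjugacy\<close>

text \<open>Write x^-1 = a y with y \<in> \<open>P\<close> and g1 = a^-1 g a; then y h = g1 y. If g1
  \<notin> K, then g1 y is outside \<open>P\<close> by \<open>P_K\<close>. Right multiplication by L
  never leaves \<open>P\<close>, and right multiplication by G does so only from \<iota>(K). Hence h
  \<in> \<iota>(G) and y \<in> \<iota>(K), so the conjugation happens inside G.\<close>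

lemma conjugate_into_K:
  assumes g: "g \<in> carrier G" and x: "x \<in> carrier M"
    and h: "h = x \<otimes>\<^bsub>M\<^esub> \<iota> g \<otimes>\<^bsub>M\<^esub> inv\<^bsub>M\<^esub> x" "h \<in> \<iota> ` carrier G \<union> L"
  shows "(\<exists>k\<in>K. conjugate_in G g k) \<or> (\<exists>a\<in>carrier G. h = \<iota> a \<and> conjugate_in G g a)"
proof -
  obtain a y where ay: "a \<in> carrier G" "y \<in> P" "inv\<^bsub>M\<^esub> x = \<iota> a \<otimes>\<^bsub>M\<^esub> y"
    using base_P_decomp[of "inv\<^bsub>M\<^esub> x"] x by auto
  note yc = P_carrier[OF ay(2)]
  define g1 where "g1 = inv a \<otimes> g \<otimes> inv (inv a)"
  have g1: "g1 \<in> carrier G" "conjugate_in G g g1"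
    using ay g by (auto simp: g1_def conjugate_in_def intro!: bexI[of _ "inv a"])
  have hc: "h \<in> carrier M" using h x g by simp
  have "inv\<^bsub>M\<^esub> x \<otimes>\<^bsub>M\<^esub> h = \<iota> g \<otimes>\<^bsub>M\<^esub> inv\<^bsub>M\<^esub> x"
    using x g by (simp add: h(1) M.m_assoc[symmetric])
  then have "\<iota> (inv a) \<otimes>\<^bsub>M\<^esub> (\<iota> a \<otimes>\<^bsub>M\<^esub> y \<otimes>\<^bsub>M\<^esub> h) = \<iota> (inv a) \<otimes>\<^bsub>M\<^esub> (\<iota> g \<otimes>\<^bsub>M\<^esub> (\<iota> a \<otimes>\<^bsub>M\<^esub> y))"
    by (simp add: ay(3))
  then have yh: "y \<otimes>\<^bsub>M\<^esub> h = \<iota> g1 \<otimes>\<^bsub>M\<^esub> y"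
    using ay(1) yc hc g by (simp add: g1_def M.m_assoc[symmetric])
  show ?thesis
  proof (cases "g1 \<in> K")
    case True
    then show ?thesis using g1 by blast
  next
    case g1K: False
    then have nP: "y \<otimes>\<^bsub>M\<^esub> h \<notin> P" using P_K[OF ay(2) g1(1)] yh by auto
    then have "h \<notin> L" using P_L[OF ay(2)] by blast
    then obtain b where b: "b \<in> carrier G" "h = \<iota> b" using h by blast
    then have "y \<in> \<iota> ` carrier G" using nP P_base[OF ay(2)] by blast
    then have "y \<in> \<iota> ` K" using ay(2) alternating_N base_notin_N unfolding P_def by blast
    then obtain k where k: "k \<in> K" "y = \<iota> k" by blast
    note kc = K_carrier[OF k(1)]
    have "\<iota> (k \<otimes> b) = \<iota> (g1 \<otimes> k)" using yh b k kc g1 by simp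
    then have "k \<otimes> b = g1 \<otimes> k" using b kc g1 by (subst (asm) \<iota>_eq_iff) auto
    then have "b = inv k \<otimes> (g1 \<otimes> k)" using b kc g1 by (metis inv_solve_left m_closed)
    then have "b = (inv k \<otimes> inv a) \<otimes> g \<otimes> inv (inv k \<otimes> inv a)"
      using kc ay(1) g by (simp add: g1_def m_assoc inv_mult_group)
    then have "conjugate_in G g b"
      unfolding conjugate_in_def using kc ay(1) by (intro bexI[of _ "inv k \<otimes> inv a"]) auto
    then show ?thesis using b by blast
  qed
qed

lemma conjugate_in_\<iota>: "g \<in> carrier G \<Longrightarrow> conjugate_in G g a \<Longrightarrow> conjugate_in M (\<iota> g) (\<iota> a)"
  unfolding conjugate_in_def by (auto simp: intro!: bexI[of _ "\<iota> _"])

theorem conjugate_iff: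
  assumes g: "g \<in> carrier G" and \<H>: "\<And>H. H \<in> \<H> \<Longrightarrow> H \<subseteq> carrier G"
  shows "(\<exists>Q\<in>\<H> \<union> {K}. \<exists>q\<in>Q. conjugate_in G g q) \<longleftrightarrow>
    (\<exists>H\<in>(\<lambda>H. \<iota> ` H) ` \<H> \<union> {L}. \<exists>h\<in>H. conjugate_in M (\<iota> g) h)"
proof
  assume "\<exists>Q\<in>\<H> \<union> {K}. \<exists>q\<in>Q. conjugate_in G g q"
  then obtain Q q where "Q \<in> \<H> \<union> {K}" "q \<in> Q" "conjugate_in G g q" by blast
  then have "conjugate_in M (\<iota> g) (\<iota> q)" "\<iota> q \<in> \<iota> ` Q"
    "\<iota> ` Q \<in> (\<lambda>H. \<iota> ` H) ` \<H> \<or> \<iota> ` Q \<subseteq> L"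
    using conjugate_in_\<iota>[OF g] K_L by auto
  then show "\<exists>H\<in>(\<lambda>H. \<iota> ` H) ` \<H> \<union> {L}. \<exists>h\<in>H. conjugate_in M (\<iota> g) h"
    by (meson UnCI insertI1 subsetD)
next
  assume "\<exists>H\<in>(\<lambda>H. \<iota> ` H) ` \<H> \<union> {L}. \<exists>h\<in>H. conjugate_in M (\<iota> g) h"
  then obtain H h x where h: "H \<in> (\<lambda>H. \<iota> ` H) ` \<H> \<union> {L}" "h \<in> H"
    and x: "x \<in> carrier M" "h = x \<otimes>\<^bsub>M\<^esub> \<iota> g \<otimes>\<^bsub>M\<^esub> inv\<^bsub>M\<^esub> x"
    unfolding conjugate_in_def by blast
  then have "h \<in> \<iota> ` carrier G \<union> L" using \<H> by blast
  from conjugate_into_K[OF g x this]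
  show "\<exists>Q\<in>\<H> \<union> {K}. \<exists>q\<in>Q. conjugate_in G g q"
  proof
    assume "\<exists>a\<in>carrier G. h = \<iota> a \<and> conjugate_in G g a"
    then obtain a where a: "a \<in> carrier G" "h = \<iota> a" "conjugate_in G g a" by blast
    consider Q where "Q \<in> \<H>" "h \<in> \<iota> ` Q" | "h \<in> L" using h by blast
    then show ?thesis
    proof cases
      case 1
      then have "a \<in> Q" using a \<H>[OF 1(1)] \<iota>_eq_iff by auto
      then show ?thesis using 1 a by blast
    next
      case 2
      then show ?thesis using L_Int_base a by blast
    qed
  qed blast
qed

end

section \<open>Relative area\<close>

text \<open>The existential inside \<open>area_bound\<close>, stated for any group, so that it can
  be studied under products, conjugation and homomorphisms.\<close>

definition area_le :: "('c, 'd) monoid_scheme \<Rightarrow> 'c set \<Rightarrow> nat \<Rightarrow> 'c \<Rightarrow> bool" where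
  "area_le F R m x \<longleftrightarrow>
    (\<exists>ps. set ps \<subseteq> (R \<union> m_inv F ` R) \<times> carrier F \<and> length ps \<le> m \<and> x = conj_product F ps)"

lemma area_le_mono: "area_le F R m x \<Longrightarrow> m \<le> n \<Longrightarrow> area_le F R n x"
  unfolding area_le_def using le_trans by blast

context group
begin

lemma conj_product_Nil [simp]: "conj_product G [] = \<one>"
  by (simp add: conj_product_def)

lemma conj_product_Cons [simp]:
  "conj_product G ((r, f) # ps) = (inv f \<otimes> r \<otimes> f) \<otimes> conj_product G ps"
  by (simp add: conj_product_def)

lemma conj_product_carrier:
  "R \<subseteq> carrier G \<Longrightarrow> set ps \<subseteq> (R \<union> m_inv G ` R) \<times> carrier G \<Longrightarrow> conj_product G ps \<in> carrier G"
  by (induction ps) auto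

lemma conj_product_append:
  assumes R: "R \<subseteq> carrier G" and "set ps \<subseteq> (R \<union> m_inv G ` R) \<times> carrier G"
    and qs: "set qs \<subseteq> (R \<union> m_inv G ` R) \<times> carrier G"
  shows "conj_product G (ps @ qs) = conj_product G ps \<otimes> conj_product G qs"
  using assms(2)
proof (induction ps)
  case (Cons p ps)
  obtain r f where p: "p = (r, f)" by (cases p)
  have "r \<in> carrier G" "f \<in> carrier G" "conj_product G ps \<in> carrier G" "conj_product G qs \<in> carrier G"
    using Cons.prems R p conj_product_carrier[OF R, of ps] conj_product_carrier[OF R qs] by auto
  then show ?case using Cons p by (simp add: m_assoc)
qed (use conj_product_carrier[OF R qs] in simp)

lemma area_le_mult:
  assumes R: "R \<subseteq> carrier G" and "area_le G R m x" "area_le G R n y"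
  shows "area_le G R (m + n) (x \<otimes> y)"
proof -
  obtain ps qs where "set ps \<subseteq> (R \<union> m_inv G ` R) \<times> carrier G" "length ps \<le> m" "x = conj_product G ps"
    "set qs \<subseteq> (R \<union> m_inv G ` R) \<times> carrier G" "length qs \<le> n" "y = conj_product G qs"
    using assms unfolding area_le_def by blast
  then show ?thesis
    unfolding area_le_def using conj_product_append[OF R]
    by (intro exI[of _ "ps @ qs"]) auto
qed

text \<open>Conjugating a product conjugates each factor, which only replaces f by f g^-1 and keeps
  the number of factors.\<close>

lemma area_le_conj:
  assumes R: "R \<subseteq> carrier G" and "area_le G R m x" and g: "g \<in> carrier G"
  shows "area_le G R m (g \<otimes> x \<otimes> inv g)"
proof -
  obtain ps where ps: "set ps \<subseteq> (R \<union> m_inv G ` R) \<times> carrier G" "length ps \<le> m" "x = conj_product G ps"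
    using assms unfolding area_le_def by blast
  let ?qs = "map (\<lambda>(r, f). (r, f \<otimes> inv g)) ps"
  have "conj_product G ?qs = g \<otimes> conj_product G ps \<otimes> inv g" using ps(1)
  proof (induction ps)
    case (Cons p ps)
    obtain r f where p: "p = (r, f)" by (cases p)
    have c: "r \<in> carrier G" "f \<in> carrier G" "conj_product G ps \<in> carrier G"
      using Cons.prems R p conj_product_carrier[OF R, of ps] by auto
    have "inv g \<otimes> (g \<otimes> (conj_product G ps \<otimes> inv g)) = conj_product G ps \<otimes> inv g"
      using c g by (simp add: m_assoc[symmetric])
    then show ?case using Cons p c g by (simp add: m_assoc inv_mult_group)
  qed (use g in simp)
  moreover have "set ?qs \<subseteq> (R \<union> m_inv G ` R) \<times> carrier G" using ps(1) g by auto
  ultimately show ?thesis unfolding area_le_def using ps by (intro exI[of _ ?qs]) auto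
qed

lemma subset_normal_closure:
  assumes R: "R \<subseteq> carrier G" shows "R \<subseteq> normal_closure G R"
proof
  fix a assume a: "a \<in> R"
  then have "conjugate_in G a a" using R by (auto simp: conjugate_in_def intro!: bexI[of _ \<one>])
  then show "a \<in> normal_closure G R" unfolding normal_closure_def using a by (blast intro: generate.incl)
qed

lemma conjugate_normal_closure:
  assumes R: "R \<subseteq> carrier G" and "r \<in> R \<union> m_inv G ` R" "f \<in> carrier G"
  shows "inv f \<otimes> r \<otimes> f \<in> normal_closure G R"
proof -
  interpret N: normal "normal_closure G R" G using normal_closure_normal[OF is_group R] .
  have "r \<in> normal_closure G R" using assms(2) subset_normal_closure[OF R] by auto
  then show ?thesis using N.inv_op_closed1[OF assms(3)] by simp
qed

lemma area_le_normal_closure: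
  assumes R: "R \<subseteq> carrier G" and "area_le G R m x"
  shows "x \<in> normal_closure G R"
proof -
  interpret N: normal "normal_closure G R" G using normal_closure_normal[OF is_group R] .
  have "conj_product G ps \<in> normal_closure G R" if "set ps \<subseteq> (R \<union> m_inv G ` R) \<times> carrier G" for ps
    using that
  proof (induction ps)
    case (Cons p ps)
    then show ?case using conjugate_normal_closure[OF R, of "fst p" "snd p"] by (cases p) auto
  qed simp
  then show ?thesis using assms(2) unfolding area_le_def by blast
qed

end

lemma (in group_hom) area_le_hom:
  assumes R: "R \<subseteq> carrier G" and "h ` R \<subseteq> R'" and "area_le G R m x"
  shows "area_le H R' m (h x)"
proof -
  obtain ps where ps: "set ps \<subseteq> (R \<union> m_inv G ` R) \<times> carrier G" "length ps \<le> m" "x = conj_product G ps"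
    using assms unfolding area_le_def by blast
  let ?qs = "map (\<lambda>(r, f). (h r, h f)) ps"
  have "conj_product H ?qs = h (conj_product G ps)" using ps(1)
  proof (induction ps)
    case (Cons p ps)
    obtain r f where p: "p = (r, f)" by (cases p)
    have c: "r \<in> carrier G" "f \<in> carrier G" "conj_product G ps \<in> carrier G"
      using Cons.prems R p G.conj_product_carrier[OF R, of ps] by auto
    then show ?case using Cons p by simp
  qed simp
  moreover have "set ?qs \<subseteq> (R' \<union> m_inv H ` R') \<times> carrier H"
  proof -
    have "h r \<in> R' \<union> m_inv H ` R'" if "r \<in> R \<union> m_inv G ` R" for r
      using that assms(2) R by (auto simp: subset_iff)
    then show ?thesis using ps(1) by fastforce
  qed
  ultimately show ?thesis unfolding area_le_def using ps by (intro exI[of _ ?qs]) auto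
qed

lemma (in group_hom) normal_closure_kernel:
  assumes "R \<subseteq> kernel G H h"
  shows "normal_closure G R \<subseteq> kernel G H h"
  unfolding normal_closure_def
proof (rule G.generate_subgroup_incl)
  show "subgroup (kernel G H h) G" by (rule subgroup_kernel)
  show "{b. \<exists>a\<in>R. conjugate_in G a b} \<subseteq> kernel G H h"
    using assms by (auto simp: kernel_def conjugate_in_def subset_iff)
qed


section \<open>Words in relative presentations\<close>

declare in_lists_conv_set [simp del] and in_listsD [rule del] and in_listsI [rule del]

locale rel_words = group G for G :: "('a, 'b) monoid_scheme" (structure) +
  fixes S :: "'a set" and \<H> :: "'a set set"
  assumes S: "S \<subseteq> carrier G" and \<H>: "\<And>H. H \<in> \<H> \<Longrightarrow> subgroup H G"
begin

abbreviation "A \<equiv> alphabet S \<H>"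
abbreviation "F \<equiv> rel_free_group G S \<H>"
abbreviation "wc \<equiv> word_class G S \<H>"

lemma letter_val_carrier: "a \<in> A \<Longrightarrow> letter_val G a \<in> carrier G"
  using S subgroup.mem_carrier[OF \<H>] by (auto simp: alphabet_def)

lemma word_val_Nil [simp]: "word_val G [] = \<one>"
  by (simp add: word_val_def)

lemma word_val_Cons [simp]: "word_val G (a # w) = letter_val G a \<otimes> word_val G w"
  by (simp add: word_val_def)

lemma word_val_carrier: "w \<in> lists A \<Longrightarrow> word_val G w \<in> carrier G"
  by (induction w) (auto simp: letter_val_carrier)

lemma word_val_append:
  "u \<in> lists A \<Longrightarrow> v \<in> lists A \<Longrightarrow> word_val G (u @ v) = word_val G u \<otimes> word_val G v"
  by (induction u) (auto simp: letter_val_carrier word_val_carrier m_assoc)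

sublocale F: group F
  by (rule group_rel_free_group[OF is_group \<H>])

lemma F_carrier: "carrier F = wc ` lists A"
  by (simp add: rel_free_group_def)

lemma wc_carrier: "w \<in> lists A \<Longrightarrow> wc w \<in> carrier F"
  unfolding F_carrier by (rule imageI)

lemma F_one: "\<one>\<^bsub>F\<^esub> = wc []"
  by (simp add: rel_free_group_def)

lemma wc_append: "u \<in> lists A \<Longrightarrow> v \<in> lists A \<Longrightarrow> wc (u @ v) = wc u \<otimes>\<^bsub>F\<^esub> wc v"
  by (rule mult_word_class[symmetric])

lemma wc_eqI: "fp_eq G S \<H> u v \<Longrightarrow> wc u = wc v"
  using fp_eq_words[where G = G and \<H> = \<H>, OF \<H>] word_class_eq_iff by blast

lemma natural_map_wc: "w \<in> lists A \<Longrightarrow> natural_map G (wc w) = word_val G w"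
  by (rule natural_map_word_class[OF is_group S \<H>])

sublocale nat: group_hom F G "natural_map G"
proof
  show "natural_map G \<in> hom F G"
  proof (rule homI)
    fix x assume "x \<in> carrier F"
    then show "natural_map G x \<in> carrier G"
      unfolding F_carrier by (auto simp: natural_map_wc word_val_carrier)
  next
    fix x y assume "x \<in> carrier F" "y \<in> carrier F"
    then obtain u v where uv: "u \<in> lists A" "v \<in> lists A" "x = wc u" "y = wc v"
      unfolding F_carrier by blast
    then have "u @ v \<in> lists A" by simp
    then show "natural_map G (x \<otimes>\<^bsub>F\<^esub> y) = natural_map G x \<otimes> natural_map G y"
      using uv by (simp add: natural_map_wc word_val_append flip: wc_append)
  qed
qed

abbreviation strict_letters :: "('a, 'a) letter set" where
  "strict_letters \<equiv> Gen ` S \<union> GenInv ` S \<union> {Par H h | H h. H \<in> \<H> \<and> h \<in> H - {\<one>}}"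

lemma strict_letters_subset: "strict_letters \<subseteq> A"
  by (auto simp: alphabet_def)

text \<open>\<open>area_bound\<close> quantifies over words without identity letters, but merging
  letters of one copy can create them. Erasing them is harmless, and this allows
  \<open>area_bound_iff\<close> to range over the full alphabet.\<close>

lemma strict_word:
  assumes "w \<in> lists A"
  shows "\<exists>v\<in>lists strict_letters. wc v = wc w \<and> length v \<le> length w \<and> word_val G v = word_val G w"
  using assms
proof (induction w)
  case (Cons a w)
  then obtain v where v: "v \<in> lists strict_letters" "wc v = wc w" "length v \<le> length w" "word_val G v = word_val G w"
    by blast
  have vA: "v \<in> lists A" using subsetD[OF lists_mono[OF strict_letters_subset] v(1)] .
  have aw: "[a] \<in> lists A" "w \<in> lists A" using Cons by auto
  show ?case
  proof (cases "a \<in> strict_letters")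
    case True
    have "wc (a # v) = wc (a # w)" using wc_append[OF aw] wc_append[OF aw(1) vA] v(2) by simp
    then show ?thesis using True v by (intro bexI[of _ "a # v"]) auto
  next
    case False
    then obtain H where H: "H \<in> \<H>" "a = Par H \<one>" using Cons(1) by (auto simp: alphabet_def)
    then have "wc [a] = \<one>\<^bsub>F\<^esub>" unfolding F_one by (auto intro!: wc_eqI fp_eq.par_one)
    then have "wc (a # w) = wc w" using wc_append[OF aw] wc_carrier[OF aw(2)] by simp
    moreover have "word_val G (a # w) = word_val G w" using H word_val_carrier[OF aw(2)] by simp
    ultimately show ?thesis using v by (intro bexI[of _ v]) auto
  qed
qed auto

lemma area_bound_iff:
  "area_bound G \<H> S R n m \<longleftrightarrow>
    (\<forall>w\<in>lists A. length w \<le> n \<and> word_val G w = \<one> \<longrightarrow> area_le F R m (wc w))"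
proof -
  have "area_bound G \<H> S R n m \<longleftrightarrow>
    (\<forall>w\<in>lists strict_letters. length w \<le> n \<and> word_val G w = \<one> \<longrightarrow> area_le F R m (wc w))"
    unfolding area_bound_def area_le_def Let_def by (rule refl)
  also have "\<dots> \<longleftrightarrow> (\<forall>w\<in>lists A. length w \<le> n \<and> word_val G w = \<one> \<longrightarrow> area_le F R m (wc w))"
  proof (intro iffI ballI impI)
    fix w assume a: "\<forall>w\<in>lists strict_letters. length w \<le> n \<and> word_val G w = \<one> \<longrightarrow> area_le F R m (wc w)"
      and w: "w \<in> lists A" "length w \<le> n \<and> word_val G w = \<one>"
    obtain v where v: "v \<in> lists strict_letters" "wc v = wc w" "length v \<le> length w" "word_val G v = word_val G w"
      using strict_word[OF w(1)] by blast
    then show "area_le F R m (wc w)" using bspec[OF a v(1)] w(2) by simp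
  next
    fix w assume a: "\<forall>w\<in>lists A. length w \<le> n \<and> word_val G w = \<one> \<longrightarrow> area_le F R m (wc w)"
      and w: "w \<in> lists strict_letters" "length w \<le> n \<and> word_val G w = \<one>"
    have "w \<in> lists A" using subsetD[OF lists_mono[OF strict_letters_subset] w(1)] .
    then show "area_le F R m (wc w)" using bspec[OF a] w(2) by simp
  qed
  finally show ?thesis .
qed

lemma rel_dehn_finite_iff: "rel_dehn G \<H> S R n < \<infinity> \<longleftrightarrow> (\<exists>m. area_bound G \<H> S R n m)"
  unfolding rel_dehn_def by (simp only: INF_less_iff) auto

lemma wc_par_mult:
  assumes "H \<in> \<H>" "h \<in> H" "k \<in> H"
  shows "wc [Par H (h \<otimes> k)] = wc [Par H h] \<otimes>\<^bsub>F\<^esub> wc [Par H k]"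
proof -
  have "[Par H h] \<in> lists A" "[Par H k] \<in> lists A" using assms by (auto simp: alphabet_def)
  then have "wc [Par H h] \<otimes>\<^bsub>F\<^esub> wc [Par H k] = wc [Par H h, Par H k]"
    by (simp flip: wc_append)
  then show ?thesis using wc_eqI[OF fp_eq.par_mult[OF assms]] by simp
qed

end


section \<open>The relative Dehn function of an amalgamated product\<close>

text \<open>One conjugate of u k' pays for replacing u by k, after which l, k and l' are neighbours
  and can be merged. Here k' is the inverse of k; a one-sided equation is what the relations of the
  copy of L provide.\<close>

lemma (in group) pinch_identity:
  assumes "k' \<otimes> k = \<one>" "x \<in> carrier G" "l \<in> carrier G" "u \<in> carrier G" "k \<in> carrier G" "k' \<in> carrier G"
    "l' \<in> carrier G" "y \<in> carrier G"
  shows "x \<otimes> (l \<otimes> (u \<otimes> (l' \<otimes> y))) =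
    ((x \<otimes> l) \<otimes> (u \<otimes> k') \<otimes> inv (x \<otimes> l)) \<otimes> (x \<otimes> ((l \<otimes> k \<otimes> l') \<otimes> y))"
proof -
  have "inv (x \<otimes> l) \<otimes> (x \<otimes> ((l \<otimes> k \<otimes> l') \<otimes> y)) = k \<otimes> (l' \<otimes> y)"
    using assms(2-) by (simp add: inv_solve_left' m_assoc)
  moreover have "k' \<otimes> (k \<otimes> (l' \<otimes> y)) = l' \<otimes> y"
    using assms by (simp flip: m_assoc)
  ultimately show ?thesis using assms(2-) by (simp add: m_assoc)
qed

locale amalgam_words = amalgam G M \<iota> K L N
  for G :: "('a, 'b) monoid_scheme" (structure) and M :: "('m, 'c) monoid_scheme"
    and \<iota> :: "'a \<Rightarrow> 'm" and K :: "'a set" and L N :: "'m set" +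
  fixes \<H> :: "'a set set" and S :: "'a set"
  assumes \<H>: "\<And>H. H \<in> \<H> \<Longrightarrow> subgroup H G" and K_notin: "K \<notin> \<H>" and S: "S \<subseteq> carrier G"
begin

abbreviation \<H>\<^sub>M :: "'m set set" where "\<H>\<^sub>M \<equiv> insert L ((\<lambda>H. \<iota> ` H) ` \<H>)"

sublocale base: rel_words G S "insert K \<H>"
  using S \<H> K by (intro rel_words.intro rel_words_axioms.intro is_group) auto

sublocale big: rel_words M "\<iota> ` S" \<H>\<^sub>M
  using S \<H> L
  by (intro rel_words.intro rel_words_axioms.intro M.is_group) (auto intro: \<iota>.subgroup_img_is_subgroup)

text \<open>The tag K becomes L, which embeds the copy of K into the larger copy of L. Since K
  \<notin> \<H>, every letter tagged by \<iota>(H) with H \<in> \<H> is still a lift.\<close>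

fun lift :: "('a, 'a) letter \<Rightarrow> ('m, 'm) letter" where
  "lift (Gen x) = Gen (\<iota> x)"
| "lift (GenInv x) = GenInv (\<iota> x)"
| "lift (Par H h) = Par (if H = K then L else \<iota> ` H) (\<iota> h)"

lemma lift_alphabet: "a \<in> base.A \<Longrightarrow> lift a \<in> big.A"
  using K_L by (cases a) (auto simp: alphabet_def)

lemma lift_words: "w \<in> lists base.A \<Longrightarrow> map lift w \<in> lists big.A"
  by (induction w) (auto simp: lift_alphabet)

lemma lift_fp_eq:
  assumes "fp_eq G S (insert K \<H>) u v"
  shows "fp_eq M (\<iota> ` S) \<H>\<^sub>M (map lift u) (map lift v)"
  using assms
proof (induction rule: fp_eq.induct)
  case (word_refl w)
  then show ?case by (intro fp_eq.word_refl lift_words)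
next
  case (word_sym v w)
  show ?case by (rule fp_eq.word_sym[OF word_sym.IH])
next
  case (word_trans u v w)
  show ?case by (rule fp_eq.word_trans[OF word_trans.IH])
next
  case (word_append u u' v v')
  show ?case using fp_eq.word_append[OF word_append.IH] by simp
next
  case (par_one H)
  then have "(if H = K then L else \<iota> ` H) \<in> \<H>\<^sub>M" by auto
  from fp_eq.par_one[OF this, of M "\<iota> ` S"] show ?case by simp
next
  case (par_mult H h k)
  then have "(if H = K then L else \<iota> ` H) \<in> \<H>\<^sub>M" "\<iota> h \<in> (if H = K then L else \<iota> ` H)"
    "\<iota> k \<in> (if H = K then L else \<iota> ` H)" "h \<in> carrier G" "k \<in> carrier G"
    using K_L base.\<H>[OF par_mult(1)] by (auto dest: subgroup.mem_carrier)
  then show ?case using fp_eq.par_mult[of "if H = K then L else \<iota> ` H" \<H>\<^sub>M "\<iota> h" "\<iota> k" M "\<iota> ` S"] by simp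
qed (auto intro: fp_eq.intros)

text \<open>By \<open>lift_fp_eq\<close> the chosen representative does not matter.\<close>

definition lift_class :: "('a, 'a) letter list set \<Rightarrow> ('m, 'm) letter list set" where
  "lift_class x = big.wc (map lift (SOME w. w \<in> x))"

lemma lift_class_wc:
  assumes "w \<in> lists base.A" shows "lift_class (base.wc w) = big.wc (map lift w)"
proof -
  have "w \<in> base.wc w" using fp_eq.word_refl[OF assms] by (simp add: word_class_def)
  then have "(SOME v. v \<in> base.wc w) \<in> base.wc w" by (rule someI)
  then have "fp_eq G S (insert K \<H>) w (SOME v. v \<in> base.wc w)" by (simp add: word_class_def)
  from big.wc_eqI[OF lift_fp_eq[OF this]] show ?thesis by (simp add: lift_class_def)
qed

sublocale lift: group_hom base.F big.F lift_class
proof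
  show "lift_class \<in> hom base.F big.F"
  proof (rule homI)
    fix x assume "x \<in> carrier base.F"
    then show "lift_class x \<in> carrier big.F"
      unfolding base.F_carrier using lift_class_wc big.wc_carrier lift_words by auto
  next
    fix x y assume "x \<in> carrier base.F" "y \<in> carrier base.F"
    then obtain u v where uv: "u \<in> lists base.A" "v \<in> lists base.A" "x = base.wc u" "y = base.wc v"
      unfolding base.F_carrier by blast
    then have "u @ v \<in> lists base.A" by simp
    then have "lift_class (x \<otimes>\<^bsub>base.F\<^esub> y) = big.wc (map lift u @ map lift v)"
      using uv lift_class_wc[of "u @ v"] by (simp flip: base.wc_append)
    then show "lift_class (x \<otimes>\<^bsub>base.F\<^esub> y) = lift_class x \<otimes>\<^bsub>big.F\<^esub> lift_class y"
      using uv lift_words by (simp add: lift_class_wc big.wc_append)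
  qed
qed

lemma lift_letter_val: "a \<in> base.A \<Longrightarrow> letter_val M (lift a) = \<iota> (letter_val G a)"
  using S by (auto simp: alphabet_def)

lemma lift_word_val: "w \<in> lists base.A \<Longrightarrow> word_val M (map lift w) = \<iota> (word_val G w)"
  by (induction w) (auto simp: lift_letter_val base.letter_val_carrier base.word_val_carrier)

text \<open>Large letters are those of L - K; their number bounds the number of pinches to be
  removed. Every other letter comes from the alphabet of G, \<open>Par L (\<iota> k)\<close> being
  read as the lift of \<open>Par K k\<close>.\<close>

definition large :: "('m, 'm) letter \<Rightarrow> bool" where
  "large a \<longleftrightarrow> letter_val M a \<notin> \<iota> ` carrier G"

lemma big_letter_cases:
  assumes "a \<in> big.A"
  obtains (base) b where "b \<in> base.A" "a = lift b" | (L) l where "l \<in> L" "a = Par L l"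
proof -
  consider x where "x \<in> S" "a = Gen (\<iota> x)" | x where "x \<in> S" "a = GenInv (\<iota> x)"
    | H h where "H \<in> \<H>" "h \<in> H" "a = Par (\<iota> ` H) (\<iota> h)" | l where "l \<in> L" "a = Par L l"
    using assms by (auto simp: alphabet_def)
  then show thesis
  proof cases
    case 1
    then show ?thesis by (intro base[of "Gen x"]) (auto simp: alphabet_def)
  next
    case 2
    then show ?thesis by (intro base[of "GenInv x"]) (auto simp: alphabet_def)
  next
    case 3
    then show ?thesis using K_notin by (intro base[of "Par H h"]) (auto simp: alphabet_def)
  qed (rule L)
qed

lemma large_L:
  assumes "a \<in> big.A" "large a"
  obtains l where "l \<in> L" "l \<notin> \<iota> ` K" "a = Par L l"
  using assms(1)
proof (cases rule: big_letter_cases)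
  case (base b)
  then show ?thesis
    using assms(2) lift_letter_val base.letter_val_carrier by (simp add: large_def)
next
  case (L l)
  then show ?thesis using that assms(2) L_base_iff by (simp add: large_def)
qed

lemma small_lift:
  assumes "a \<in> big.A" "\<not> large a"
  shows "\<exists>b\<in>base.A. a = lift b"
  using assms(1)
proof (cases rule: big_letter_cases)
  case (L l)
  then obtain k where "k \<in> K" "l = \<iota> k" using assms(2) L_base_iff by (auto simp: large_def)
  then show ?thesis using L by (intro bexI[of _ "Par K k"]) (auto simp: alphabet_def)
qed blast

lemma small_word_lift:
  assumes "w \<in> lists big.A" "\<forall>a\<in>set w. \<not> large a"
  shows "\<exists>v\<in>lists base.A. w = map lift v"
  using assms
proof (induction w)
  case (Cons a w)
  then obtain b v where "b \<in> base.A" "a = lift b" "v \<in> lists base.A" "w = map lift v"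
    using small_lift[of a] by auto
  then show ?case by (intro bexI[of _ "b # v"]) auto
qed auto

text \<open>The analogue for amalgamated products of a pinch in Britton's lemma.\<close>

definition has_pinch :: "('m, 'm) letter list \<Rightarrow> bool" where
  "has_pinch w \<longleftrightarrow> (\<exists>x l u l' y. w = x @ [Par L l] @ map lift u @ [Par L l'] @ y \<and>
    l \<in> L \<and> l' \<in> L \<and> l \<notin> \<iota> ` K \<and> l' \<notin> \<iota> ` K \<and> u \<in> lists base.A \<and> word_val G u \<in> K)"

lemma has_pinch_Cons: "has_pinch w \<Longrightarrow> has_pinch (a # w)"
  unfolding has_pinch_def by (metis append_Cons)

text \<open>Ping-pong along the word, from right to left. A large letter sends the value of the
  remaining word into N unless that value is already in N; in that case \<open>base_in_N\<close>
  puts the value of the part before the next large letter into K, which is a pinch.\<close>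

lemma no_pinch:
  assumes "w \<in> lists big.A" "\<not> has_pinch w"
  shows "(\<exists>v\<in>lists base.A. w = map lift v) \<or>
    (\<exists>u\<in>lists base.A. \<exists>l y. w = map lift u @ Par L l # y \<and> l \<in> L \<and> l \<notin> \<iota> ` K \<and>
       y \<in> lists big.A \<and> word_val M (Par L l # y) \<in> N)"
  using assms
proof (induction w)
  case (Cons a w)
  then have aw: "a \<in> big.A" "w \<in> lists big.A" and np: "\<not> has_pinch w" using has_pinch_Cons by auto
  note IH = Cons.IH[OF np]
  show ?case
  proof (cases "large a")
    case False
    then obtain b where b: "b \<in> base.A" "a = lift b" using small_lift[OF aw(1)] by blast
    from IH show ?thesis
    proof
      assume "\<exists>v\<in>lists base.A. w = map lift v"
      then obtain v where "v \<in> lists base.A" "w = map lift v" by blast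
      then show ?thesis using b by (intro disjI1 bexI[of _ "b # v"]) auto
    next
      assume "\<exists>u\<in>lists base.A. \<exists>l y. w = map lift u @ Par L l # y \<and> l \<in> L \<and> l \<notin> \<iota> ` K \<and>
        y \<in> lists big.A \<and> word_val M (Par L l # y) \<in> N"
      then obtain u l y where u: "u \<in> lists base.A" "w = map lift u @ Par L l # y"
        "l \<in> L \<and> l \<notin> \<iota> ` K \<and> y \<in> lists big.A \<and> word_val M (Par L l # y) \<in> N" by blast
      then show ?thesis using b by (intro disjI2 bexI[of _ "b # u"] exI conjI) auto
    qed
  next
    case True
    then obtain l where l: "l \<in> L" "l \<notin> \<iota> ` K" "a = Par L l" by (rule large_L[OF aw(1)])
    have "word_val M w \<notin> N"
    proof
      assume inN: "word_val M w \<in> N"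
      then have "\<not> (\<exists>v\<in>lists base.A. w = map lift v)"
        using lift_word_val base.word_val_carrier base_notin_N by auto
      then obtain u l' y where u: "u \<in> lists base.A" "w = map lift u @ Par L l' # y"
        "l' \<in> L" "l' \<notin> \<iota> ` K" "y \<in> lists big.A" "word_val M (Par L l' # y) \<in> N"
        using IH by blast
      have "Par L l' # y \<in> lists big.A" using u by (auto simp: alphabet_def)
      then have "word_val M w = \<iota> (word_val G u) \<otimes>\<^bsub>M\<^esub> word_val M (Par L l' # y)"
        using big.word_val_append[OF lift_words[OF u(1)]] u(2) lift_word_val[OF u(1)] by metis
      then have "word_val G u \<in> K"
        using base_in_N[OF base.word_val_carrier[OF u(1)] u(6)] inN by simp
      then have "has_pinch (a # w)"
        unfolding has_pinch_def using u l by (intro exI[of _ "[]"]) auto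
      then show False using Cons.prems by blast
    qed
    then have "word_val M (Par L l # w) \<in> N"
      using ping[OF l(1,2) big.word_val_carrier[OF aw(2)]] by simp
    then have "\<exists>u\<in>lists base.A. \<exists>l y. a # w = map lift u @ Par L l # y \<and> l \<in> L \<and> l \<notin> \<iota> ` K \<and>
        y \<in> lists big.A \<and> word_val M (Par L l # y) \<in> N"
      using l aw by (intro bexI[of _ "[]"]) auto
    then show ?thesis by blast
  qed
qed auto

text \<open>Without a pinch the value is \<iota>(g) n with n \<in> N. If it were 1, then n would be
  in \<iota>(G), which is disjoint from N.\<close>

lemma trivial_word_pinch:
  assumes w: "w \<in> lists big.A" and one: "word_val M w = \<one>\<^bsub>M\<^esub>" and large: "\<exists>a\<in>set w. large a"
  shows "has_pinch w"
proof (rule ccontr)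
  assume "\<not> has_pinch w"
  moreover have "\<not> (\<exists>v\<in>lists base.A. w = map lift v)"
    using large lift_letter_val base.letter_val_carrier by (auto simp: large_def in_lists_conv_set)
  ultimately obtain u l y where u: "u \<in> lists base.A" "w = map lift u @ Par L l # y"
    "l \<in> L" "l \<notin> \<iota> ` K" "y \<in> lists big.A" "word_val M (Par L l # y) \<in> N"
    using no_pinch[OF w] by blast
  let ?v = "word_val M (Par L l # y)" and ?g = "word_val G u"
  note g = base.word_val_carrier[OF u(1)]
  have "Par L l # y \<in> lists big.A" using u by (auto simp: alphabet_def)
  then have "\<iota> ?g \<otimes>\<^bsub>M\<^esub> ?v = \<one>\<^bsub>M\<^esub>"
    using big.word_val_append[OF lift_words[OF u(1)]] u(2) lift_word_val[OF u(1)] one by metis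
  then have "?v = \<iota> (inv ?g)"
    using g u(6) N_carrier M.inv_equality[of "\<iota> ?g" ?v] M.inv_comm[of "\<iota> ?g" ?v] by (auto simp: M.inv_equality)
  then show False using u(6) base_notin_N[of "inv ?g"] g by simp
qed

section \<open>Areas: removal of pinches\<close>

lemma Par_L_words: "l \<in> L \<Longrightarrow> [Par L l] \<in> lists big.A"
  by (auto simp: alphabet_def)

lemma area_le_base:
  assumes R: "R \<subseteq> carrier base.F" and b: "area_bound G (insert K \<H>) S R n d"
    and v: "v \<in> lists base.A" "length v \<le> n" "word_val G v = \<one>"
  shows "area_le big.F (lift_class ` R) d (big.wc (map lift v))"
  using lift.area_le_hom[OF R order_refl] b v
  by (auto simp: base.area_bound_iff simp flip: lift_class_wc)

text \<open>Closing u by the letter k^-1 of K gives a word of length at most n + 1 that represents 1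
  in G, which explains \<open>Suc n\<close> in the bound. Its lifted filling is the conjugate in
  \<open>pinch_identity\<close>; merging l, k and l' uses only the multiplication of the copy of L
  and costs nothing.\<close>

lemma area_le_pinch:
  assumes R: "R \<subseteq> carrier base.F" and b: "area_bound G (insert K \<H>) S R (Suc n) d"
    and u: "u \<in> lists base.A" "length u \<le> n" "word_val G u \<in> K"
    and l: "l \<in> L" "l' \<in> L" and x: "x \<in> lists big.A" and y: "y \<in> lists big.A"
    and area: "area_le big.F (lift_class ` R) m
      (big.wc (x @ [Par L (l \<otimes>\<^bsub>M\<^esub> \<iota> (word_val G u) \<otimes>\<^bsub>M\<^esub> l')] @ y))"
  shows "area_le big.F (lift_class ` R) (d + m)
    (big.wc (x @ [Par L l] @ map lift u @ [Par L l'] @ y))"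
proof -
  let ?k = "word_val G u"
  note kc = K_carrier[OF u(3)]
  have kL: "\<iota> ?k \<in> L" using u K_L by blast
  have R': "lift_class ` R \<subseteq> carrier big.F" using R lift.hom_closed by blast
  have K1: "[Par K (inv ?k)] \<in> lists base.A" "[Par K ?k] \<in> lists base.A"
    using u(3) K_inv by (auto simp: alphabet_def)
  let ?v = "u @ [Par K (inv ?k)]"
  have v: "?v \<in> lists base.A" using u(1) K1 by simp
  have "word_val G ?v = \<one>"
    using base.word_val_append[OF u(1) K1(1)] kc by simp
  then have av: "area_le big.F (lift_class ` R) d (big.wc (map lift ?v))"
    using area_le_base[OF R b v] u(2) by simp
  let ?U = "big.wc (map lift u)" and ?X = "big.wc x" and ?Y = "big.wc y"
    and ?l = "big.wc [Par L l]" and ?l' = "big.wc [Par L l']" and ?K = "big.wc [Par L (\<iota> ?k)]"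
    and ?K' = "big.wc [Par L (\<iota> (inv ?k))]"
  note words = lift_words[OF u(1)] Par_L_words[OF l(1)] Par_L_words[OF l(2)] Par_L_words[OF kL] x y
  have kiL: "\<iota> (inv ?k) \<in> L" using kL L_inv kc by simp
  note c = words[THEN big.wc_carrier] Par_L_words[OF kiL, THEN big.wc_carrier]
  have KK: "?K' \<otimes>\<^bsub>big.F\<^esub> ?K = \<one>\<^bsub>big.F\<^esub>"
  proof -
    have "?K' \<otimes>\<^bsub>big.F\<^esub> ?K = big.wc [Par L \<one>\<^bsub>M\<^esub>]"
      using big.wc_par_mult[of L "\<iota> (inv ?k)" "\<iota> ?k"] kL kiL kc by (simp flip: \<iota>.hom_mult del: \<iota>.hom_inv)
    also have "\<dots> = \<one>\<^bsub>big.F\<^esub>" unfolding big.F_one by (intro big.wc_eqI fp_eq.par_one) auto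
    finally show ?thesis .
  qed
  have vU: "big.wc (map lift ?v) = ?U \<otimes>\<^bsub>big.F\<^esub> ?K'"
    using big.wc_append[OF words(1) Par_L_words[OF kiL]] by (simp del: \<iota>.hom_inv)
  have merged: "big.wc [Par L (l \<otimes>\<^bsub>M\<^esub> \<iota> ?k \<otimes>\<^bsub>M\<^esub> l')] = ?l \<otimes>\<^bsub>big.F\<^esub> ?K \<otimes>\<^bsub>big.F\<^esub> ?l'"
    using l kL by (simp add: big.wc_par_mult L_mult)
  have mw: "[Par L (l \<otimes>\<^bsub>M\<^esub> \<iota> ?k \<otimes>\<^bsub>M\<^esub> l')] \<in> lists big.A"
    using l kL by (intro Par_L_words L_mult)
  let ?f = "?X \<otimes>\<^bsub>big.F\<^esub> ?l"
  have f: "?f \<in> carrier big.F" by (rule big.F.m_closed[OF c(5) c(2)])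
  have "big.wc (x @ [Par L l] @ map lift u @ [Par L l'] @ y) =
      ?X \<otimes>\<^bsub>big.F\<^esub> (?l \<otimes>\<^bsub>big.F\<^esub> (?U \<otimes>\<^bsub>big.F\<^esub> (?l' \<otimes>\<^bsub>big.F\<^esub> ?Y)))"
    using words by (simp only: big.wc_append append_in_lists_conv)
  also have "\<dots> = (?f \<otimes>\<^bsub>big.F\<^esub> (?U \<otimes>\<^bsub>big.F\<^esub> ?K') \<otimes>\<^bsub>big.F\<^esub> inv\<^bsub>big.F\<^esub> ?f) \<otimes>\<^bsub>big.F\<^esub>
      (?X \<otimes>\<^bsub>big.F\<^esub> ((?l \<otimes>\<^bsub>big.F\<^esub> ?K \<otimes>\<^bsub>big.F\<^esub> ?l') \<otimes>\<^bsub>big.F\<^esub> ?Y))"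
    by (rule big.F.pinch_identity[OF KK c(5) c(2) c(1) c(4) c(7) c(3) c(6)])
  also have "?X \<otimes>\<^bsub>big.F\<^esub> ((?l \<otimes>\<^bsub>big.F\<^esub> ?K \<otimes>\<^bsub>big.F\<^esub> ?l') \<otimes>\<^bsub>big.F\<^esub> ?Y) =
      big.wc (x @ [Par L (l \<otimes>\<^bsub>M\<^esub> \<iota> ?k \<otimes>\<^bsub>M\<^esub> l')] @ y)"
    using words mw by (simp only: big.wc_append append_in_lists_conv merged)
  finally show ?thesis
    using big.F.area_le_mult[OF R' big.F.area_le_conj[OF R' av f] area] by (simp only: vU)
qed

text \<open>Each pinch replaces two large letters by at most one and does not lengthen the word, so
  p pinches cost at most p d. The remaining word without large letters needs one more filling in G,
  hence the factor \<open>Suc p\<close>.\<close>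

lemma area_le_big:
  assumes R: "R \<subseteq> carrier base.F" and b: "area_bound G (insert K \<H>) S R (Suc n) d"
    and "w \<in> lists big.A" "length w \<le> n" "word_val M w = \<one>\<^bsub>M\<^esub>" "length (filter large w) \<le> p"
  shows "area_le big.F (lift_class ` R) (Suc p * d) (big.wc w)"
  using assms(3-)
proof (induction p arbitrary: w)
  case 0
  then have "\<forall>a\<in>set w. \<not> large a" by (simp add: filter_empty_conv)
  then obtain v where v: "v \<in> lists base.A" "w = map lift v" using small_word_lift[OF 0(1)] by blast
  then have "\<iota> (word_val G v) = \<iota> \<one>" using lift_word_val[OF v(1)] 0(3) by simp
  then have "word_val G v = \<one>" using \<iota>_eq_iff base.word_val_carrier[OF v(1)] by blast
  then show ?case using area_le_base[OF R b v(1)] v 0(2) by simp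
next
  case (Suc p)
  show ?case
  proof (cases "\<exists>a\<in>set w. large a")
    case False
    then have "length (filter large w) \<le> p" by (simp add: filter_empty_conv)
    then show ?thesis using area_le_mono[OF Suc.IH[OF Suc.prems(1-3)]] by simp
  next
    case True
    then obtain x l u l' y where w: "w = x @ [Par L l] @ map lift u @ [Par L l'] @ y"
      and l: "l \<in> L" "l' \<in> L" "l \<notin> \<iota> ` K" "l' \<notin> \<iota> ` K" and u: "u \<in> lists base.A" "word_val G u \<in> K"
      using trivial_word_pinch[OF Suc.prems(1,3)] unfolding has_pinch_def by blast
    let ?m = "l \<otimes>\<^bsub>M\<^esub> \<iota> (word_val G u) \<otimes>\<^bsub>M\<^esub> l'"
    let ?w' = "x @ [Par L ?m] @ y"
    have xy: "x \<in> lists big.A" "y \<in> lists big.A" using Suc.prems(1) w by auto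
    have m: "?m \<in> L" using l u K_L by (auto intro!: L_mult)
    have w': "?w' \<in> lists big.A" using xy Par_L_words[OF m] by simp
    have "word_val M w = word_val M ?w'"
      using xy l m u lift_words[OF u(1)] L_carrier K_carrier
        big.word_val_carrier[OF xy(1)] big.word_val_carrier[OF xy(2)]
      by (simp add: w big.word_val_append alphabet_def lift_word_val M.m_assoc)
    moreover have "large (Par L l)" "large (Par L l')"
      using l L_base_iff by (auto simp: large_def)
    then have "length (filter large ?w') \<le> p" using Suc.prems(4) by (simp add: w)
    ultimately have "area_le big.F (lift_class ` R) (Suc p * d) (big.wc ?w')"
      using Suc.prems(2,3) by (intro Suc.IH[OF w']) (auto simp: w)
    then have "area_le big.F (lift_class ` R) (d + Suc p * d) (big.wc w)"
      unfolding w using Suc.prems(2) by (intro area_le_pinch[OF R b u(1) _ u(2) l(1,2) xy]) (auto simp: w)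
    then show ?thesis by simp
  qed
qed

lemma area_bound_big:
  assumes R: "R \<subseteq> carrier base.F" and b: "area_bound G (insert K \<H>) S R (Suc n) d"
  shows "area_bound M \<H>\<^sub>M (\<iota> ` S) (lift_class ` R) n (Suc n * d)"
  unfolding big.area_bound_iff
proof (intro ballI impI)
  fix w assume w: "w \<in> lists big.A" "length w \<le> n \<and> word_val M w = \<one>\<^bsub>M\<^esub>"
  then have "length (filter large w) \<le> n" using length_filter_le[of large w] by linarith
  then show "area_le big.F (lift_class ` R) (Suc n * d) (big.wc w)"
    using w by (intro area_le_big[OF R b]) auto
qed

end

section \<open>The finite relative presentation of M\<close>

context amalgam
begin

lemma class_D_amalgam:
  assumes D: "class_D G (insert K \<H>)" and K\<H>: "K \<notin> \<H>"
  shows "class_D M (insert L ((\<lambda>H. \<iota> ` H) ` \<H>))"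
proof -
  obtain S R where pair: "group_pair G (insert K \<H>)" and pres: "finite_rel_presentation G (insert K \<H>) S R"
    and dehn: "\<And>n. rel_dehn G (insert K \<H>) S R n < \<infinity>"
    using D unfolding class_D_def by blast
  interpret amalgam_words G M \<iota> K L N \<H> S
    using pair pres K\<H>
    by (intro amalgam_words.intro amalgam_words_axioms.intro amalgam_axioms)
       (auto simp: group_pair_def finite_rel_presentation_def Let_def)
  have SR: "finite S" "finite R" "R \<subseteq> carrier base.F" "natural_map G ` carrier base.F = carrier G"
    "normal_closure base.F R = kernel base.F G (natural_map G)"
    using pres by (auto simp: finite_rel_presentation_def Let_def)
  note R = SR(3)
  have R': "lift_class ` R \<subseteq> carrier big.F" using R lift.hom_closed by blast
  have bound: "\<exists>m. area_bound M \<H>\<^sub>M (\<iota> ` S) (lift_class ` R) n m" for n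
    using dehn[of "Suc n"] area_bound_big[OF R] unfolding base.rel_dehn_finite_iff by blast
  have pair': "group_pair M \<H>\<^sub>M"
    using pair M.is_group big.\<H> by (auto simp: group_pair_def)
  have nat_lift: "natural_map M (lift_class x) = \<iota> (natural_map G x)" if "x \<in> carrier base.F" for x
    using that lift_class_wc big.natural_map_wc lift_words lift_word_val base.natural_map_wc
    unfolding base.F_carrier by auto
  have "carrier M \<subseteq> natural_map M ` carrier big.F"
  proof -
    have sub: "subgroup (natural_map M ` carrier big.F) M"
      by (rule big.nat.img_is_subgroup)
    have "\<iota> ` carrier G \<subseteq> natural_map M ` carrier big.F"
    proof
      fix y assume "y \<in> \<iota> ` carrier G"
      then obtain x where x: "x \<in> carrier base.F" "y = \<iota> (natural_map G x)"
        unfolding SR(4)[symmetric] by blast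
      then have "y = natural_map M (lift_class x)" using nat_lift by simp
      then show "y \<in> natural_map M ` carrier big.F" using lift.hom_closed[OF x(1)] by (rule image_eqI)
    qed
    moreover have "L \<subseteq> natural_map M ` carrier big.F"
    proof
      fix l assume l: "l \<in> L"
      then have "natural_map M (big.wc [Par L l]) = l"
        using big.natural_map_wc[OF Par_L_words] L_carrier by simp
      then show "l \<in> natural_map M ` carrier big.F"
        using big.wc_carrier[OF Par_L_words[OF l]] by (metis imageI)
    qed
    ultimately have "generate M (\<iota> ` carrier G \<union> L) \<subseteq> natural_map M ` carrier big.F"
      by (intro M.generate_subgroup_incl[OF _ sub] Un_least)
    then show ?thesis by (simp only: gen)
  qed
  moreover have "natural_map M ` carrier big.F \<subseteq> carrier M" using big.nat.hom_closed by blast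
  ultimately have surj: "natural_map M ` carrier big.F = carrier M" by (rule equalityI[rotated])
  have "lift_class ` R \<subseteq> kernel big.F M (natural_map M)"
  proof -
    have "R \<subseteq> kernel base.F G (natural_map G)"
      using base.F.subset_normal_closure[OF R] SR(5) by simp
    then show ?thesis using nat_lift by (auto simp: kernel_def subset_iff)
  qed
  then have "normal_closure big.F (lift_class ` R) \<subseteq> kernel big.F M (natural_map M)"
    by (rule big.nat.normal_closure_kernel)
  \<comment> \<open>A word that represents 1 has finite area over the lifted relators by
    \<open>bound\<close>, so it lies in their normal closure.\<close>
  moreover have "kernel big.F M (natural_map M) \<subseteq> normal_closure big.F (lift_class ` R)"
  proof
    fix x assume "x \<in> kernel big.F M (natural_map M)"
    then have x: "x \<in> big.wc ` lists big.A" "natural_map M x = \<one>\<^bsub>M\<^esub>"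
      by (simp_all add: kernel_def big.F_carrier)
    obtain w where w: "x = big.wc w" "w \<in> lists big.A" using x(1) by (rule imageE)
    have "word_val M w = \<one>\<^bsub>M\<^esub>" using x(2) big.natural_map_wc[OF w(2)] w(1) by simp
    obtain m where "area_bound M \<H>\<^sub>M (\<iota> ` S) (lift_class ` R) (length w) m" using bound by blast
    then have "area_le big.F (lift_class ` R) m (big.wc w)"
      using w(2) \<open>word_val M w = \<one>\<^bsub>M\<^esub>\<close> by (simp add: big.area_bound_iff)
    then show "x \<in> normal_closure big.F (lift_class ` R)"
      unfolding w(1) by (rule big.F.area_le_normal_closure[OF R'])
  qed
  ultimately have "finite_rel_presentation M \<H>\<^sub>M (\<iota> ` S) (lift_class ` R)"
    using SR R' surj big.S by (auto simp: finite_rel_presentation_def Let_def)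
  moreover have "rel_dehn M \<H>\<^sub>M (\<iota> ` S) (lift_class ` R) n < \<infinity>" for n
    using bound unfolding big.rel_dehn_finite_iff by blast
  ultimately show ?thesis using pair' unfolding class_D_def by blast
qed

end

section \<open>Distances and geodesics in graphs\<close>

text \<open>Without labels and orientation, paths become relational powers; labels only matter for
  deciding which edges are available.\<close>

definition adj :: "('v \<times> 'l \<times> 'v) set \<Rightarrow> ('v \<times> 'v) set" where
  "adj E = {(u, v). \<exists>l. (u, l, v) \<in> E \<or> (v, l, u) \<in> E}"

lemma adj_sym: "(u, v) \<in> adj E \<Longrightarrow> (v, u) \<in> adj E"
  by (auto simp: adj_def)

lemma adjI: "(u, a, v) \<in> E \<Longrightarrow> (u, v) \<in> adj E"
  by (auto simp: adj_def)

lemma adjE: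
  assumes "(u, v) \<in> adj E"
  obtains a where "(u, a, v) \<in> E" | a where "(v, a, u) \<in> E"
  using assms by (auto simp: adj_def)

lemma adj_mono: "E \<subseteq> E' \<Longrightarrow> adj E \<subseteq> adj E'"
  by (auto simp: adj_def)

lemma edge_path_relpow: "(\<exists>p. edge_path E u p v \<and> length p = n) \<longleftrightarrow> (u, v) \<in> adj E ^^ n"
proof
  have "edge_path E u p v \<Longrightarrow> (u, v) \<in> adj E ^^ length p" for p
  proof (induction rule: edge_path.induct)
    case (forward u l v p w)
    then have "(u, v) \<in> adj E" by (auto simp: adj_def)
    then show ?case using forward by (metis length_Cons relpow_Suc_I2)
  next
    case (backward v l u p w)
    then have "(u, v) \<in> adj E" by (auto simp: adj_def)
    then show ?case using backward by (metis length_Cons relpow_Suc_I2)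
  qed simp
  then show "\<exists>p. edge_path E u p v \<and> length p = n \<Longrightarrow> (u, v) \<in> adj E ^^ n" by blast
next
  show "(u, v) \<in> adj E ^^ n \<Longrightarrow> \<exists>p. edge_path E u p v \<and> length p = n"
  proof (induction n arbitrary: u)
    case 0
    then show ?case by (auto intro: edge_path.nil)
  next
    case (Suc n)
    then obtain w where w: "(u, w) \<in> adj E" "(w, v) \<in> adj E ^^ n" by (meson relpow_Suc_D2)
    then obtain p where p: "edge_path E w p v" "length p = n" using Suc.IH by blast
    from w(1) obtain l where "(u, l, w) \<in> E \<or> (w, l, u) \<in> E" unfolding adj_def by blast
    then show ?case
      using edge_path.forward[OF _ p(1), of u l] edge_path.backward[OF _ p(1), of l u] p(2)
      by (metis length_Cons)
  qed
qed

lemma graph_dist_le_iff: "graph_dist E u v \<le> enat n \<longleftrightarrow> (\<exists>m\<le>n. (u, v) \<in> adj E ^^ m)"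
proof
  assume "graph_dist E u v \<le> enat n"
  then have "graph_dist E u v < enat (Suc n)" by (rule le_less_trans) simp
  then obtain p where "edge_path E u p v" "length p < Suc n"
    unfolding graph_dist_def by (auto simp: INF_less_iff)
  then show "\<exists>m\<le>n. (u, v) \<in> adj E ^^ m" using edge_path_relpow less_Suc_eq_le by metis
next
  assume "\<exists>m\<le>n. (u, v) \<in> adj E ^^ m"
  then obtain p where "edge_path E u p v" "length p \<le> n" using edge_path_relpow by metis
  then show "graph_dist E u v \<le> enat n"
    unfolding graph_dist_def by (intro INF_lower2[of p]) auto
qed

lemma graph_dist_refl: "graph_dist E u u \<le> enat n"
  unfolding graph_dist_le_iff by (intro exI[of _ 0]) simp

lemma graph_dist_adj: "(u, v) \<in> adj E \<Longrightarrow> graph_dist E u v \<le> enat 1"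
  unfolding graph_dist_le_iff by (intro exI[of _ 1]) simp

lemma graph_dist_trans:
  "graph_dist E u v \<le> enat m \<Longrightarrow> graph_dist E v w \<le> enat n \<Longrightarrow> graph_dist E u w \<le> enat (m + n)"
  unfolding graph_dist_le_iff by (meson add_mono relpow_trans)

lemma adj_relpow_sym: "(u, v) \<in> adj E ^^ n \<Longrightarrow> (v, u) \<in> adj E ^^ n"
proof (induction n arbitrary: v)
  case (Suc n)
  then obtain w where "(u, w) \<in> adj E ^^ n" "(w, v) \<in> adj E" by auto
  then show ?case using Suc.IH adj_sym by (metis relpow_Suc_I2)
qed simp

lemma graph_dist_sym: "graph_dist E u v \<le> enat n \<Longrightarrow> graph_dist E v u \<le> enat n"
  unfolding graph_dist_le_iff by (metis adj_relpow_sym)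

lemma graph_dist_mono: "graph_dist E u v \<le> enat m \<Longrightarrow> m \<le> n \<Longrightarrow> graph_dist E u v \<le> enat n"
  by (meson enat_ord_simps(1) order_trans)

text \<open>A bound of 1 on the images, rather than adjacency, allows edges to be collapsed.\<close>

lemma graph_dist_map:
  assumes f: "\<And>u v. (u, v) \<in> adj E \<Longrightarrow> graph_dist E' (f u) (f v) \<le> enat 1"
    and d: "graph_dist E u v \<le> enat n"
  shows "graph_dist E' (f u) (f v) \<le> enat n"
proof -
  have *: "(u, v) \<in> adj E ^^ m \<Longrightarrow> graph_dist E' (f u) (f v) \<le> enat m" for m
  proof (induction m arbitrary: v)
    case 0
    then show ?case using graph_dist_refl by simp
  next
    case (Suc m)
    then obtain w where "(u, w) \<in> adj E ^^ m" "(w, v) \<in> adj E" by auto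
    then show ?case using graph_dist_trans[OF Suc.IH f] by simp
  qed
  obtain m where m: "m \<le> n" "(u, v) \<in> adj E ^^ m" using d by (auto simp: graph_dist_le_iff)
  show ?thesis by (rule graph_dist_mono[OF *[OF m(2)] m(1)])
qed

lemma geodesic_dist:
  "geodesic V E x y n \<gamma> \<Longrightarrow> i \<le> j \<Longrightarrow> j \<le> n \<Longrightarrow> graph_dist E (\<gamma> i) (\<gamma> j) = enat (j - i)"
  by (simp add: geodesic_def)

lemma geodesic_mem: "geodesic V E x y n \<gamma> \<Longrightarrow> i \<le> n \<Longrightarrow> \<gamma> i \<in> V"
  by (auto simp: geodesic_def)

lemma geodesic_ends: "geodesic V E x y n \<gamma> \<Longrightarrow> \<gamma> 0 = x" "geodesic V E x y n \<gamma> \<Longrightarrow> \<gamma> n = y"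
  by (simp_all add: geodesic_def)

lemma geodesic_adj:
  assumes g: "geodesic V E x y n \<gamma>" and i: "i < n"
  shows "(\<gamma> i, \<gamma> (Suc i)) \<in> adj E"
proof -
  have d: "graph_dist E (\<gamma> i) (\<gamma> (Suc i)) = enat 1" using geodesic_dist[OF g, of i "Suc i"] i by simp
  then have "graph_dist E (\<gamma> i) (\<gamma> (Suc i)) \<le> enat 1" by simp
  then obtain m where m: "m \<le> 1" "(\<gamma> i, \<gamma> (Suc i)) \<in> adj E ^^ m" unfolding graph_dist_le_iff by blast
  have "m \<noteq> 0"
  proof
    assume "m = 0"
    then have "\<gamma> i = \<gamma> (Suc i)" using m by simp
    then show False using d graph_dist_refl[of E "\<gamma> i" 0] by simp
  qed
  then have "m = 1" using m by simp
  then show ?thesis using m by simp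
qed

lemma geodesic_length_le:
  assumes "geodesic V E x y n \<gamma>" "i \<le> j" "j \<le> n" "graph_dist E (\<gamma> i) (\<gamma> j) \<le> enat d"
  shows "j - i \<le> d"
  using geodesic_dist[OF assms(1-3)] assms(4) by simp

lemma geodesic_exists:
  assumes d: "graph_dist E x y \<le> enat m" and V: "x \<in> V" "adj E \<subseteq> V \<times> V"
  shows "\<exists>n \<gamma>. n \<le> m \<and> geodesic V E x y n \<gamma>"
proof -
  define n where "n = (LEAST n. (x, y) \<in> adj E ^^ n)"
  obtain k where k: "k \<le> m" "(x, y) \<in> adj E ^^ k" using d by (auto simp: graph_dist_le_iff)
  have n: "(x, y) \<in> adj E ^^ n" unfolding n_def using k(2) by (rule LeastI)
  have least: "n \<le> j" if "(x, y) \<in> adj E ^^ j" for j unfolding n_def using that by (rule Least_le)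
  obtain \<gamma> where \<gamma>: "\<gamma> 0 = x" "\<gamma> n = y" "\<forall>i<n. (\<gamma> i, \<gamma> (Suc i)) \<in> adj E"
    using n unfolding relpow_fun_conv by blast
  have sub: "(\<gamma> i, \<gamma> (i + j)) \<in> adj E ^^ j" if "i + j \<le> n" for i j
    using that
  proof (induction j)
    case (Suc j)
    then have "(\<gamma> i, \<gamma> (i + j)) \<in> adj E ^^ j" "(\<gamma> (i + j), \<gamma> (i + Suc j)) \<in> adj E" using \<gamma>(3) by auto
    then show ?case by (auto)
  qed simp
  have "graph_dist E (\<gamma> i) (\<gamma> j) = enat (j - i)" if ij: "i \<le> j" "j \<le> n" for i j
  proof (rule antisym)
    have "(\<gamma> i, \<gamma> j) \<in> adj E ^^ (j - i)" using sub[of i "j - i"] ij by simp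
    then show "graph_dist E (\<gamma> i) (\<gamma> j) \<le> enat (j - i)" unfolding graph_dist_le_iff by (intro exI[of _ "j - i"]) simp
    \<comment> \<open>A shorter path between two points of \<gamma> would shorten the whole path
      from x to y below n.\<close>
    show "enat (j - i) \<le> graph_dist E (\<gamma> i) (\<gamma> j)"
    proof (cases "graph_dist E (\<gamma> i) (\<gamma> j)")
      case (enat q)
      then have "graph_dist E (\<gamma> i) (\<gamma> j) \<le> enat q" by simp
      then obtain r where r: "r \<le> q" "(\<gamma> i, \<gamma> j) \<in> adj E ^^ r" unfolding graph_dist_le_iff by blast
      have "(x, \<gamma> i) \<in> adj E ^^ i" using sub[of 0 i] ij \<gamma> by simp
      moreover have "(\<gamma> j, y) \<in> adj E ^^ (n - j)" using sub[of j "n - j"] ij \<gamma> by simp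
      ultimately have "(x, y) \<in> adj E ^^ (i + r + (n - j))" using r(2) relpow_trans by metis
      then have "n \<le> i + r + (n - j)" by (rule least)
      then show ?thesis using enat r ij by simp
    qed simp
  qed
  moreover have "\<gamma> i \<in> V" if "i \<le> n" for i
  proof (cases i)
    case (Suc k)
    then have "(\<gamma> k, \<gamma> i) \<in> adj E" using \<gamma>(3) that by auto
    then show ?thesis using V(2) by blast
  qed (use \<gamma> V in simp)
  ultimately have "geodesic V E x y n \<gamma>" using \<gamma> unfolding geodesic_def by auto
  moreover have "n \<le> m" using least k by fastforce
  ultimately show ?thesis by blast
qed

definition slim :: "nat \<Rightarrow> 'v set \<Rightarrow> ('v \<times> 'l \<times> 'v) set \<Rightarrow> bool" where
  "slim \<delta> V E \<longleftrightarrow> (\<forall>x y z l m n \<alpha> \<beta> \<gamma>.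
     geodesic V E x y l \<alpha> \<and> geodesic V E y z m \<beta> \<and> geodesic V E x z n \<gamma> \<longrightarrow>
     (\<forall>k\<le>n. \<exists>p \<in> \<alpha> ` {..l} \<union> \<beta> ` {..m}. graph_dist E (\<gamma> k) p \<le> enat \<delta>))"

lemma hyperbolic_graph_slim: "hyperbolic_graph V E \<longleftrightarrow> (\<exists>\<delta>. slim \<delta> V E)"
  unfolding hyperbolic_graph_def slim_def by (rule refl)

lemma slimD:
  assumes "slim \<delta> V E" "geodesic V E x y l \<alpha>" "geodesic V E y z m \<beta>" "geodesic V E x z n \<gamma>" "k \<le> n"
  obtains (left) i where "i \<le> l" "graph_dist E (\<gamma> k) (\<alpha> i) \<le> enat \<delta>"
    | (right) i where "i \<le> m" "graph_dist E (\<gamma> k) (\<beta> i) \<le> enat \<delta>"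
  using assms unfolding slim_def by blast

text \<open>The diagonal from a to d cuts the quadrilateral into two slim triangles. Passing from
  \<sigma> to \<tau> through both costs 2\<delta>; if one ends on a short side instead, 1 more leads
  to a corner of \<tau>.\<close>

lemma geodesics_fellow_travel:
  assumes slim: "slim \<delta> V E" and V: "adj E \<subseteq> V \<times> V"
    and conn: "\<And>u v. u \<in> V \<Longrightarrow> v \<in> V \<Longrightarrow> \<exists>n. graph_dist E u v \<le> enat n"
    and \<sigma>: "geodesic V E a b n \<sigma>" and \<tau>: "geodesic V E c d m \<tau>"
    and ac: "graph_dist E a c \<le> enat 1" and bd: "graph_dist E b d \<le> enat 1" and k: "k \<le> n"
  shows "\<exists>i\<le>m. graph_dist E (\<sigma> k) (\<tau> i) \<le> enat (2 * \<delta> + 1)"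
proof -
  have mem: "a \<in> V" "b \<in> V" "c \<in> V" "d \<in> V"
    using geodesic_mem[OF \<sigma>, of 0] geodesic_mem[OF \<sigma>, of n] geodesic_mem[OF \<tau>, of 0]
      geodesic_mem[OF \<tau>, of m] geodesic_ends[OF \<sigma>] geodesic_ends[OF \<tau>] by auto
  obtain p \<rho> where \<rho>: "geodesic V E a d p \<rho>"
    using conn[OF mem(1) mem(4)] geodesic_exists[OF _ mem(1) V] by blast
  obtain q \<eta> where \<eta>: "q \<le> 1" "geodesic V E d b q \<eta>"
    using geodesic_exists[OF graph_dist_sym[OF bd] mem(4) V] by blast
  obtain r \<zeta> where \<zeta>: "r \<le> 1" "geodesic V E a c r \<zeta>"
    using geodesic_exists[OF ac mem(1) V] by blast
  from slim \<rho> \<eta>(2) \<sigma> k show ?thesis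
  proof (cases rule: slimD)
    case (left i)
    from slim \<zeta>(2) \<tau> \<rho> left(1) show ?thesis
    proof (cases rule: slimD)
      case (left j)
      have "graph_dist E (\<zeta> j) c \<le> enat 1"
        using geodesic_dist[OF \<zeta>(2) left(1) order_refl] geodesic_ends[OF \<zeta>(2)] \<zeta>(1) by simp
      from graph_dist_trans[OF \<open>graph_dist E (\<sigma> k) (\<rho> i) \<le> enat \<delta>\<close> graph_dist_trans[OF left(2) this]]
      have "graph_dist E (\<sigma> k) (\<tau> 0) \<le> enat (\<delta> + (\<delta> + 1))" using geodesic_ends[OF \<tau>] by simp
      then show ?thesis by (intro exI[of _ 0]) (simp add: mult_2)
    next
      case (right j)
      then have "graph_dist E (\<sigma> k) (\<tau> j) \<le> enat (\<delta> + \<delta>)"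
        using graph_dist_trans[OF \<open>graph_dist E (\<sigma> k) (\<rho> i) \<le> enat \<delta>\<close> right(2)] by simp
      then show ?thesis
        using right(1) graph_dist_mono[of E "\<sigma> k" "\<tau> j" "\<delta> + \<delta>" "2 * \<delta> + 1"] by (intro exI[of _ j]) simp
    qed
  next
    case (right i)
    have "graph_dist E d (\<eta> i) \<le> enat 1"
      using geodesic_dist[OF \<eta>(2) le0 right(1)] geodesic_ends[OF \<eta>(2)] \<eta>(1) right(1) by simp
    from graph_dist_trans[OF right(2) graph_dist_sym[OF this]]
    have "graph_dist E (\<sigma> k) (\<tau> m) \<le> enat (\<delta> + 1)" using geodesic_ends[OF \<tau>] by simp
    then show ?thesis
      using graph_dist_mono[of E "\<sigma> k" "\<tau> m" "\<delta> + 1" "2 * \<delta> + 1"] by (intro exI[of _ m]) simp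
  qed
qed


section \<open>Cayley graphs\<close>

lemma (in group) cayley_edge_iff:
  "(u, a, v) \<in> cayley_edges G X \<H> \<longleftrightarrow> u \<in> carrier G \<and> v = u \<otimes> letter_val G a \<and>
    (a \<in> Gen ` X \<or> (\<exists>H h. a = Par H h \<and> H \<in> \<H> \<and> h \<in> H \<and> h \<noteq> \<one>))"
  by (auto simp: cayley_edges_def)

locale cayley = group G for G :: "('a, 'b) monoid_scheme" (structure) +
  fixes X :: "'a set" and \<H> :: "'a set set"
  assumes X: "X \<subseteq> carrier G" and \<H>: "\<And>H. H \<in> \<H> \<Longrightarrow> subgroup H G"
begin

abbreviation "E \<equiv> cayley_edges G X \<H>"

lemma edge_carrier:
  assumes "(u, a, v) \<in> E" shows "u \<in> carrier G" "v \<in> carrier G" "letter_val G a \<in> carrier G"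
proof -
  show u: "u \<in> carrier G" and a: "letter_val G a \<in> carrier G"
    using assms X subgroup.mem_carrier[OF \<H>] by (auto simp: cayley_edge_iff)
  show "v \<in> carrier G" using u a assms by (simp add: cayley_edge_iff)
qed

lemma adj_carrier: "(u, v) \<in> adj E \<Longrightarrow> u \<in> carrier G" "(u, v) \<in> adj E \<Longrightarrow> v \<in> carrier G"
  using edge_carrier by (auto simp: adj_def)

lemma edge_translate: "g \<in> carrier G \<Longrightarrow> (u, a, v) \<in> E \<Longrightarrow> (g \<otimes> u, a, g \<otimes> v) \<in> E"
  using edge_carrier[of u a v] by (auto simp: cayley_edge_iff m_assoc)

lemma dist_translate:
  assumes g: "g \<in> carrier G" and uv: "u \<in> carrier G" "v \<in> carrier G"
  shows "graph_dist E (g \<otimes> u) (g \<otimes> v) = graph_dist E u v"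
proof -
  have 1: "graph_dist E (h \<otimes> x) (h \<otimes> y) \<le> enat n"
    if "graph_dist E x y \<le> enat n" "h \<in> carrier G" for h x y n
    using that edge_translate[OF that(2)]
    by (intro graph_dist_map[OF _ that(1)] graph_dist_adj) (auto simp: adj_def)
  have 2: "graph_dist E (g \<otimes> u) (g \<otimes> v) \<le> enat n \<longleftrightarrow> graph_dist E u v \<le> enat n" for n
    using 1[of u v n g] 1[of "g \<otimes> u" "g \<otimes> v" n "inv g"] g uv by (auto simp: m_assoc[symmetric])
  show ?thesis
  proof (rule antisym)
    show "graph_dist E (g \<otimes> u) (g \<otimes> v) \<le> graph_dist E u v"
      using 2 by (cases "graph_dist E u v") auto
    show "graph_dist E u v \<le> graph_dist E (g \<otimes> u) (g \<otimes> v)"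
      using 2 by (cases "graph_dist E (g \<otimes> u) (g \<otimes> v)") auto
  qed
qed

lemma geodesic_translate:
  assumes "geodesic (carrier G) E x y n \<gamma>" "g \<in> carrier G"
  shows "geodesic (carrier G) E (g \<otimes> x) (g \<otimes> y) n (\<lambda>i. g \<otimes> \<gamma> i)"
  using assms unfolding geodesic_def by (auto simp: dist_translate image_subset_iff)

lemma member_edge: "H \<in> \<H> \<Longrightarrow> h \<in> H \<Longrightarrow> h \<noteq> \<one> \<Longrightarrow> u \<in> carrier G \<Longrightarrow> (u, Par H h, u \<otimes> h) \<in> E"
  by (auto simp: cayley_edge_iff)

lemma member_dist: "H \<in> \<H> \<Longrightarrow> h \<in> H \<Longrightarrow> u \<in> carrier G \<Longrightarrow> graph_dist E u (u \<otimes> h) \<le> enat 1"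
proof (cases "h = \<one>")
  case False
  assume "H \<in> \<H>" "h \<in> H" "u \<in> carrier G"
  then have "(u, u \<otimes> h) \<in> adj E" using member_edge[of H h u] False unfolding adj_def by blast
  then show ?thesis by (rule graph_dist_adj)
qed (use graph_dist_refl in simp)

lemma connected:
  assumes gen: "generate G (X \<union> \<Union>\<H>) = carrier G" and uv: "u \<in> carrier G" "v \<in> carrier G"
  shows "\<exists>n. graph_dist E u v \<le> enat n"
proof -
  have X_dist: "graph_dist E u (u \<otimes> x) \<le> enat 1" if "x \<in> X" "u \<in> carrier G" for x u
    using that by (intro graph_dist_adj) (auto simp: adj_def cayley_edge_iff intro!: exI[of _ "Gen x"])
  have "\<forall>u\<in>carrier G. \<exists>n. graph_dist E u (u \<otimes> w) \<le> enat n" if "w \<in> generate G (X \<union> \<Union>\<H>)" for w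
    using that
  proof (induction rule: generate.induct)
    case one
    then show ?case using graph_dist_refl[of E _ 0] by auto
  next
    case (incl h)
    then show ?case using X_dist member_dist by blast
  next
    case (inv h)
    then have h: "h \<in> carrier G" using X subgroup.mem_carrier[OF \<H>] by blast
    have "graph_dist E v (v \<otimes> h) \<le> enat 1" if "v \<in> carrier G" for v
      using X_dist member_dist inv that by blast
    then have "graph_dist E (u \<otimes> inv h) u \<le> enat 1" if "u \<in> carrier G" for u
      using h that by (metis inv_closed m_closed m_assoc l_inv r_one)
    from graph_dist_sym[OF this] show ?case by blast
  next
    case (eng h1 h2)
    show ?case
    proof
      fix u assume u: "u \<in> carrier G"
      have h: "h1 \<in> carrier G" "h2 \<in> carrier G" using eng gen by auto
      obtain m n where "graph_dist E u (u \<otimes> h1) \<le> enat m" "graph_dist E (u \<otimes> h1) (u \<otimes> h1 \<otimes> h2) \<le> enat n"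
        using eng u h by (meson m_closed)
      then show "\<exists>n. graph_dist E u (u \<otimes> (h1 \<otimes> h2)) \<le> enat n"
        using graph_dist_trans u h by (metis m_assoc)
    qed
  qed
  then obtain n where "graph_dist E u (u \<otimes> (inv u \<otimes> v)) \<le> enat n"
    using gen uv by (metis inv_closed m_closed)
  then show ?thesis using uv by (auto simp: m_assoc[symmetric])
qed

lemma adj_subset: "adj E \<subseteq> carrier G \<times> carrier G"
  using adj_carrier by auto

text \<open>Translation by h \<in> H maps no admissible edge to a forbidden one, since h x \<in> H
  implies x \<in> H. This moves the centre of a ball in H to \<one>.\<close>

lemma rel_dist_translate:
  assumes H: "H \<in> \<H>" and h: "h \<in> H" and d: "rel_dist G X \<H> H u v \<le> enat n"
  shows "rel_dist G X \<H> H (h \<otimes> u) (h \<otimes> v) \<le> enat n"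
  unfolding rel_dist_def
proof (rule graph_dist_map[OF _ d[unfolded rel_dist_def]])
  fix u v assume "(u, v) \<in> adj (E - {(u, Par H k, v) | u k v. u \<in> H \<and> v \<in> H})"
  then obtain a where a: "(u, a, v) \<in> E - {(u, Par H k, v) | u k v. u \<in> H \<and> v \<in> H} \<or>
    (v, a, u) \<in> E - {(u, Par H k, v) | u k v. u \<in> H \<and> v \<in> H}" by (auto simp: adj_def)
  have hc: "h \<in> carrier G" using subgroup.mem_carrier[OF \<H>[OF H] h] .
  have "x \<in> H" if x: "x \<in> carrier G" "h \<otimes> x \<in> H" for x
  proof -
    have "inv h \<otimes> (h \<otimes> x) \<in> H"
      using \<H>[OF H] h x(2) by (simp add: subgroup.m_closed subgroup.m_inv_closed)
    then show ?thesis using hc x(1) by (simp add: m_assoc[symmetric])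
  qed
  then have "(h \<otimes> x, a, h \<otimes> y) \<in> E - {(u, Par H k, v) | u k v. u \<in> H \<and> v \<in> H}"
    if "(x, a, y) \<in> E - {(u, Par H k, v) | u k v. u \<in> H \<and> v \<in> H}" for x y
    using that edge_translate[OF hc, of x a y] edge_carrier[of x a y] by blast
  then have "(h \<otimes> u, h \<otimes> v) \<in> adj (E - {(u, Par H k, v) | u k v. u \<in> H \<and> v \<in> H})"
    using a unfolding adj_def by blast
  then show "graph_dist (E - {(u, Par H k, v) | u k v. u \<in> H \<and> v \<in> H}) (h \<otimes> u) (h \<otimes> v) \<le> enat 1"
    by (rule graph_dist_adj)
qed

end


section \<open>Projection of an amalgamated product to a factor\<close>

context amalgam
begin

text \<open>
  In the tree of cosets of \<open>G\<close> and \<open>L\<close> in \<open>M\<close>, \<open>gate y\<close> is the coset of \<open>K\<close> in \<open>G\<close> that corresponds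
  to the edge at the vertex \<open>G\<close> in the direction of the vertex \<open>y L\<close>.
\<close>

definition gate :: "'m \<Rightarrow> 'a set" where
  "gate y = {g \<in> carrier G. inv\<^bsub>M\<^esub> (\<iota> g) \<otimes>\<^bsub>M\<^esub> y \<in> P}"

lemma gate_carrier: "g \<in> gate y \<Longrightarrow> g \<in> carrier G"
  by (simp add: gate_def)

text \<open>A gate lies in a single left coset of K because \<open>P_K\<close> separates the
  translates of \<open>P\<close>.\<close>

lemma gate_diff:
  assumes "y \<in> carrier M" "g \<in> gate y" "h \<in> gate y" shows "inv g \<otimes> h \<in> K"
proof -
  have gh: "g \<in> carrier G" "h \<in> carrier G" using assms gate_carrier by auto
  have "\<iota> (inv g \<otimes> h) \<otimes>\<^bsub>M\<^esub> (inv\<^bsub>M\<^esub> (\<iota> h) \<otimes>\<^bsub>M\<^esub> y) = inv\<^bsub>M\<^esub> (\<iota> g) \<otimes>\<^bsub>M\<^esub> y"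
    using gh assms(1) by (simp add: M.m_assoc) (simp add: M.m_assoc[symmetric])
  then show ?thesis
    using P_K[of "inv\<^bsub>M\<^esub> (\<iota> h) \<otimes>\<^bsub>M\<^esub> y" "inv g \<otimes> h"] assms gh by (simp add: gate_def)
qed

lemma gate_L_le:
  assumes "y \<in> carrier M" "l \<in> L" shows "gate y \<subseteq> gate (y \<otimes>\<^bsub>M\<^esub> l)"
  using assms P_L L_carrier by (auto simp: gate_def M.m_assoc[symmetric])

lemma gate_L:
  assumes "y \<in> carrier M" "l \<in> L" shows "gate (y \<otimes>\<^bsub>M\<^esub> l) = gate y"
proof
  have "gate (y \<otimes>\<^bsub>M\<^esub> l) \<subseteq> gate (y \<otimes>\<^bsub>M\<^esub> l \<otimes>\<^bsub>M\<^esub> inv\<^bsub>M\<^esub> l)"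
    using assms L_carrier L_inv by (intro gate_L_le) auto
  then show "gate (y \<otimes>\<^bsub>M\<^esub> l) \<subseteq> gate y" using assms L_carrier by (simp add: M.m_assoc)
qed (rule gate_L_le[OF assms])

lemma times_base_notin:
  assumes "y \<in> carrier M" "g \<in> carrier G" "y \<otimes>\<^bsub>M\<^esub> \<iota> g \<in> \<iota> ` carrier G"
  shows "y \<in> \<iota> ` carrier G"
proof -
  obtain h where h: "h \<in> carrier G" "y \<otimes>\<^bsub>M\<^esub> \<iota> g = \<iota> h" using assms(3) by blast
  then have "y = \<iota> (h \<otimes> inv g)"
    using assms M.inv_solve_right[of y "\<iota> h" "\<iota> g"] by simp
  then show ?thesis using h assms(2) by blast
qed

lemma gate_base_le:
  assumes y: "y \<in> carrier M" "y \<notin> \<iota> ` carrier G" and g: "g \<in> carrier G"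
  shows "gate y \<subseteq> gate (y \<otimes>\<^bsub>M\<^esub> \<iota> g)"
proof
  fix h assume h: "h \<in> gate y"
  have "inv\<^bsub>M\<^esub> (\<iota> h) \<otimes>\<^bsub>M\<^esub> y \<notin> \<iota> ` carrier G"
  proof
    assume "inv\<^bsub>M\<^esub> (\<iota> h) \<otimes>\<^bsub>M\<^esub> y \<in> \<iota> ` carrier G"
    then obtain k where k: "k \<in> carrier G" "inv\<^bsub>M\<^esub> (\<iota> h) \<otimes>\<^bsub>M\<^esub> y = \<iota> k" by blast
    then have "y = \<iota> (h \<otimes> k)" using y gate_carrier[OF h] M.inv_solve_left'[of "\<iota> k" "\<iota> h" y] by simp
    then show False using y(2) k gate_carrier[OF h] by blast
  qed
  then show "h \<in> gate (y \<otimes>\<^bsub>M\<^esub> \<iota> g)"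
    using h y g P_base[of "inv\<^bsub>M\<^esub> (\<iota> h) \<otimes>\<^bsub>M\<^esub> y" g] by (simp add: gate_def M.m_assoc)
qed

text \<open>In the tree, yL and y g L are both adjacent to the vertex yG. As this is not the vertex
  G, the paths from G to both start with the same edge.\<close>

lemma gate_times_base:
  assumes y: "y \<in> carrier M" "y \<notin> \<iota> ` carrier G" and g: "g \<in> carrier G"
  shows "gate (y \<otimes>\<^bsub>M\<^esub> \<iota> g) = gate y"
proof
  have "y \<otimes>\<^bsub>M\<^esub> \<iota> g \<notin> \<iota> ` carrier G" using times_base_notin assms by blast
  then have "gate (y \<otimes>\<^bsub>M\<^esub> \<iota> g) \<subseteq> gate (y \<otimes>\<^bsub>M\<^esub> \<iota> g \<otimes>\<^bsub>M\<^esub> \<iota> (inv g))"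
    using assms by (intro gate_base_le) auto
  then show "gate (y \<otimes>\<^bsub>M\<^esub> \<iota> g) \<subseteq> gate y" using assms by (simp add: M.m_assoc)
qed (rule gate_base_le[OF assms])

lemma gate_base: "g \<in> carrier G \<Longrightarrow> g \<in> gate (\<iota> g)"
  using one_P by (simp add: gate_def)

lemma gate_one: "\<one> \<in> gate \<one>\<^bsub>M\<^esub>"
  using gate_base[of \<one>] by simp

end

section \<open>Comparison of the Cayley graphs of G and M\<close>

locale amalgam_graph = amalgam G M \<iota> K L N
  for G :: "('a, 'b) monoid_scheme" (structure) and M :: "('m, 'c) monoid_scheme"
    and \<iota> :: "'a \<Rightarrow> 'm" and K :: "'a set" and L N :: "'m set" +
  fixes \<H> :: "'a set set" and X :: "'a set"
  assumes \<H>: "\<And>H. H \<in> \<H> \<Longrightarrow> subgroup H G" and K_notin: "K \<notin> \<H>" and X: "X \<subseteq> carrier G"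
begin

abbreviation \<H>\<^sub>M :: "'m set set" where "\<H>\<^sub>M \<equiv> insert L ((\<lambda>H. \<iota> ` H) ` \<H>)"

sublocale base: cayley G X "insert K \<H>"
  using X \<H> K by (intro cayley.intro cayley_axioms.intro is_group) auto

sublocale big: cayley M "\<iota> ` X" \<H>\<^sub>M
  using X \<H> L
  by (intro cayley.intro cayley_axioms.intro M.is_group) (auto intro: \<iota>.subgroup_img_is_subgroup)

abbreviation "label H \<equiv> (if H = K then L else \<iota> ` H)"

text \<open>An edge either stays in a coset of \<iota>(G), where it is a translated copy of an edge
  for G, or is labelled by an element of L - K. Edges labelled by \<iota>(k) in the copy of L count
  as edges of K. The tags are recorded because relative distances depend on them.\<close>

lemma edge_cases:
  assumes "(y, a, z) \<in> big.E"
  obtains (base) g b where "g \<in> carrier G" "z = y \<otimes>\<^bsub>M\<^esub> \<iota> g"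
      "\<And>u. u \<in> carrier G \<Longrightarrow> (u, b, u \<otimes> g) \<in> base.E"
      "\<And>H h. b = Par H h \<Longrightarrow> H \<in> insert K \<H> \<and> a = Par (label H) (\<iota> h)"
  | (L) l where "l \<in> L" "l \<notin> \<iota> ` carrier G" "z = y \<otimes>\<^bsub>M\<^esub> l" "a = Par L l"
proof -
  have z: "z = y \<otimes>\<^bsub>M\<^esub> letter_val M a" and y: "y \<in> carrier M"
    using assms by (simp_all add: M.cayley_edge_iff)
  consider x where "x \<in> X" "a = Gen (\<iota> x)"
    | H h where "H \<in> \<H>" "h \<in> H" "\<iota> h \<noteq> \<one>\<^bsub>M\<^esub>" "a = Par (\<iota> ` H) (\<iota> h)"
    | l where "l \<in> L" "l \<noteq> \<one>\<^bsub>M\<^esub>" "a = Par L l"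
    using assms by (auto simp: M.cayley_edge_iff)
  then show thesis
  proof cases
    case 1
    then have "x \<in> carrier G" using X by blast
    then show ?thesis using 1 z by (intro base[of x "Gen x"]) (auto simp: cayley_edge_iff)
  next
    case 2
    have h: "h \<in> carrier G" using subgroup.mem_carrier[OF \<H>] 2 by blast
    then have "h \<noteq> \<one>" using 2 by auto
    then show ?thesis using 2 z h K_notin by (intro base[of h "Par H h"]) (auto simp: cayley_edge_iff)
  next
    case 3
    show ?thesis
    proof (cases "l \<in> \<iota> ` carrier G")
      case True
      then obtain k where k: "k \<in> K" "l = \<iota> k" using 3 L_base_iff by blast
      then have "k \<noteq> \<one>" using 3 by auto
      then show ?thesis using 3 k z K_carrier by (intro base[of k "Par K k"]) (auto simp: cayley_edge_iff)
    next
      case False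
      then show ?thesis using 3 z by (intro L[of l]) auto
    qed
  qed
qed

lemma edge_lift:
  assumes "(u, v) \<in> adj base.E" shows "(\<iota> u, \<iota> v) \<in> adj big.E"
proof -
  have "\<exists>b. (\<iota> x, b, \<iota> y) \<in> big.E" if e: "(x, a, y) \<in> base.E" for x a y
  proof -
    have x: "x \<in> carrier G" "y = x \<otimes> letter_val G a" using e by (auto simp: cayley_edge_iff)
    consider g where "g \<in> X" "a = Gen g"
      | H h where "H \<in> insert K \<H>" "h \<in> H" "h \<noteq> \<one>" "a = Par H h"
      using e by (auto simp: cayley_edge_iff)
    then show ?thesis
    proof cases
      case 1
      then have "g \<in> carrier G" using X by blast
      then show ?thesis using 1 x by (intro exI[of _ "Gen (\<iota> g)"]) (auto simp: M.cayley_edge_iff)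
    next
      case 2
      have h: "h \<in> carrier G" using subgroup.mem_carrier[OF base.\<H>] 2 by blast
      then have "\<iota> h \<noteq> \<one>\<^bsub>M\<^esub>" using 2 \<iota>_eq_iff[of h \<one>] by simp
      moreover have "label H \<in> \<H>\<^sub>M" "\<iota> h \<in> label H" using 2 K_L by auto
      ultimately show ?thesis
        using x 2 h by (intro exI[of _ "Par (label H) (\<iota> h)"]) (simp add: M.cayley_edge_iff)
    qed
  qed
  then show ?thesis using assms unfolding adj_def by blast
qed

lemma dist_lift: "graph_dist base.E u v \<le> enat n \<Longrightarrow> graph_dist big.E (\<iota> u) (\<iota> v) \<le> enat n"
  by (rule graph_dist_map[OF graph_dist_adj[OF edge_lift]])

text \<open>An edge of the first kind moves within a coset of \<iota>(G) other than \<iota>(G)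
  itself, and an edge of the second kind within a coset of L; neither changes the gate.\<close>

lemma edge_gate:
  assumes "(y, a, z) \<in> big.E" "y \<notin> \<iota> ` carrier G \<or> z \<notin> \<iota> ` carrier G"
  shows "gate z = gate y"
  using assms(1)
proof (cases rule: edge_cases)
  case (base g b)
  have y: "y \<in> carrier M" using big.edge_carrier[OF assms(1)] by blast
  have "y \<notin> \<iota> ` carrier G"
  proof
    assume "y \<in> \<iota> ` carrier G"
    then obtain h where "h \<in> carrier G" "y = \<iota> h" by blast
    then have "z = \<iota> (h \<otimes> g)" "h \<otimes> g \<in> carrier G" using base by auto
    then show False using assms(2) \<open>y \<in> \<iota> ` carrier G\<close> by blast
  qed
  then show ?thesis using gate_times_base[OF y] base by simp
next
  case (L l)
  then show ?thesis using gate_L big.edge_carrier[OF assms(1)] by simp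
qed

lemma adj_gate:
  assumes "(y, z) \<in> adj big.E" "y \<notin> \<iota> ` carrier G \<or> z \<notin> \<iota> ` carrier G"
  shows "gate z = gate y"
  using assms edge_gate unfolding adj_def by blast

lemma base_edge:
  assumes "(\<iota> g, a, \<iota> h) \<in> big.E" "g \<in> carrier G" "h \<in> carrier G"
  shows "\<exists>b. (g, b, h) \<in> base.E \<and> (\<forall>H k. b = Par H k \<longrightarrow> H \<in> insert K \<H> \<and> a = Par (label H) (\<iota> k))"
  using assms(1)
proof (cases rule: edge_cases)
  case (base x b)
  then have "\<iota> h = \<iota> (g \<otimes> x)" using assms by simp
  then have "h = g \<otimes> x" using assms(2,3) base(1) \<iota>_eq_iff by blast
  then show ?thesis using base(3)[OF assms(2)] base(4) by blast
next
  case (L l)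
  then have "l = \<iota> (inv g \<otimes> h)"
    using assms(2,3) L_carrier[of l] by (simp add: M.inv_solve_left)
  then show ?thesis using L(2) assms(2,3) by blast
qed

text \<open>
  Replacing each excursion outside \<open>G\<close>, which leaves and enters \<open>G\<close> through the same coset of \<open>K\<close>,
  by an edge of that coset does not lengthen a path. The edges available for this are those of \<open>E0\<close>,
  and \<open>Q\<close> records through which cosets the path can leave.
\<close>

lemma projection:
  assumes E1: "E1 \<subseteq> big.E"
    and stay: "\<And>g h. g \<in> carrier G \<Longrightarrow> h \<in> carrier G \<Longrightarrow> (\<iota> g, \<iota> h) \<in> adj E1 \<Longrightarrow> (g, h) \<in> adj E0"
    and leave: "\<And>g y h. g \<in> carrier G \<Longrightarrow> y \<notin> \<iota> ` carrier G \<Longrightarrow> (\<iota> g, y) \<in> adj E1 \<Longrightarrow>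
      Q (gate y) \<and> (h \<in> gate y \<longrightarrow> g = h \<or> (g, h) \<in> adj E0)"
    and a: "a \<in> carrier G"
    and path: "(\<iota> a, y) \<in> adj E1 ^^ n"
  shows "y \<in> carrier M \<and> (\<forall>b\<in>carrier G. y = \<iota> b \<longrightarrow> graph_dist E0 a b \<le> enat n) \<and>
    (y \<notin> \<iota> ` carrier G \<longrightarrow> Q (gate y) \<and> (\<forall>b\<in>gate y. graph_dist E0 a b \<le> enat n))"
  using path
proof (induction n arbitrary: y)
  case 0
  then show ?case using a \<iota>_eq_iff graph_dist_refl[of E0 a 0] by auto
next
  case (Suc n)
  then obtain x where x: "(\<iota> a, x) \<in> adj E1 ^^ n" "(x, y) \<in> adj E1" by auto
  have adj: "(x, y) \<in> adj big.E" using x(2) E1 unfolding adj_def by blast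
  have step: "graph_dist E0 a h \<le> enat (Suc n)" if "graph_dist E0 a g \<le> enat n" "g = h \<or> (g, h) \<in> adj E0" for g h
  proof (cases "g = h")
    case True
    then show ?thesis using graph_dist_mono[OF that(1), of "Suc n"] by simp
  next
    case False
    then have "graph_dist E0 g h \<le> enat 1" using that(2) by (intro graph_dist_adj) simp
    from graph_dist_trans[OF that(1) this] show ?thesis by simp
  qed
  have y: "y \<in> carrier M" using adj big.adj_carrier by blast
  show ?case
  proof (cases "x \<in> \<iota> ` carrier G")
    case True
    then obtain g where g: "g \<in> carrier G" "x = \<iota> g" by blast
    have d: "graph_dist E0 a g \<le> enat n" using Suc.IH[OF x(1)] g by blast
    have "graph_dist E0 a b \<le> enat (Suc n)" if "b \<in> carrier G" "y = \<iota> b" for b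
      using step[OF d] stay[OF g(1)] x(2) g(2) that by blast
    \<comment> \<open>The edge by which the path leaves pays for one edge of \<open>E0\<close> from
      g to any point of the gate.\<close>
    moreover have "Q (gate y) \<and> (\<forall>b\<in>gate y. graph_dist E0 a b \<le> enat (Suc n))" if "y \<notin> \<iota> ` carrier G"
      using step[OF d] leave[OF g(1) that] x(2) g(2) by blast
    ultimately show ?thesis using y by blast
  next
    case False
    have gates: "gate y = gate x" using adj_gate[OF adj] False by blast
    have IH: "Q (gate y)" "\<And>b. b \<in> gate y \<Longrightarrow> graph_dist E0 a b \<le> enat (Suc n)"
      using Suc.IH[OF x(1)] False gates step by auto
    \<comment> \<open>A path re-enters \<iota>(G) at a point of the gate. The distance to that point
      is already bounded, because the induction covers the whole gate.\<close>
    have "b \<in> gate y" if "b \<in> carrier G" "y = \<iota> b" for b using that gate_base by simp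
    then show ?thesis using y IH by blast
  qed
qed

section \<open>Distances and relative distances in G and M\<close>

lemma K_edge:
  assumes "g \<in> carrier G" "y \<in> carrier M" "g \<in> gate y" "h \<in> gate y"
  shows "g = h \<or> (g, Par K (inv g \<otimes> h), h) \<in> base.E"
proof -
  have k: "inv g \<otimes> h \<in> K" "h \<in> carrier G" using gate_diff[OF assms(2-4)] gate_carrier[OF assms(4)] by auto
  have "inv g \<otimes> h \<noteq> \<one>" if "g \<noteq> h"
    using that assms(1) k(2) by (metis inv_solve_left' one_closed r_one)
  moreover have "g \<otimes> (inv g \<otimes> h) = h" using assms(1) k(2) by (simp add: m_assoc[symmetric])
  ultimately show ?thesis using assms(1) k(1) by (auto simp: cayley_edge_iff)
qed

lemma adj_base_gate:
  assumes "g \<in> carrier G" "y \<notin> \<iota> ` carrier G" "(\<iota> g, y) \<in> adj big.E"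
  shows "y \<in> carrier M" "g \<in> gate y"
  using assms adj_gate[OF assms(3)] gate_base[OF assms(1)] big.adj_carrier by auto

lemma dist_project:
  assumes "a \<in> carrier G" "b \<in> carrier G" "graph_dist big.E (\<iota> a) (\<iota> b) \<le> enat n"
  shows "graph_dist base.E a b \<le> enat n"
proof -
  obtain m where m: "m \<le> n" "(\<iota> a, \<iota> b) \<in> adj big.E ^^ m" using assms(3) by (auto simp: graph_dist_le_iff)
  have stay: "(g, h) \<in> adj base.E" if "g \<in> carrier G" "h \<in> carrier G" "(\<iota> g, \<iota> h) \<in> adj big.E" for g h
    using that(3) base_edge[OF _ that(1,2)] base_edge[OF _ that(2,1)] unfolding adj_def by blast
  have leave: "True \<and> (h \<in> gate y \<longrightarrow> g = h \<or> (g, h) \<in> adj base.E)"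
    if g: "g \<in> carrier G" "y \<notin> \<iota> ` carrier G" "(\<iota> g, y) \<in> adj big.E" for g h y
    using K_edge[OF g(1) adj_base_gate[OF g]] unfolding adj_def by blast
  have "graph_dist base.E a b \<le> enat m"
    using projection[where Q = "\<lambda>_. True", OF order_refl stay leave assms(1) m(2)] assms(2) by blast
  then show ?thesis by (rule graph_dist_mono[OF _ m(1)])
qed

lemma dist_\<iota>:
  assumes "a \<in> carrier G" "b \<in> carrier G"
  shows "graph_dist big.E (\<iota> a) (\<iota> b) = graph_dist base.E a b"
proof (rule antisym)
  show "graph_dist big.E (\<iota> a) (\<iota> b) \<le> graph_dist base.E a b"
    using dist_lift by (cases "graph_dist base.E a b") auto
  show "graph_dist base.E a b \<le> graph_dist big.E (\<iota> a) (\<iota> b)"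
    using dist_project[OF assms] by (cases "graph_dist big.E (\<iota> a) (\<iota> b)") auto
qed

text \<open>The shortcuts carry the tag K \<noteq> H, so the relative metric of H allows them. Edges
  inside \<iota>(G) keep their tags, so admissible ones come from admissible ones.\<close>

lemma rel_dist_project:
  assumes H: "H \<in> \<H>" and ab: "a \<in> carrier G" "b \<in> carrier G"
    and d: "rel_dist M (\<iota> ` X) \<H>\<^sub>M (\<iota> ` H) (\<iota> a) (\<iota> b) \<le> enat n"
  shows "rel_dist G X (insert K \<H>) H a b \<le> enat n"
proof -
  define E1 where "E1 = big.E - {(u, Par (\<iota> ` H) k, v) | u k v. u \<in> \<iota> ` H \<and> v \<in> \<iota> ` H}"
  define E0 where "E0 = base.E - {(u, Par H k, v) | u k v. u \<in> H \<and> v \<in> H}"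
  have E1: "E1 \<subseteq> big.E" unfolding E1_def by blast
  obtain m where m: "m \<le> n" "(\<iota> a, \<iota> b) \<in> adj E1 ^^ m"
    using d unfolding rel_dist_def graph_dist_le_iff E1_def by blast
  have HK: "H \<noteq> K" using H K_notin by blast
  have edge: "\<exists>b. (g, b, h) \<in> E0" if e: "(\<iota> g, c, \<iota> h) \<in> E1" "g \<in> carrier G" "h \<in> carrier G" for g c h
  proof -
    have "(\<iota> g, c, \<iota> h) \<in> big.E" using e(1) unfolding E1_def by blast
    from base_edge[OF this e(2,3)] obtain b where b: "(g, b, h) \<in> base.E"
      "\<forall>H k. b = Par H k \<longrightarrow> H \<in> insert K \<H> \<and> c = Par (label H) (\<iota> k)" by (elim exE conjE)
    have "(g, b, h) \<in> E0"
    proof (rule ccontr)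
      assume "(g, b, h) \<notin> E0"
      then obtain k where k: "b = Par H k" "g \<in> H" "h \<in> H" using b(1) unfolding E0_def by blast
      then have "c = Par (\<iota> ` H) (\<iota> k)" using b(2) HK by simp
      then show False using e(1) k(2,3) unfolding E1_def by blast
    qed
    then show ?thesis by blast
  qed
  have stay: "(g, h) \<in> adj E0" if "g \<in> carrier G" "h \<in> carrier G" "(\<iota> g, \<iota> h) \<in> adj E1" for g h
    using that(3)
  proof (rule adjE)
    fix c assume "(\<iota> g, c, \<iota> h) \<in> E1"
    from edge[OF this that(1,2)] show ?thesis by (blast intro: adjI)
  next
    fix c assume "(\<iota> h, c, \<iota> g) \<in> E1"
    from edge[OF this that(2,1)] show ?thesis by (blast intro: adjI adj_sym)
  qed
  have leave: "True \<and> (h \<in> gate y \<longrightarrow> g = h \<or> (g, h) \<in> adj E0)"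
    if "g \<in> carrier G" "y \<notin> \<iota> ` carrier G" "(\<iota> g, y) \<in> adj E1" for g h y
  proof -
    have "(\<iota> g, y) \<in> adj big.E" using that(3) adj_mono[OF E1] by blast
    note y = adj_base_gate[OF that(1,2) this]
    have "(g, Par K (inv g \<otimes> h), h) \<in> base.E \<Longrightarrow> (g, Par K (inv g \<otimes> h), h) \<in> E0"
      using HK unfolding E0_def by blast
    then show ?thesis using K_edge[OF that(1) y, of h] adjI[of g "Par K (inv g \<otimes> h)" h E0] by blast
  qed
  have "graph_dist E0 a b \<le> enat m"
    using projection[where Q = "\<lambda>_. True", OF E1 stay leave ab(1) m(2)] ab(2) by blast
  then show ?thesis unfolding rel_dist_def E0_def by (rule graph_dist_mono[OF _ m(1)])
qed

text \<open>A shortcut inside K itself would be forbidden. But an edge that leaves \<iota>(G) at an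
  element of \<iota>(K) is labelled by L and joins two elements of L, so it is forbidden as well.
  Hence an admissible path leaves only through cosets gK other than K, where shortcuts are allowed.
  In particular the elements of L - K are infinitely far from 1.\<close>

lemma rel_dist_L:
  assumes l: "l \<in> L" and d: "rel_dist M (\<iota> ` X) \<H>\<^sub>M L \<one>\<^bsub>M\<^esub> l \<le> enat n"
  shows "\<exists>k\<in>K. l = \<iota> k \<and> rel_dist G X (insert K \<H>) K \<one> k \<le> enat n"
proof -
  define E1 where "E1 = big.E - {(u, Par L k, v) | u k v. u \<in> L \<and> v \<in> L}"
  define E0 where "E0 = base.E - {(u, Par K k, v) | u k v. u \<in> K \<and> v \<in> K}"
  have E1: "E1 \<subseteq> big.E" unfolding E1_def by blast
  have "\<exists>m\<le>n. (\<one>\<^bsub>M\<^esub>, l) \<in> adj E1 ^^ m"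
    using d unfolding rel_dist_def graph_dist_le_iff E1_def .
  then obtain m where m: "m \<le> n" "(\<iota> \<one>, l) \<in> adj E1 ^^ m" unfolding \<iota>.hom_one by blast
  have edge: "\<exists>b. (g, b, h) \<in> E0" if e: "(\<iota> g, c, \<iota> h) \<in> E1" "g \<in> carrier G" "h \<in> carrier G" for g c h
  proof -
    have "(\<iota> g, c, \<iota> h) \<in> big.E" using e(1) unfolding E1_def by blast
    from base_edge[OF this e(2,3)] obtain b where b: "(g, b, h) \<in> base.E"
      "\<forall>H k. b = Par H k \<longrightarrow> H \<in> insert K \<H> \<and> c = Par (label H) (\<iota> k)" by (elim exE conjE)
    have "(g, b, h) \<in> E0"
    proof (rule ccontr)
      assume "(g, b, h) \<notin> E0"
      then obtain k where k: "b = Par K k" "g \<in> K" "h \<in> K" using b(1) unfolding E0_def by blast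
      then have "c = Par L (\<iota> k)" using b(2) by simp
      then show False using e(1) k(2,3) K_L unfolding E1_def by blast
    qed
    then show ?thesis by blast
  qed
  have stay: "(g, h) \<in> adj E0" if "g \<in> carrier G" "h \<in> carrier G" "(\<iota> g, \<iota> h) \<in> adj E1" for g h
    using that(3)
  proof (rule adjE)
    fix c assume "(\<iota> g, c, \<iota> h) \<in> E1"
    from edge[OF this that(1,2)] show ?thesis by (blast intro: adjI)
  next
    fix c assume "(\<iota> h, c, \<iota> g) \<in> E1"
    from edge[OF this that(2,1)] show ?thesis by (blast intro: adjI adj_sym)
  qed
  have notin: "g \<notin> K"
    if g: "g \<in> carrier G" and y: "y \<notin> \<iota> ` carrier G" and e: "(\<iota> g, y) \<in> adj E1" for g y
  proof
    assume gK: "g \<in> K"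
    then have gL: "\<iota> g \<in> L" using K_L by blast
    from e show False
    proof (rule adjE)
      fix c assume e: "(\<iota> g, c, y) \<in> E1"
      then have "(\<iota> g, c, y) \<in> big.E" using E1 by blast
      then show False
      proof (cases rule: edge_cases)
        case (base x b)
        then show False using y g by (auto simp flip: \<iota>.hom_mult)
      next
        case (L x)
        then show False using e gL L_mult[OF gL L(1)] unfolding E1_def by blast
      qed
    next
      fix c assume e: "(y, c, \<iota> g) \<in> E1"
      then have b: "(y, c, \<iota> g) \<in> big.E" using E1 by blast
      note yc = big.edge_carrier(1)[OF b]
      from b show False
      proof (cases rule: edge_cases)
        case (base x b)
        then have "y \<otimes>\<^bsub>M\<^esub> \<iota> x \<in> \<iota> ` carrier G" using g by (metis imageI)
        then show False using y times_base_notin[OF yc base(1)] by blast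
      next
        case (L x)
        then have "y = \<iota> g \<otimes>\<^bsub>M\<^esub> inv\<^bsub>M\<^esub> x"
          using yc L_carrier[of x] by (simp add: M.m_assoc)
        then have "y \<in> L" using gL L(1) L_mult L_inv by simp
        then show False using e gL L(4) unfolding E1_def by blast
      qed
    qed
  qed
  have leave: "\<one> \<notin> gate y \<and> (h \<in> gate y \<longrightarrow> g = h \<or> (g, h) \<in> adj E0)"
    if g: "g \<in> carrier G" "y \<notin> \<iota> ` carrier G" "(\<iota> g, y) \<in> adj E1" for g h y
  proof -
    have "(\<iota> g, y) \<in> adj big.E" using g(3) adj_mono[OF E1] by blast
    note y = adj_base_gate[OF g(1,2) this]
    have gK: "g \<notin> K" by (rule notin[OF g])
    have "\<one> \<notin> gate y" using gate_diff[OF y(1) _ y(2), of \<one>] gK g(1) by auto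
    moreover have "g = h \<or> (g, h) \<in> adj E0" if "h \<in> gate y"
    proof -
      have "(g, Par K (inv g \<otimes> h), h) \<in> base.E \<Longrightarrow> (g, Par K (inv g \<otimes> h), h) \<in> E0"
        using gK unfolding E0_def by blast
      then show ?thesis using K_edge[OF g(1) y that] adjI[of g "Par K (inv g \<otimes> h)" h E0] by blast
    qed
    ultimately show ?thesis by blast
  qed
  have *: "(\<forall>b\<in>carrier G. l = \<iota> b \<longrightarrow> graph_dist E0 \<one> b \<le> enat m) \<and>
      (l \<notin> \<iota> ` carrier G \<longrightarrow> \<one> \<notin> gate l)"
    using projection[where Q = "\<lambda>A. \<one> \<notin> A", OF E1 stay leave one_closed m(2)] by blast
  \<comment> \<open>Both l and 1 lie in L, so they have the same gate. The property \<open>Q\<close>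
    recorded along the path therefore rules out that l lies outside \<iota>(G).\<close>
  have "\<one> \<in> gate l" using gate_L[of "\<one>\<^bsub>M\<^esub>" l] gate_one l L_carrier by simp
  then obtain b where b: "b \<in> K" "l = \<iota> b" using * L_base_iff[OF l] by blast
  then have "graph_dist E0 \<one> b \<le> enat m" using * K_carrier by blast
  then have "rel_dist G X (insert K \<H>) K \<one> b \<le> enat n"
    unfolding rel_dist_def E0_def by (rule graph_dist_mono[OF _ m(1)])
  then show ?thesis using b by blast
qed

section \<open>Geodesics of M and their traces in the copy of G\<close>

lemma gate_const:
  assumes \<gamma>: "geodesic (carrier M) big.E x y n \<gamma>" and ij: "i \<le> j" "j \<le> n"
    and out: "\<And>k. i < k \<Longrightarrow> k < j \<Longrightarrow> \<gamma> k \<notin> \<iota> ` carrier G"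
    and nonadj: "j \<noteq> Suc i \<or> \<gamma> i \<notin> \<iota> ` carrier G \<or> \<gamma> j \<notin> \<iota> ` carrier G"
  shows "gate (\<gamma> i) = gate (\<gamma> j)"
proof -
  have step: "gate (\<gamma> (Suc k)) = gate (\<gamma> k)" if k: "i \<le> k" "k < j" for k
  proof (rule adj_gate)
    show "(\<gamma> k, \<gamma> (Suc k)) \<in> adj big.E" using geodesic_adj[OF \<gamma>] k ij by simp
    show "\<gamma> k \<notin> \<iota> ` carrier G \<or> \<gamma> (Suc k) \<notin> \<iota> ` carrier G"
    proof (cases "k = i")
      case True
      \<comment> \<open>The condition \<open>nonadj\<close> excludes a single edge inside
        \<iota>(G), the only kind of edge that can change the gate.\<close>
      show ?thesis unfolding True using nonadj out[of "Suc i"] k True by (cases "j = Suc i") auto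
    next
      case False
      then show ?thesis using out[of k] k by simp
    qed
  qed
  have "gate (\<gamma> (i + d)) = gate (\<gamma> i)" if "i + d \<le> j" for d
    using that step by (induction d) auto
  from this[of "j - i"] show ?thesis using ij by simp
qed

lemma gate_close:
  assumes "y \<in> carrier M" "g \<in> gate y" "h \<in> gate y"
  shows "graph_dist base.E g h \<le> enat 1"
  using K_edge[OF gate_carrier[OF assms(2)] assms] graph_dist_refl[of base.E g 1] graph_dist_adj[of g h base.E]
  unfolding adj_def by blast

text \<open>The trace on \<iota>(G) is one subpath: an excursion starts and ends in the same gate,
  hence at points of distance at most 1, which is too short for a geodesic. Before and after the
  trace the gate is constant, so the ends of the trace lie in the gates of x and y.\<close>

lemma geodesic_meets_base:
  assumes \<gamma>: "geodesic (carrier M) big.E x y n \<gamma>" and p: "p \<le> n" "\<gamma> p \<in> \<iota> ` carrier G"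
  obtains i j \<sigma> where "i \<le> p" "p \<le> j" "j \<le> n"
    "geodesic (carrier G) base.E (\<sigma> 0) (\<sigma> (j - i)) (j - i) \<sigma>"
    "\<And>k. k \<le> j - i \<Longrightarrow> \<gamma> (i + k) = \<iota> (\<sigma> k)"
    "\<sigma> 0 \<in> gate x" "\<sigma> (j - i) \<in> gate y"
    "\<And>k. k < i \<Longrightarrow> \<gamma> k \<notin> \<iota> ` carrier G" "\<And>k. j < k \<Longrightarrow> k \<le> n \<Longrightarrow> \<gamma> k \<notin> \<iota> ` carrier G"
proof -
  define I where "I = {k. k \<le> n \<and> \<gamma> k \<in> \<iota> ` carrier G}"
  have fin: "finite I" "p \<in> I" "I \<noteq> {}" using p unfolding I_def by auto
  define i where "i = Min I"
  define j where "j = Max I"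
  have i: "i \<in> I" "i \<le> p" unfolding i_def using Min_in[OF fin(1,3)] Min_le[OF fin(1,2)] by auto
  have j: "j \<in> I" "p \<le> j" unfolding j_def using Max_in[OF fin(1,3)] Max_ge[OF fin(1,2)] by auto
  have below: "\<gamma> k \<notin> \<iota> ` carrier G" if "k < i" for k
    using that Min_le[OF fin(1), of k] i(1) unfolding i_def I_def by fastforce
  have above: "\<gamma> k \<notin> \<iota> ` carrier G" if "j < k" "k \<le> n" for k
    using that Max_ge[OF fin(1), of k] unfolding j_def I_def by fastforce
  have between: "\<gamma> k \<in> \<iota> ` carrier G" if k: "i \<le> k" "k \<le> j" for k
  proof (rule ccontr)
    assume nk: "\<gamma> k \<notin> \<iota> ` carrier G"
    have jn: "j \<le> n" using j unfolding I_def by simp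
    \<comment> \<open>The last visit a before k and the first visit b after k bound the excursion
      around k, so b - a is at least 2.\<close>
    define A where "A = {m\<in>I. m < k}"
    define B where "B = {m\<in>I. k < m}"
    have "i \<noteq> k" "j \<noteq> k" using nk i(1) j(1) unfolding I_def by auto
    then have AB: "finite A" "finite B" "i \<in> A" "j \<in> B"
      using fin i j k unfolding A_def B_def by auto
    define a where "a = Max A"
    define b where "b = Min B"
    have a: "a \<in> A" unfolding a_def using AB Max_in by blast
    have b: "b \<in> B" unfolding b_def using AB Min_in by blast
    have out: "\<gamma> m \<notin> \<iota> ` carrier G" if m: "a < m" "m < b" for m
    proof
      assume "\<gamma> m \<in> \<iota> ` carrier G"
      moreover have "m \<le> n" using m b unfolding B_def I_def by simp
      ultimately have "m \<in> I" unfolding I_def by simp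
      then have "m \<in> A \<or> m \<in> B \<or> m = k" unfolding A_def B_def by auto
      then show False
        using m Max_ge[OF AB(1), of m] Min_le[OF AB(2), of m] nk \<open>m \<in> I\<close>
        unfolding a_def b_def I_def by auto
    qed
    have ab: "a < k" "k < b" "b \<le> n" using a b unfolding A_def B_def I_def by auto
    have "gate (\<gamma> a) = gate (\<gamma> b)" using ab out by (intro gate_const[OF \<gamma>]) auto
    moreover obtain g h where gh: "g \<in> carrier G" "\<gamma> a = \<iota> g" "h \<in> carrier G" "\<gamma> b = \<iota> h"
      using a b unfolding A_def B_def I_def by blast
    ultimately have "graph_dist base.E g h \<le> enat 1"
      using gate_base[of g] gate_base[of h] by (intro gate_close[of "\<iota> g"]) auto
    then have "graph_dist big.E (\<gamma> a) (\<gamma> b) \<le> enat 1" using dist_lift gh by simp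
    then have "b - a \<le> 1" using geodesic_length_le[OF \<gamma>, of a b] ab by simp
    then show False using ab by simp
  qed
  define \<sigma> where "\<sigma> k = inv_into (carrier G) \<iota> (\<gamma> (i + k))" for k
  have jn: "j \<le> n" using j unfolding I_def by simp
  have \<sigma>: "\<sigma> k \<in> carrier G \<and> \<iota> (\<sigma> k) = \<gamma> (i + k)" if "k \<le> j - i" for k
    using between[of "i + k"] that i j unfolding \<sigma>_def by (auto simp: inv_into_into f_inv_into_f)
  have "graph_dist base.E (\<sigma> k) (\<sigma> m) = enat (m - k)" if "k \<le> m" "m \<le> j - i" for k m
  proof -
    have "graph_dist base.E (\<sigma> k) (\<sigma> m) = graph_dist big.E (\<gamma> (i + k)) (\<gamma> (i + m))"
      using dist_\<iota>[of "\<sigma> k" "\<sigma> m"] \<sigma>[of k] \<sigma>[of m] that by simp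
    then show ?thesis using geodesic_dist[OF \<gamma>, of "i + k" "i + m"] that jn i(2) j(2) by simp
  qed
  then have geo: "geodesic (carrier G) base.E (\<sigma> 0) (\<sigma> (j - i)) (j - i) \<sigma>"
    using \<sigma> unfolding geodesic_def by auto
  have "gate (\<gamma> 0) = gate (\<gamma> i)"
  proof (cases "i = 0")
    case False
    then show ?thesis using below i j jn by (intro gate_const[OF \<gamma>]) auto
  qed simp
  then have gx: "\<sigma> 0 \<in> gate x"
    using \<sigma>[of 0] gate_base[of "\<sigma> 0"] geodesic_ends[OF \<gamma>] by simp
  have "gate (\<gamma> j) = gate (\<gamma> n)"
  proof (cases "j = n")
    case False
    then show ?thesis using above[of n] above j jn by (intro gate_const[OF \<gamma>]) auto
  qed simp
  then have gy: "\<sigma> (j - i) \<in> gate y"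
    using \<sigma>[of "j - i"] gate_base[of "\<sigma> (j - i)"] geodesic_ends[OF \<gamma>] i j by simp
  show thesis using that[OF i(2) j(2) jn geo _ gx gy below above] \<sigma> by simp
qed

lemma geodesic_misses_base:
  assumes \<gamma>: "geodesic (carrier M) big.E x y n \<gamma>" and out: "\<And>k. k \<le> n \<Longrightarrow> \<gamma> k \<notin> \<iota> ` carrier G"
  shows "gate x = gate y"
  using gate_const[OF \<gamma>, of 0 n] out geodesic_ends[OF \<gamma>] by auto

text \<open>If the geodesic visited \<iota>(G), the last vertex before the visit and the first one
  after it would lie in the same coset of L. This coset is a clique, while the geodesic takes at
  least two steps between them.\<close>

lemma geodesic_same_gate:
  assumes \<gamma>: "geodesic (carrier M) big.E x y n \<gamma>" and out: "x \<notin> \<iota> ` carrier G" "y \<notin> \<iota> ` carrier G"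
    and same: "gate x = gate y" and p: "p \<le> n"
  shows "\<gamma> p \<notin> \<iota> ` carrier G"
proof
  assume "\<gamma> p \<in> \<iota> ` carrier G"
  from geodesic_meets_base[OF \<gamma> p this] obtain i j \<sigma> where
    ij: "i \<le> p" "p \<le> j" "j \<le> n" and \<sigma>: "geodesic (carrier G) base.E (\<sigma> 0) (\<sigma> (j - i)) (j - i) \<sigma>"
    and \<iota>\<sigma>: "\<And>k. k \<le> j - i \<Longrightarrow> \<gamma> (i + k) = \<iota> (\<sigma> k)"
    and gates: "\<sigma> 0 \<in> gate x" "\<sigma> (j - i) \<in> gate y"
    and below: "\<And>k. k < i \<Longrightarrow> \<gamma> k \<notin> \<iota> ` carrier G" and above: "\<And>k. j < k \<Longrightarrow> k \<le> n \<Longrightarrow> \<gamma> k \<notin> \<iota> ` carrier G"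
    by metis
  have \<sigma>c: "\<sigma> 0 \<in> carrier G" "\<sigma> (j - i) \<in> carrier G" using gates gate_carrier by auto
  have ends: "\<gamma> i = \<iota> (\<sigma> 0)" "\<gamma> j = \<iota> (\<sigma> (j - i))" using \<iota>\<sigma>[of 0] \<iota>\<sigma>[of "j - i"] ij by auto
  have "i \<noteq> 0" using ends \<sigma>c out(1) geodesic_ends(1)[OF \<gamma>] by auto
  then obtain i' where i': "i = Suc i'" by (cases i) auto
  have "j \<noteq> n" using ends \<sigma>c out(2) geodesic_ends(2)[OF \<gamma>] by auto
  then have jn: "Suc j \<le> n" using ij by simp
  \<comment> \<open>Edges of the first kind in \<open>edge_cases\<close> do not leave \<iota>(G), so
    the neighbour v is reached through L.\<close>
  have LE: "\<exists>l\<in>L. v = \<iota> g \<otimes>\<^bsub>M\<^esub> l" if e: "(\<iota> g, v) \<in> adj big.E" "v \<notin> \<iota> ` carrier G" "g \<in> carrier G" for g v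
  proof -
    from e obtain c where "(\<iota> g, c, v) \<in> big.E \<or> (v, c, \<iota> g) \<in> big.E" unfolding adj_def by blast
    then show ?thesis
    proof
      assume "(\<iota> g, c, v) \<in> big.E"
      then show ?thesis
      proof (cases rule: edge_cases)
        case (base x b)
        then have "v = \<iota> (g \<otimes> x)" using e(3) by simp
        then show ?thesis using e base(1) by blast
      qed blast
    next
      assume e': "(v, c, \<iota> g) \<in> big.E"
      note vc = big.edge_carrier(1)[OF e']
      from e' show ?thesis
      proof (cases rule: edge_cases)
        case (base x b)
        then have "v \<otimes>\<^bsub>M\<^esub> \<iota> x \<in> \<iota> ` carrier G" using e(3) by (metis imageI)
        then show ?thesis using e(2) times_base_notin[OF vc base(1)] by blast
      next
        case (L x)
        then have "v = \<iota> g \<otimes>\<^bsub>M\<^esub> inv\<^bsub>M\<^esub> x" using vc L_carrier[of x] by (simp add: M.m_assoc)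
        then show ?thesis using L(1) L_inv by blast
      qed
    qed
  qed
  have "(\<gamma> i', \<gamma> i) \<in> adj big.E" "(\<gamma> j, \<gamma> (Suc j)) \<in> adj big.E"
    using geodesic_adj[OF \<gamma>] i' ij jn by auto
  moreover have "\<gamma> i' \<notin> \<iota> ` carrier G" "\<gamma> (Suc j) \<notin> \<iota> ` carrier G" using below above i' jn by auto
  ultimately obtain l1 l2 where l: "l1 \<in> L" "\<gamma> i' = \<iota> (\<sigma> 0) \<otimes>\<^bsub>M\<^esub> l1" "l2 \<in> L" "\<gamma> (Suc j) = \<iota> (\<sigma> (j - i)) \<otimes>\<^bsub>M\<^esub> l2"
    using LE[OF adj_sym] LE ends \<sigma>c by metis
  have xc: "x \<in> carrier M" using geodesic_mem[OF \<gamma>, of 0] geodesic_ends[OF \<gamma>] by simp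
  have k: "inv (\<sigma> 0) \<otimes> \<sigma> (j - i) \<in> K" using gate_diff[OF xc] gates same by simp
  let ?l = "inv\<^bsub>M\<^esub> l1 \<otimes>\<^bsub>M\<^esub> \<iota> (inv (\<sigma> 0) \<otimes> \<sigma> (j - i)) \<otimes>\<^bsub>M\<^esub> l2"
  have lL: "?l \<in> L" using l k K_L by (auto intro!: L_mult L_inv simp del: \<iota>.hom_mult)
  note lc = L_carrier[OF l(1)] L_carrier[OF l(3)]
  have "l1 \<otimes>\<^bsub>M\<^esub> ?l = \<iota> (inv (\<sigma> 0) \<otimes> \<sigma> (j - i)) \<otimes>\<^bsub>M\<^esub> l2"
    using lc \<sigma>c by (simp add: M.m_assoc[symmetric] del: \<iota>.hom_mult)
  then have "\<gamma> i' \<otimes>\<^bsub>M\<^esub> ?l = \<iota> (\<sigma> 0 \<otimes> (inv (\<sigma> 0) \<otimes> \<sigma> (j - i))) \<otimes>\<^bsub>M\<^esub> l2"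
    using l(2) lc \<sigma>c by (simp add: M.m_assoc)
  also have "\<sigma> 0 \<otimes> (inv (\<sigma> 0) \<otimes> \<sigma> (j - i)) = \<sigma> (j - i)" using \<sigma>c by (simp add: m_assoc[symmetric])
  finally have "\<gamma> (Suc j) = \<gamma> i' \<otimes>\<^bsub>M\<^esub> ?l" using l by simp
  moreover have "\<gamma> i' \<in> carrier M" using geodesic_mem[OF \<gamma>] i' ij by simp
  ultimately have "graph_dist big.E (\<gamma> i') (\<gamma> (Suc j)) \<le> enat 1"
    using big.member_dist[of L ?l "\<gamma> i'"] lL by simp
  then have "Suc j - i' \<le> 1" using geodesic_length_le[OF \<gamma>, of i' "Suc j"] i' ij jn by simp
  then show False using i' ij by simp
qed

text \<open>Traces with a common gate have ends at distance at most 1 there. If both other sides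
  meet \<iota>(G), slimness and fellow-travelling give \<delta> + (2\<delta> + 1). If only one does,
  its trace joins the same gates as that of \<gamma>, and 2\<delta> + 1 suffices. If neither does, x
  and z have the same gate and \<gamma> misses \<iota>(G).\<close>

lemma slim_at_base:
  assumes slim: "slim \<delta> (carrier G) base.E"
    and gen: "generate G (X \<union> \<Union>(insert K \<H>)) = carrier G"
    and \<alpha>: "geodesic (carrier M) big.E x y l \<alpha>" and \<beta>: "geodesic (carrier M) big.E y z m \<beta>"
    and \<gamma>: "geodesic (carrier M) big.E x z n \<gamma>" and k: "k \<le> n" "\<gamma> k \<in> \<iota> ` carrier G"
  shows "\<exists>q\<in>\<alpha> ` {..l} \<union> \<beta> ` {..m}. graph_dist big.E (\<gamma> k) q \<le> enat (3 * \<delta> + 1)"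
proof -
  note conn = base.connected[OF gen]
  note fellow = geodesics_fellow_travel[OF slim base.adj_subset conn]
  have xyz: "x \<in> carrier M" "y \<in> carrier M" "z \<in> carrier M"
    using geodesic_mem[OF \<alpha>, of 0] geodesic_mem[OF \<beta>, of 0] geodesic_mem[OF \<beta>, of m]
      geodesic_ends[OF \<alpha>] geodesic_ends[OF \<beta>] by auto
  from geodesic_meets_base[OF \<gamma> k] obtain i j \<sigma> where
    ij: "i \<le> k" "k \<le> j" and \<sigma>: "geodesic (carrier G) base.E (\<sigma> 0) (\<sigma> (j - i)) (j - i) \<sigma>"
    and \<iota>\<sigma>: "\<And>k. k \<le> j - i \<Longrightarrow> \<gamma> (i + k) = \<iota> (\<sigma> k)"
    and \<sigma>x: "\<sigma> 0 \<in> gate x" and \<sigma>z: "\<sigma> (j - i) \<in> gate z"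
    by metis
  define p where "p = k - i"
  have p: "p \<le> j - i" "\<gamma> k = \<iota> (\<sigma> p)" using ij \<iota>\<sigma>[of p] unfolding p_def by auto
  have near: "\<exists>q\<in>\<alpha> ` {..l} \<union> \<beta> ` {..m}. graph_dist big.E (\<gamma> k) q \<le> enat (3 * \<delta> + 1)"
    if "graph_dist base.E (\<sigma> p) g \<le> enat d" "d \<le> 3 * \<delta> + 1" "\<iota> g \<in> \<alpha> ` {..l} \<union> \<beta> ` {..m}" for g d
    using dist_lift[OF graph_dist_mono[OF that(1,2)]] that(3) p(2) by (intro bexI[of _ "\<iota> g"]) simp
  have refl: "graph_dist base.E g g \<le> enat 1" for g by (rule graph_dist_refl)
  show ?thesis
  proof (cases "\<exists>q\<le>l. \<alpha> q \<in> \<iota> ` carrier G")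
    case A: True
    then obtain q where q: "q \<le> l" "\<alpha> q \<in> \<iota> ` carrier G" by blast
    from geodesic_meets_base[OF \<alpha> q] obtain i1 j1 \<sigma>1 where
      ij1: "i1 \<le> q" "q \<le> j1" "j1 \<le> l"
      and \<sigma>1: "geodesic (carrier G) base.E (\<sigma>1 0) (\<sigma>1 (j1 - i1)) (j1 - i1) \<sigma>1"
      and \<iota>\<sigma>1: "\<And>k. k \<le> j1 - i1 \<Longrightarrow> \<alpha> (i1 + k) = \<iota> (\<sigma>1 k)"
      and \<sigma>1x: "\<sigma>1 0 \<in> gate x" and \<sigma>1y: "\<sigma>1 (j1 - i1) \<in> gate y"
      by metis
    have in\<alpha>: "\<iota> (\<sigma>1 r) \<in> \<alpha> ` {..l} \<union> \<beta> ` {..m}" if "r \<le> j1 - i1" for r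
    proof -
      have "i1 + r \<le> l" using that ij1 by simp
      then show ?thesis using \<iota>\<sigma>1[OF that, symmetric] by simp
    qed
    show ?thesis
    proof (cases "\<exists>q\<le>m. \<beta> q \<in> \<iota> ` carrier G")
      case B: True
      then obtain q' where q': "q' \<le> m" "\<beta> q' \<in> \<iota> ` carrier G" by blast
      from geodesic_meets_base[OF \<beta> q'] obtain i2 j2 \<sigma>2 where
        ij2: "i2 \<le> q'" "q' \<le> j2" "j2 \<le> m"
        and \<sigma>2: "geodesic (carrier G) base.E (\<sigma>2 0) (\<sigma>2 (j2 - i2)) (j2 - i2) \<sigma>2"
        and \<iota>\<sigma>2: "\<And>k. k \<le> j2 - i2 \<Longrightarrow> \<beta> (i2 + k) = \<iota> (\<sigma>2 k)"
        and \<sigma>2y: "\<sigma>2 0 \<in> gate y" and \<sigma>2z: "\<sigma>2 (j2 - i2) \<in> gate z"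
        by metis
      have in\<beta>: "\<iota> (\<sigma>2 r) \<in> \<alpha> ` {..l} \<union> \<beta> ` {..m}" if "r \<le> j2 - i2" for r
      proof -
        have "i2 + r \<le> m" using that ij2 by simp
        then show ?thesis using \<iota>\<sigma>2[OF that, symmetric] by simp
      qed
      \<comment> \<open>The end of the trace of \<alpha> serves as the third corner: the trace of
        \<alpha> ends exactly there, and that of \<beta> starts within distance 1.\<close>
      let ?b = "\<sigma>1 (j1 - i1)"
      obtain d1 where "graph_dist base.E (\<sigma> 0) ?b \<le> enat d1"
        using conn[OF gate_carrier[OF \<sigma>x] gate_carrier[OF \<sigma>1y]] by blast
      from geodesic_exists[OF this gate_carrier[OF \<sigma>x] base.adj_subset]
      obtain n1 \<tau>1 where \<tau>1: "geodesic (carrier G) base.E (\<sigma> 0) ?b n1 \<tau>1" by blast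
      obtain d2 where "graph_dist base.E ?b (\<sigma> (j - i)) \<le> enat d2"
        using conn[OF gate_carrier[OF \<sigma>1y] gate_carrier[OF \<sigma>z]] by blast
      from geodesic_exists[OF this gate_carrier[OF \<sigma>1y] base.adj_subset]
      obtain n2 \<tau>2 where \<tau>2: "geodesic (carrier G) base.E ?b (\<sigma> (j - i)) n2 \<tau>2" by blast
      from slim \<tau>1 \<tau>2 \<sigma> p(1) show ?thesis
      proof (cases rule: slimD)
        case (left e)
        from fellow[OF _ _ \<tau>1 \<sigma>1 gate_close[OF xyz(1) \<sigma>x \<sigma>1x] refl left(1)]
        obtain r where r: "r \<le> j1 - i1" "graph_dist base.E (\<tau>1 e) (\<sigma>1 r) \<le> enat (2 * \<delta> + 1)" by blast
        show ?thesis by (rule near[OF graph_dist_trans[OF left(2) r(2)] _ in\<alpha>[OF r(1)]]) simp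
      next
        case (right e)
        from fellow[OF _ _ \<tau>2 \<sigma>2 gate_close[OF xyz(2) \<sigma>1y \<sigma>2y] gate_close[OF xyz(3) \<sigma>z \<sigma>2z] right(1)]
        obtain r where r: "r \<le> j2 - i2" "graph_dist base.E (\<tau>2 e) (\<sigma>2 r) \<le> enat (2 * \<delta> + 1)" by blast
        show ?thesis by (rule near[OF graph_dist_trans[OF right(2) r(2)] _ in\<beta>[OF r(1)]]) simp
      qed
    next
      case False
      then have "gate y = gate z" by (intro geodesic_misses_base[OF \<beta>]) blast
      then have "graph_dist base.E (\<sigma> (j - i)) (\<sigma>1 (j1 - i1)) \<le> enat 1"
        using gate_close[OF xyz(3) \<sigma>z] \<sigma>1y by simp
      from fellow[OF _ _ \<sigma> \<sigma>1 gate_close[OF xyz(1) \<sigma>x \<sigma>1x] this p(1)]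
      obtain r where r: "r \<le> j1 - i1" "graph_dist base.E (\<sigma> p) (\<sigma>1 r) \<le> enat (2 * \<delta> + 1)" by blast
      show ?thesis by (rule near[OF r(2) _ in\<alpha>[OF r(1)]]) simp
    qed
  next
    case A: False
    then have xy: "gate x = gate y" by (intro geodesic_misses_base[OF \<alpha>]) blast
    show ?thesis
    proof (cases "\<exists>q\<le>m. \<beta> q \<in> \<iota> ` carrier G")
      case True
      then obtain q' where q': "q' \<le> m" "\<beta> q' \<in> \<iota> ` carrier G" by blast
      from geodesic_meets_base[OF \<beta> q'] obtain i2 j2 \<sigma>2 where
        ij2: "i2 \<le> q'" "q' \<le> j2" "j2 \<le> m"
        and \<sigma>2: "geodesic (carrier G) base.E (\<sigma>2 0) (\<sigma>2 (j2 - i2)) (j2 - i2) \<sigma>2"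
        and \<iota>\<sigma>2: "\<And>k. k \<le> j2 - i2 \<Longrightarrow> \<beta> (i2 + k) = \<iota> (\<sigma>2 k)"
        and \<sigma>2y: "\<sigma>2 0 \<in> gate y" and \<sigma>2z: "\<sigma>2 (j2 - i2) \<in> gate z"
        by metis
      have "graph_dist base.E (\<sigma> 0) (\<sigma>2 0) \<le> enat 1"
        using gate_close[OF xyz(1) \<sigma>x] \<sigma>2y xy by simp
      from fellow[OF _ _ \<sigma> \<sigma>2 this gate_close[OF xyz(3) \<sigma>z \<sigma>2z] p(1)]
      obtain r where r: "r \<le> j2 - i2" "graph_dist base.E (\<sigma> p) (\<sigma>2 r) \<le> enat (2 * \<delta> + 1)" by blast
      have "i2 + r \<le> m" using r(1) ij2 by simp
      then have "\<iota> (\<sigma>2 r) \<in> \<alpha> ` {..l} \<union> \<beta> ` {..m}" using \<iota>\<sigma>2[OF r(1), symmetric] by simp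
      then show ?thesis by (rule near[OF r(2), rotated]) simp
    next
      case False
      then have "gate y = gate z" by (intro geodesic_misses_base[OF \<beta>]) blast
      moreover have "x \<notin> \<iota> ` carrier G" using A geodesic_ends(1)[OF \<alpha>] by blast
      moreover have "z \<notin> \<iota> ` carrier G" using False geodesic_ends(2)[OF \<beta>] by blast
      ultimately show ?thesis using geodesic_same_gate[OF \<gamma> _ _ _ k(1)] xy k(2) by simp
    qed
  qed
qed

lemma slim_big:
  assumes slim: "slim \<delta> (carrier G) base.E"
    and gen: "generate G (X \<union> \<Union>(insert K \<H>)) = carrier G"
  shows "slim (3 * \<delta> + 1) (carrier M) big.E"
  unfolding slim_def
proof (intro allI impI, elim conjE)
  fix x y z l m n \<alpha> \<beta> \<gamma> k
  assume \<alpha>: "geodesic (carrier M) big.E x y l \<alpha>" and \<beta>: "geodesic (carrier M) big.E y z m \<beta>"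
    and \<gamma>: "geodesic (carrier M) big.E x z n \<gamma>" and k: "k \<le> n"
  \<comment> \<open>Left translations are isometries, so the point of \<gamma> in question may be
    moved to 1, which lies in \<iota>(G).\<close>
  define h where "h = inv\<^bsub>M\<^esub> (\<gamma> k)"
  have \<gamma>k: "\<gamma> k \<in> carrier M" using geodesic_mem[OF \<gamma> k] .
  then have h: "h \<in> carrier M" by (simp add: h_def)
  have "h \<otimes>\<^bsub>M\<^esub> \<gamma> k = \<iota> \<one>" using \<gamma>k by (simp add: h_def)
  then have "h \<otimes>\<^bsub>M\<^esub> \<gamma> k \<in> \<iota> ` carrier G" by blast
  from slim_at_base[OF slim gen big.geodesic_translate[OF \<alpha> h] big.geodesic_translate[OF \<beta> h]
      big.geodesic_translate[OF \<gamma> h] k this]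
  obtain q where q: "q \<in> (\<lambda>i. h \<otimes>\<^bsub>M\<^esub> \<alpha> i) ` {..l} \<union> (\<lambda>i. h \<otimes>\<^bsub>M\<^esub> \<beta> i) ` {..m}"
    "graph_dist big.E (h \<otimes>\<^bsub>M\<^esub> \<gamma> k) q \<le> enat (3 * \<delta> + 1)" by blast
  then obtain q' where q': "q' \<in> \<alpha> ` {..l} \<union> \<beta> ` {..m}" "q = h \<otimes>\<^bsub>M\<^esub> q'" by blast
  have "q' \<in> carrier M" using q'(1) geodesic_mem[OF \<alpha>] geodesic_mem[OF \<beta>] by auto
  then have "graph_dist big.E (\<gamma> k) q' \<le> enat (3 * \<delta> + 1)"
    using q(2) big.dist_translate[OF h \<gamma>k] unfolding q'(2) by simp
  then show "\<exists>p\<in>\<alpha> ` {..l} \<union> \<beta> ` {..m}. graph_dist big.E (\<gamma> k) p \<le> enat (3 * \<delta> + 1)"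
    using q'(1) by blast
qed

end

section \<open>Hyperbolic embedding in the amalgamated product\<close>

context amalgam
begin

lemma hyp_embedded_amalgam:
  assumes hyp: "hyp_embedded (insert K \<H>) G" and K\<H>: "K \<notin> \<H>"
  shows "hyp_embedded (insert L ((\<lambda>H. \<iota> ` H) ` \<H>)) M"
proof -
  from hyp have pair: "group_pair G (insert K \<H>)" unfolding hyp_embedded_def by (rule conjunct1)
  from hyp[unfolded hyp_embedded_def, THEN conjunct2] obtain X where X: "X \<subseteq> carrier G"
    and gX: "generate G (X \<union> \<Union>(insert K \<H>)) = carrier G"
    and hypX: "hyperbolic_graph (carrier G) (cayley_edges G X (insert K \<H>))"
    and ball: "\<forall>H\<in>insert K \<H>. \<forall>h\<in>H. \<forall>n. finite {h' \<in> H. rel_dist G X (insert K \<H>) H h h' \<le> enat n}"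
    by (elim exE conjE)
  from hypX obtain \<delta> where slim: "slim \<delta> (carrier G) (cayley_edges G X (insert K \<H>))"
    unfolding hyperbolic_graph_slim ..
  note balls = ball[rule_format]
  interpret amalgam_graph G M \<iota> K L N \<H> X
    using pair X K\<H>
    by (intro amalgam_graph.intro amalgam_graph_axioms.intro amalgam_axioms) (auto simp: group_pair_def)
  have pair': "group_pair M \<H>\<^sub>M"
    using pair M.is_group big.\<H> by (auto simp: group_pair_def)
  have "generate M (\<iota> ` X \<union> \<Union>\<H>\<^sub>M) = carrier M"
  proof
    let ?A = "generate M (\<iota> ` X \<union> \<Union>\<H>\<^sub>M)"
    have sub: "\<iota> ` X \<union> \<Union>\<H>\<^sub>M \<subseteq> carrier M"
      using big.X subgroup.subset[OF big.\<H>] by blast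
    then show "?A \<subseteq> carrier M" by (rule M.generate_incl)
    have A: "subgroup ?A M" by (rule M.generate_is_subgroup[OF sub])
    have "\<iota> ` (X \<union> \<Union>(insert K \<H>)) \<subseteq> ?A" using K_L by (auto intro!: generate.incl)
    then have "generate M (\<iota> ` (X \<union> \<Union>(insert K \<H>))) \<subseteq> ?A" by (rule M.generate_subgroup_incl[OF _ A])
    moreover have "X \<union> \<Union>(insert K \<H>) \<subseteq> carrier G" using X subgroup.subset[OF base.\<H>] by blast
    ultimately have "\<iota> ` carrier G \<subseteq> ?A" using \<iota>.generate_img gX by metis
    moreover have "L \<subseteq> ?A" by (auto intro!: generate.incl)
    ultimately have "generate M (\<iota> ` carrier G \<union> L) \<subseteq> ?A"
      by (intro M.generate_subgroup_incl[OF _ A] Un_least)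
    then show "carrier M \<subseteq> ?A" by (simp only: gen)
  qed
  moreover have "hyperbolic_graph (carrier M) big.E"
    unfolding hyperbolic_graph_slim by (rule exI, rule slim_big[OF slim gX])
  moreover have "finite {y \<in> H. rel_dist M (\<iota> ` X) \<H>\<^sub>M H x y \<le> enat n}"
    if H: "H \<in> \<H>\<^sub>M" "x \<in> H" for H x n
  proof -
    consider "H = L" | H' where "H' \<in> \<H>" "H = \<iota> ` H'" using H(1) by blast
    then show ?thesis
    proof cases
      case 1
      let ?B = "{k \<in> K. rel_dist G X (insert K \<H>) K \<one> k \<le> enat n}"
      \<comment> \<open>After translating the centre to 1, \<open>rel_dist_L\<close> places the ball
        inside the image of a ball of K.\<close>
      have "{y \<in> H. rel_dist M (\<iota> ` X) \<H>\<^sub>M H x y \<le> enat n} \<subseteq> (\<lambda>k. x \<otimes>\<^bsub>M\<^esub> \<iota> k) ` ?B"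
      proof
        fix y assume "y \<in> {y \<in> H. rel_dist M (\<iota> ` X) \<H>\<^sub>M H x y \<le> enat n}"
        then have y: "y \<in> L" "rel_dist M (\<iota> ` X) \<H>\<^sub>M L x y \<le> enat n" using 1 by auto
        have x: "x \<in> L" using H 1 by simp
        note c = L_carrier[OF x] L_carrier[OF y(1)]
        have "rel_dist M (\<iota> ` X) \<H>\<^sub>M L (inv\<^bsub>M\<^esub> x \<otimes>\<^bsub>M\<^esub> x) (inv\<^bsub>M\<^esub> x \<otimes>\<^bsub>M\<^esub> y) \<le> enat n"
          using big.rel_dist_translate[OF _ L_inv[OF x] y(2)] by simp
        then have "rel_dist M (\<iota> ` X) \<H>\<^sub>M L \<one>\<^bsub>M\<^esub> (inv\<^bsub>M\<^esub> x \<otimes>\<^bsub>M\<^esub> y) \<le> enat n" using c by simp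
        from rel_dist_L[OF L_mult[OF L_inv[OF x] y(1)] this]
        obtain k where k: "k \<in> ?B" "inv\<^bsub>M\<^esub> x \<otimes>\<^bsub>M\<^esub> y = \<iota> k" by blast
        have "y = x \<otimes>\<^bsub>M\<^esub> \<iota> k" using c by (simp add: k(2)[symmetric] M.m_assoc[symmetric])
        then show "y \<in> (\<lambda>k. x \<otimes>\<^bsub>M\<^esub> \<iota> k) ` ?B" using k(1) by (rule image_eqI)
      qed
      moreover have "finite ?B" using subgroup.one_closed[OF K] by (intro balls) auto
      ultimately show ?thesis by (meson finite_imageI finite_subset)
    next
      case 2
      then obtain a where a: "a \<in> H'" "x = \<iota> a" using H(2) by blast
      have sub: "b \<in> carrier G" if "b \<in> H'" for b using subgroup.mem_carrier[OF \<H>] 2 that by blast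
      let ?B = "{b \<in> H'. rel_dist G X (insert K \<H>) H' a b \<le> enat n}"
      have "{y \<in> H. rel_dist M (\<iota> ` X) \<H>\<^sub>M H x y \<le> enat n} \<subseteq> \<iota> ` ?B"
      proof
        fix y assume "y \<in> {y \<in> H. rel_dist M (\<iota> ` X) \<H>\<^sub>M H x y \<le> enat n}"
        then obtain b where b: "b \<in> H'" "y = \<iota> b"
          "rel_dist M (\<iota> ` X) \<H>\<^sub>M (\<iota> ` H') (\<iota> a) (\<iota> b) \<le> enat n" using 2 a by auto
        then have "b \<in> ?B" using rel_dist_project[OF 2(1) sub[OF a(1)] sub[OF b(1)]] by simp
        then show "y \<in> \<iota> ` ?B" using b(2) by blast
      qed
      moreover have "finite ?B" using 2 a by (intro balls) auto
      ultimately show ?thesis by (meson finite_imageI finite_subset)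
    qed
  qed
  ultimately show ?thesis
    unfolding hyp_embedded_def using pair' big.X by (intro conjI exI[of _ "\<iota> ` X"]) simp_all
qed

end


section \<open>HNN extensions as amalgamated products\<close>

sublocale hnn_setup \<subseteq> amalgam: amalgam G M \<iota> K L N
proof (intro amalgam.intro amalgam_axioms.intro)
  show "subgroup L M" using K_carrier by (intro M.generate_is_subgroup) auto
  show "\<iota> ` K \<subseteq> L" by (auto intro: generate.incl)
  show "generate M (\<iota> ` carrier G \<union> L) = carrier M" by (rule M_generate)
qed (simp_all add: is_group M.is_group \<iota>.homh \<iota>_inj K N_carrier N_base L_ping base_in_N)

theorem corollary1p4:
  fixes G :: "('a, 'b) monoid_scheme" (structure)
    and \<H> :: "'a set set" and K C :: "'a set" and s :: 'a and \<phi> :: "'a \<Rightarrow> 'a"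
  assumes "group_pair G (\<H> \<union> {K})"
    and "K \<notin> \<H>"
    and "subgroup C (G\<lparr>carrier := K\<rparr>)"
    and "s \<in> carrier G"
    and "\<phi> \<in> mon (G\<lparr>carrier := C\<rparr>) (G\<lparr>carrier := s <# K #> inv s\<rparr>)"
  shows "let G' = HNN G C \<phi>;
             \<iota> = hnn_base G C \<phi>;
             t = hnn_stable G C \<phi>;
             L = generate G' (\<iota> ` K \<union> {\<iota> (inv s) \<otimes>\<^bsub>G'\<^esub> t});
             \<H>' = (\<lambda>H. \<iota> ` H) ` \<H> \<union> {L}
         in (hyp_embedded (\<H> \<union> {K}) G \<longrightarrow> hyp_embedded \<H>' G') \<and>
            (class_D G (\<H> \<union> {K}) \<longrightarrow> class_D G' \<H>') \<and>
            (\<forall>g\<in>carrier G.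
               (\<exists>Q\<in>\<H> \<union> {K}. \<exists>q\<in>Q. conjugate_in G g q) \<longleftrightarrow>
               (\<exists>H\<in>\<H>'. \<exists>h\<in>H. conjugate_in G' (\<iota> g) h))"
proof -
  interpret hnn_setup G K C s \<phi>
    using assms by (intro hnn_setup.intro hnn_setup_axioms.intro) (auto simp: group_pair_def)
  have \<H>: "H \<subseteq> carrier G" if "H \<in> \<H>" for H
    using assms(1) that subgroup.subset unfolding group_pair_def by blast
  have "hyp_embedded (\<H> \<union> {K}) G \<longrightarrow> hyp_embedded ((\<lambda>H. \<iota> ` H) ` \<H> \<union> {L}) M"
    using amalgam.hyp_embedded_amalgam[OF _ assms(2)] by simp
  moreover have "class_D G (\<H> \<union> {K}) \<longrightarrow> class_D M ((\<lambda>H. \<iota> ` H) ` \<H> \<union> {L})"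
    using amalgam.class_D_amalgam[OF _ assms(2)] by simp
  ultimately show ?thesis
    unfolding Let_def using amalgam.conjugate_iff[OF _ \<H>] by (intro conjI ballI)
qed

end
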